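(* Let $\phi\in\mathbb{R}[x_1,\dots,x_4]$ be a unimodular Hessian potential of index $1$. Then $\phi$ admits a (real) constant pivot if and only if $\operatorname{rank}(\mu_\phi)\leq55$.
   Context: A polynomial $\phi\in\mathbb{R}[x_1,\dots,x_n]$ is a unimodular Hessian potential of index $q$ if $\det(\operatorname{Hess}(\phi))$ is the constant polynomial $1$ or the constant polynomial $-1$, and the symmetric matrix $\operatorname{Hess}(\phi)_x$ has index $q$ (i.e. exactly $q$ negative eigenvalues, counted with multiplicity) at every $x\in\mathbb{R}^n$. A constant pivot for $\phi$ is a nonzero constant vector $\xi\in\mathbb{R}^n$ such that the second directional derivative $D_\xi^2\phi=\langle\operatorname{Hess}(\phi)\xi,\xi\rangle$ is a constant function. Put $V_{\mathbb{C}}:=\mathbb{C}^4$. For a polynomial $\phi\in\mathbb{R}[x_1,\dots,x_4]$ (extended to $V_{\mathbb{C}}$) and $c\in V_{\mathbb{C}}$, regard $D_\zeta^2\phi(c)=\sum_{i,j}\partial_i\partial_j\phi(c)\zeta_i\zeta_j$ as a quadratic form in $\zeta\in V_{\mathbb{C}}$. The Hesse system of $\phi$ is $$\mathcal{H}_\phi:=\operatorname{span}_{\mathbb{C}}\{D_\zeta^2\phi(a)-D_\zeta^2\phi(b):a,b\in V_{\mathbb{C}}\}\subseteq\operatorname{Sym}^2(V_{\mathbb{C}}^* ),$$ and $\mu_\phi\colon\operatorname{Sym}^3(V_{\mathbb{C}}^* )\otimes_{\mathbb{C}}\mathcal{H}_\phi\rightarrow\operatorname{Sym}^5(V_{\mathbb{C}}^*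 )$ is the $\mathbb{C}$-linear multiplication map determined by $\mu_\phi(C\otimes q)=Cq$. *)

theory Defs
  imports "HOL-Analysis.Analysis" "HOL-Library.Poly_Mapping"
    "HOL-Computational_Algebra.Polynomial"
begin

section \<open>Finitely supported functions as a vector space\<close>

abbreviation "lookup \<equiv> Poly_Mapping.lookup"
abbreviation "keys \<equiv> Poly_Mapping.keys"

definition pscale :: "'b::mult_zero \<Rightarrow> ('a \<Rightarrow>\<^sub>0 'b) \<Rightarrow> ('a \<Rightarrow>\<^sub>0 'b)"
  where "pscale c p = Poly_Mapping.map ((*) c) p"

lemma lookup_pscale [simp]: "lookup (pscale c p) k = c * lookup p k"
  unfolding pscale_def by transfer (auto simp: when_def)

lemma keys_pscale: "keys (pscale c p) \<subseteq> keys p"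
  by (auto simp: in_keys_iff)

lemma pscale_single [simp]: "pscale c (Poly_Mapping.single k a) = Poly_Mapping.single k (c * a)"
  by (rule poly_mapping_eqI) (auto simp: Poly_Mapping.lookup_single when_def)

global_interpretation pvs: vector_space "pscale :: 'b::field \<Rightarrow> ('a \<Rightarrow>\<^sub>0 'b) \<Rightarrow> ('a \<Rightarrow>\<^sub>0 'b)"
  by unfold_locales (auto intro!: poly_mapping_eqI simp: Poly_Mapping.lookup_add algebra_simps)

section \<open>Multivariate polynomials\<close>

text \<open>
  A polynomial in the variables indexed by the finite type \<open>'n\<close> maps exponent vectors to
  coefficients; the ring structure is the convolution product of
  \<^theory>\<open>HOL-Library.Poly_Mapping\<close>.
\<close>

type_synonym ('n, 'a) mpol = "('n \<Rightarrow>\<^sub>0 nat) \<Rightarrow>\<^sub>0 'a"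

definition peval :: "('n::finite, 'a::comm_semiring_1) mpol \<Rightarrow> 'a ^ 'n \<Rightarrow> 'a"
  where "peval p x = (\<Sum>m\<in>keys p. lookup p m * (\<Prod>i\<in>UNIV. (x $ i) ^ lookup m i))"

text \<open>
  The subtraction of exponent vectors is truncated, but where it truncates
  the coefficient vanishes.
\<close>

definition pdiff :: "'n \<Rightarrow> ('n, 'a::comm_semiring_1) mpol \<Rightarrow> ('n, 'a) mpol"
  where "pdiff i p = (\<Sum>m\<in>keys p.
    Poly_Mapping.single (m - Poly_Mapping.single i 1) (of_nat (lookup m i) * lookup p m))"

definition hess :: "('n::finite, 'a::comm_semiring_1) mpol \<Rightarrow> ('n, 'a) mpol ^ 'n ^ 'n"
  where "hess p = (\<chi> i j. pdiff i (pdiff j p))"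

definition hess_at :: "('n::finite, 'a::comm_semiring_1) mpol \<Rightarrow> 'a ^ 'n \<Rightarrow> 'a ^ 'n ^ 'n"
  where "hess_at p x = (\<chi> i j. peval (hess p $ i $ j) x)"

section \<open>Unimodular Hessian potentials and constant pivots\<close>

definition charpoly :: "real ^ 'n ^ 'n \<Rightarrow> real poly"
  where "charpoly A = det (\<chi> i j. (if i = j then [:0, 1:] else 0) - [:A $ i $ j:])"

definition neg_index :: "real ^ 'n ^ 'n \<Rightarrow> nat"
  where "neg_index A = (\<Sum>r | r < 0 \<and> poly (charpoly A) r = 0. Polynomial.order r (charpoly A))"

definition unimodular_hessian_potential :: "nat \<Rightarrow> ('n::finite, real) mpol \<Rightarrow> bool"
  where "unimodular_hessian_potential q \<phi> \<longleftrightarrow>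
    (det (hess \<phi>) = 1 \<or> det (hess \<phi>) = - 1) \<and> (\<forall>x. neg_index (hess_at \<phi> x) = q)"

definition constant_pivot :: "('n::finite, real) mpol \<Rightarrow> real ^ 'n \<Rightarrow> bool"
  where "constant_pivot \<phi> \<xi> \<longleftrightarrow>
    \<xi> \<noteq> 0 \<and> (\<exists>c. \<forall>x. (hess_at \<phi> x *v \<xi>) \<bullet> \<xi> = c)"

section \<open>The Hesse system\<close>

text \<open>
  \<open>Sym\<^sup>k\<close> of the dual of \<open>\<complex>\<^sup>n\<close> is the space of homogeneous polynomials of degree \<open>k\<close>.
\<close>

definition Sym :: "nat \<Rightarrow> ('n::finite, complex) mpol set"
  where "Sym k = {p. \<forall>m\<in>keys p. (\<Sum>i\<in>UNIV. lookup m i) = k}"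

definition complexify :: "('n, real) mpol \<Rightarrow> ('n, complex) mpol"
  where "complexify \<phi> = Poly_Mapping.map complex_of_real \<phi>"

text \<open>The second directional derivative at \<open>c\<close>, as a quadratic form in the direction.\<close>

definition hess_form :: "('n::finite, real) mpol \<Rightarrow> complex ^ 'n \<Rightarrow> ('n, complex) mpol"
  where "hess_form \<phi> c = (\<Sum>i\<in>UNIV. \<Sum>j\<in>UNIV.
    Poly_Mapping.single (Poly_Mapping.single i 1 + Poly_Mapping.single j 1)
      (hess_at (complexify \<phi>) c $ i $ j))"

definition hesse_system :: "('n::finite, real) mpol \<Rightarrow> ('n, complex) mpol set"
  where "hesse_system \<phi> = pvs.span {hess_form \<phi> a - hess_form \<phi> b | a b. True}"

lemma subspace_Sym: "pvs.subspace (Sym k)"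
proof (rule pvs.subspaceI)
  show "0 \<in> Sym k" by (simp add: Sym_def)
  show "x + y \<in> Sym k" if "x \<in> Sym k" "y \<in> Sym k" for x y :: "('a, complex) mpol"
    using that Poly_Mapping.keys_add[of x y] by (fastforce simp: Sym_def)
  show "pscale c x \<in> Sym k" if "x \<in> Sym k" for c and x :: "('a, complex) mpol"
    using that keys_pscale[of c x] by (fastforce simp: Sym_def)
qed

lemma hess_form_Sym: "hess_form \<phi> c \<in> Sym 2"
proof -
  have "Poly_Mapping.single (Poly_Mapping.single i 1 + Poly_Mapping.single j 1) a \<in> Sym 2"
    for i j :: 'a and a
    by (auto simp: Sym_def Poly_Mapping.lookup_add Poly_Mapping.lookup_single when_def
        sum.distrib)
  then show ?thesis
    unfolding hess_form_def by (intro pvs.subspace_sum[OF subspace_Sym]) auto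
qed

lemma hesse_system_Sym: "hesse_system \<phi> \<subseteq> Sym 2"
  unfolding hesse_system_def
  by (rule pvs.span_minimal[OF _ subspace_Sym])
    (auto intro: pvs.subspace_diff[OF subspace_Sym] hess_form_Sym)

section \<open>The multiplication map\<close>

text \<open>
  The tensor product of two subspaces \<open>U\<close>, \<open>W\<close> of polynomials: the free vector space on
  \<open>U \<times> W\<close> modulo the bilinearity relations, with cosets as elements.
\<close>

abbreviation (input) pair_gen :: "'u \<Rightarrow> 'w \<Rightarrow> ('u \<times> 'w) \<Rightarrow>\<^sub>0 complex"
  where "pair_gen u w \<equiv> Poly_Mapping.single (u, w) 1"

definition bilinear_rels ::
  "('n, complex) mpol set \<Rightarrow> ('n, complex) mpol set \<Rightarrow>
    ((('n, complex) mpol \<times> ('n, complex) mpol) \<Rightarrow>\<^sub>0 complex) set"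
  where "bilinear_rels U W = pvs.span (
      {pair_gen (u + u') w - pair_gen u w - pair_gen u' w | u u' w. u \<in> U \<and> u' \<in> U \<and> w \<in> W}
    \<union> {pair_gen u (w + w') - pair_gen u w - pair_gen u w' | u w w'. u \<in> U \<and> w \<in> W \<and> w' \<in> W}
    \<union> {pair_gen (pscale c u) w - pscale c (pair_gen u w) | c u w. u \<in> U \<and> w \<in> W}
    \<union> {pair_gen u (pscale c w) - pscale c (pair_gen u w) | c u w. u \<in> U \<and> w \<in> W})"

definition tensor_equiv ::
  "('n, complex) mpol set \<Rightarrow> ('n, complex) mpol set \<Rightarrow>
    ((('n, complex) mpol \<times> ('n, complex) mpol) \<Rightarrow>\<^sub>0 complex) rel"
  where "tensor_equiv U W =
    {(x, y). keys x \<subseteq> U \<times> W \<and> keys y \<subseteq> U \<times> W \<and> x - y \<in> bilinear_rels U W}"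

definition tensor_space ::
  "('n, complex) mpol set \<Rightarrow> ('n, complex) mpol set \<Rightarrow>
    ((('n, complex) mpol \<times> ('n, complex) mpol) \<Rightarrow>\<^sub>0 complex) set set"
  where "tensor_space U W = {x. keys x \<subseteq> U \<times> W} // tensor_equiv U W"

definition mult_free ::
  "((('n, complex) mpol \<times> ('n, complex) mpol) \<Rightarrow>\<^sub>0 complex) \<Rightarrow> ('n, complex) mpol"
  where "mult_free x = (\<Sum>k\<in>keys x. pscale (lookup x k) (fst k * snd k))"

text \<open>
  \<open>mult_free\<close> is constant on the cosets, and the induced map is linear and sends
  the class of \<open>(u, w)\<close> to \<open>u * w\<close>; see the lemmas below.
\<close>

definition tensor_mult ::
  "((('n, complex) mpol \<times> ('n, complex) mpol) \<Rightarrow>\<^sub>0 complex) set \<Rightarrow> ('n, complex) mpol"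
  where "tensor_mult T = the_elem (mult_free ` T)"

definition mu_rank :: "('n::finite, real) mpol \<Rightarrow> nat"
  where "mu_rank \<phi> = pvs.dim (tensor_mult ` tensor_space (Sym 3) (hesse_system \<phi>))"

lemma mult_free_superset:
  assumes "finite K" "keys x \<subseteq> K"
  shows "mult_free x = (\<Sum>k\<in>K. pscale (lookup x k) (fst k * snd k))"
  unfolding mult_free_def
  by (rule sum.mono_neutral_left) (use assms in \<open>auto simp: in_keys_iff\<close>)

lemma mult_free_add: "mult_free (x + y) = mult_free x + mult_free y"
proof -
  have "keys (x + y) \<subseteq> keys x \<union> keys y" by (rule Poly_Mapping.keys_add)
  then show ?thesis
    by (simp add: mult_free_superset[of "keys x \<union> keys y"] Poly_Mapping.lookup_add
        pvs.scale_left_distrib sum.distrib)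
qed

lemma mult_free_pscale: "mult_free (pscale c x) = pscale c (mult_free x)"
  by (subst mult_free_superset[OF finite_keys keys_pscale])
    (simp add: mult_free_def pvs.scale_sum_right)

lemma mult_free_diff: "mult_free (x - y) = mult_free x - mult_free y"
  using mult_free_add[of "x - y" y] by (simp add: algebra_simps)

lemma mult_free_single: "mult_free (Poly_Mapping.single (u, w) c) = pscale c (u * w)"
  by (simp add: mult_free_superset[of "{(u, w)}"])

lemma pscale_mult_left: "pscale c p * q = pscale c (p * (q :: ('n, complex) mpol))"
  by (simp add: pscale_def Poly_Mapping.mult_map_scale_conv_mult mult.assoc)

lemma pscale_mult_right: "p * pscale c q = pscale c (p * (q :: ('n, complex) mpol))"
  using pscale_mult_left[of c q p] by (simp add: mult.commute)

lemma mult_free_bilinear_rels: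
  assumes "r \<in> bilinear_rels U W"
  shows "mult_free r = 0"
  using assms unfolding bilinear_rels_def
proof (induction rule: pvs.span_induct)
  case base
  show ?case
    by (intro pvs.subspaceI)
      (auto simp: mult_free_add mult_free_pscale, simp add: mult_free_def)
next
  case (step x)
  then show ?case
    by (auto simp: mult_free_diff mult_free_single mult_free_pscale pscale_mult_left
        pscale_mult_right distrib_left distrib_right)
qed

lemma tensor_mult_class:
  assumes "keys x \<subseteq> U \<times> W"
  shows "tensor_mult (tensor_equiv U W `` {x}) = mult_free x"
proof -
  have "x \<in> tensor_equiv U W `` {x}"
    using assms by (simp add: tensor_equiv_def bilinear_rels_def pvs.span_zero)
  moreover have "mult_free y = mult_free x" if "y \<in> tensor_equiv U W `` {x}" for y
    using that mult_free_bilinear_rels[of "x - y" U W]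
    by (simp add: tensor_equiv_def mult_free_diff)
  ultimately have "mult_free ` (tensor_equiv U W `` {x}) = {mult_free x}" by blast
  then show ?thesis by (simp add: tensor_mult_def)
qed

lemma tensor_mult_pure:
  assumes "u \<in> U" "w \<in> W"
  shows "tensor_mult (tensor_equiv U W `` {pair_gen u w}) = u * w"
  using assms by (simp add: tensor_mult_class mult_free_single)

lemma tensor_mult_linear:
  assumes "keys x \<subseteq> U \<times> W" "keys y \<subseteq> U \<times> W"
  shows "tensor_mult (tensor_equiv U W `` {pscale a x + pscale b y}) =
    pscale a (tensor_mult (tensor_equiv U W `` {x})) +
    pscale b (tensor_mult (tensor_equiv U W `` {y}))"
proof -
  have "keys (pscale a x + pscale b y) \<subseteq> U \<times> W"
    using assms keys_pscale[of a x] keys_pscale[of b y]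
      Poly_Mapping.keys_add[of "pscale a x" "pscale b y"] by blast
  then show ?thesis
    using assms by (simp add: tensor_mult_class mult_free_add mult_free_pscale)
qed

end

theory Submission
  imports Defs
    "HOL-Computational_Algebra.Fundamental_Theorem_Algebra"
    "HOL-Computational_Algebra.Polynomial_Factorial"
    "HOL-Computational_Algebra.Field_as_Ring"
begin

text \<open>
  Both sides of the equivalence say that the Hesse system \<open>H\<close> of \<open>\<phi>\<close> has a common zero
  \<open>z \<noteq> 0\<close> in complex four-space. A constant pivot is a common zero that happens to be real.

  The rank side is commutative algebra (\<open>mu_rank_le_iff_common_zero\<close>). The target, the quintic forms,
  has dimension 56, so a rank of at most 55 means that \<open>Sym 3 \<sqdot> H\<close> is not all of \<open>Sym 5\<close>. A
  common zero prevents this, as all products vanish there. If there is none, then by the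
  Nullstellensatz the ideal of \<open>H\<close> contains powers of all variables, and a Noether normalization replaces \<open>H\<close> by four of its
  elements with the same property (\<open>few_generators\<close>). Four quadrics in four variables without common
  zero form a complete intersection, whose quotient ring ends in degree \<open>4 \<sqdot> (2 - 1) = 4\<close>; hence all
  quintics lie in the ideal (\<open>quadrics_generate_above_socle\<close>). This is proved by the residue
  duality of Scheja and Storch, which for quadrics is completely explicit.

  The pivot side uses that the Hessian determinant is a nonzero constant (\<open>pivot_iff_common_zero\<close>).
  A common zero \<open>z\<close> is a direction in which the second derivative of \<open>\<phi>\<close> is constant, and then its
  conjugate is another one. If \<open>z\<close> is not proportional to a real vector, \<open>z\<close> and its conjugate
  are linearly independent, and the point is that the mixed second derivative \<open>\<alpha>\<close> in these two
  directions is constant as well (\<open>mixed_derivative_constant\<close>); so every combination of them, in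
  particular the real and the imaginary part of \<open>z\<close>, is a direction with constant second derivative.
  For the constancy of \<open>\<alpha>\<close>, note that \<open>\<alpha>\<close> is invariant under translations by the plane spanned by
  \<open>z\<close> and its conjugate, and that along this plane with coordinates \<open>s\<close>, \<open>t\<close> all entries of the
  Hessian matrix are polynomials of degree at most 2. The determinant does not involve \<open>s\<close> and \<open>t\<close>,
  and the vanishing of its coefficients yields, on every line transversal to the plane, equations
  between univariate polynomials that have no solution with nonconstant \<open>\<alpha>\<close>.
\<close>

section \<open>Ring homomorphisms and determinants\<close>

locale ring_1_hom =
  fixes h :: "'a::comm_ring_1 \<Rightarrow> 'b::comm_ring_1"
  assumes hom_one: "h 1 = 1"
    and hom_add: "h (x + y) = h x + h y"
    and hom_mult: "h (x * y) = h x * h y"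
begin

lemma hom_zero: "h 0 = 0"
  using hom_add[of 0 0] by simp

lemma hom_uminus: "h (- x) = - h x"
  using hom_add[of x "- x"] by (simp add: hom_zero eq_neg_iff_add_eq_0 add.commute)

lemma hom_diff: "h (x - y) = h x - h y"
  using hom_add[of x "- y"] by (simp add: hom_uminus)

lemma hom_sum: "h (sum f A) = (\<Sum>a\<in>A. h (f a))"
  by (induction A rule: infinite_finite_induct) (simp_all add: hom_zero hom_add)

lemma hom_prod: "h (prod f A) = (\<Prod>a\<in>A. h (f a))"
  by (induction A rule: infinite_finite_induct) (simp_all add: hom_one hom_mult)

lemma hom_power: "h (x ^ n) = h x ^ n"
  by (induction n) (simp_all add: hom_one hom_mult)

lemma hom_of_int: "h (of_int n) = of_int n"
proof -
  have "h (of_nat m) = of_nat m" for m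
    by (induction m) (simp_all add: hom_zero hom_one hom_add)
  then show ?thesis by (cases n rule: int_cases2) (simp_all add: hom_uminus)
qed

lemma hom_det: "h (det A) = det (\<chi> i j. h (A $ i $ j))"
  by (simp add: det_def hom_sum hom_mult hom_prod hom_of_int)

end

text \<open>Cramer's rule without division: scaling column \<open>k\<close> by \<open>x $ k\<close> and then adding the
  multiples \<open>x $ j\<close> of the other columns turns it into \<open>A *v x\<close>.\<close>

lemma cramer_column:
  fixes A :: "'a::comm_ring_1^'n^'n"
  shows "det (\<chi> i j. if j = k then (A *v x) $ i else A $ i $ j) = x $ k * det A"
proof -
  have "det (\<chi> i j. if j = k then (A *v x) $ i else A $ i $ j)
      = det (transpose (\<chi> i j. if j = k then (A *v x) $ i else A $ i $ j))"
    by (rule det_transpose[symmetric])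
  also have "transpose (\<chi> i j. if j = k then (A *v x) $ i else A $ i $ j)
      = (\<chi> i. if i = k then (\<Sum>j\<in>UNIV. x $ j *s column j A) else column i A)"
    by (simp add: vec_eq_iff transpose_def column_def matrix_vector_mult_def mult.commute
        sum_component)
  also have "det \<dots> = (\<Sum>j\<in>UNIV. det (\<chi> i. if i = k then x $ j *s column j A else column i A))"
    by (rule det_linear_row_sum) simp
  also have "\<dots> = (\<Sum>j\<in>UNIV. x $ j * det (\<chi> i. if i = k then column j A else column i A))"
    by (intro sum.cong refl det_row_mul)
  also have "\<dots> = (\<Sum>j\<in>UNIV. if j = k then x $ j * det A else 0)"
  proof (intro sum.cong refl)
    fix j
    have tr: "(\<chi> i. column i A) = transpose A"
      by (simp add: vec_eq_iff transpose_def column_def)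
    show "x $ j * det (\<chi> i. if i = k then column j A else column i A)
        = (if j = k then x $ j * det A else 0)"
    proof (cases "j = k")
      case True
      then have "(\<chi> i. if i = k then column j A else column i A) = transpose A"
        by (simp add: vec_eq_iff transpose_def column_def)
      with True show ?thesis by simp
    next
      case False
      have "det (\<chi> i. if i = k then column j A else column i A) = 0"
        by (rule det_identical_rows[of j k]) (use False in \<open>auto simp: row_def\<close>)
      with False show ?thesis by simp
    qed
  qed
  also have "\<dots> = x $ k * det A" by simp
  finally show ?thesis .
qed

section \<open>Polynomial mappings as polynomials\<close>

abbreviation monom :: "('n \<Rightarrow>\<^sub>0 nat) \<Rightarrow> 'a \<Rightarrow> ('n, 'a::zero) mpol"
  where "monom \<equiv> Poly_Mapping.single"

abbreviation Const :: "'a \<Rightarrow> ('n, 'a::zero) mpol"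
  where "Const \<equiv> Poly_Mapping.single 0"

abbreviation Var :: "'n \<Rightarrow> ('n, 'a::zero_neq_one) mpol"
  where "Var i \<equiv> Poly_Mapping.single (Poly_Mapping.single i 1) 1"

lemma sum_single_lookup: "p = (\<Sum>m\<in>keys p. Poly_Mapping.single m (lookup p m))"
  by (rule poly_mapping_eqI)
    (simp add: Poly_Mapping.lookup_sum Poly_Mapping.lookup_single when_def in_keys_iff)

lemma poly_mapping_single_induct [case_names single add]:
  fixes p :: "'k \<Rightarrow>\<^sub>0 'b::comm_monoid_add"
  assumes "\<And>m a. P (Poly_Mapping.single m a)" "\<And>p q. P p \<Longrightarrow> P q \<Longrightarrow> P (p + q)"
  shows "P p"
proof -
  have "P (\<Sum>m\<in>K. Poly_Mapping.single m (lookup p m))" if "finite K" for K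
    using that
  proof (induction K)
    case empty
    show ?case using assms(1)[of undefined 0] by simp
  qed (simp add: assms)
  from this[of "keys p"] show ?thesis by (simp flip: sum_single_lookup)
qed

lemma ring_1_hom_single: "ring_1_hom (Poly_Mapping.single (0::'k::comm_monoid_add))"
  by unfold_locales (simp_all add: Poly_Mapping.single_add Poly_Mapping.mult_single)

lemma lookup_map_hom:
  assumes "h 0 = 0"
  shows "lookup (Poly_Mapping.map h p) k = h (lookup p k)"
  using assms by transfer (auto simp: when_def)

lemma ring_1_hom_map:
  fixes h :: "'a::comm_ring_1 \<Rightarrow> 'b::comm_ring_1"
  assumes "ring_1_hom h"
  shows "ring_1_hom (Poly_Mapping.map h :: ('k::comm_monoid_add \<Rightarrow>\<^sub>0 'a) \<Rightarrow> _)"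
proof -
  interpret ring_1_hom h by fact
  have add: "Poly_Mapping.map h (p + q) = Poly_Mapping.map h p + Poly_Mapping.map h q"
    for p q :: "'k \<Rightarrow>\<^sub>0 'a"
    by (rule poly_mapping_eqI) (simp add: lookup_map_hom hom_zero Poly_Mapping.lookup_add hom_add)
  have single: "Poly_Mapping.map h (Poly_Mapping.single m a) = Poly_Mapping.single m (h a)"
    for m :: 'k and a
    by (simp add: hom_zero)
  have "Poly_Mapping.map h (p * q) = Poly_Mapping.map h p * Poly_Mapping.map h q"
    for p q :: "'k \<Rightarrow>\<^sub>0 'a"
  proof (induction p rule: poly_mapping_single_induct)
    case (single m a)
    show ?case
      by (induction q rule: poly_mapping_single_induct)
        (simp_all add: Poly_Mapping.mult_single hom_mult distrib_left add hom_zero)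
  qed (simp add: add distrib_right)
  moreover have "Poly_Mapping.map h (1 :: 'k \<Rightarrow>\<^sub>0 'a) = 1"
    using single[of 0 1] by (simp add: hom_one)
  ultimately show ?thesis
    by unfold_locales (simp_all add: add)
qed

section \<open>Evaluation\<close>

lemma peval_superset:
  assumes "finite K" "keys p \<subseteq> K"
  shows "peval p x = (\<Sum>m\<in>K. lookup p m * (\<Prod>i\<in>UNIV. (x $ i) ^ lookup m i))"
  unfolding peval_def
  by (rule sum.mono_neutral_left) (use assms in \<open>auto simp: in_keys_iff\<close>)

lemma peval_single: "peval (monom m a) x = a * (\<Prod>i\<in>UNIV. (x $ i) ^ lookup m i)"
  by (simp add: peval_superset[of "{m}"])

lemma peval_add: "peval (p + q) x = peval p x + peval q x"
proof -
  have "keys (p + q) \<subseteq> keys p \<union> keys q" by (rule Poly_Mapping.keys_add)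
  then show ?thesis
    by (simp add: peval_superset[of "keys p \<union> keys q"] Poly_Mapping.lookup_add
        distrib_right sum.distrib)
qed

lemma peval_mult: "peval (p * q) x = peval p x * peval q x"
proof (induction p rule: poly_mapping_single_induct)
  case (single m a)
  show ?case
    by (induction q rule: poly_mapping_single_induct)
      (simp_all add: Poly_Mapping.mult_single peval_add peval_single
        Poly_Mapping.lookup_add power_add prod.distrib algebra_simps)
qed (simp add: peval_add distrib_right)

lemma peval_Const: "peval (Const c) x = c"
  by (simp add: peval_single)

lemma peval_1: "peval 1 x = 1"
  using peval_Const[of 1 x] by simp

lemma peval_Var: "peval (Var i) x = x $ i"
proof -
  have "(\<Prod>j\<in>UNIV. (x $ j) ^ lookup (Poly_Mapping.single i 1) j)
      = (\<Prod>j\<in>UNIV. if j = i then x $ j else 1)"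
    by (rule prod.cong) (auto simp: Poly_Mapping.lookup_single when_def)
  then show ?thesis by (simp add: peval_single)
qed

interpretation peval: ring_1_hom "\<lambda>p. peval p x" for x :: "'a::comm_ring_1^'n"
  by unfold_locales (simp_all add: peval_1 peval_add peval_mult)

lemma pscale_eq: "pscale c p = Const c * (p :: ('n, 'a::comm_ring_1) mpol)"
  by (simp add: pscale_def Poly_Mapping.mult_map_scale_conv_mult)

lemma peval_pscale: "peval (pscale c p) x = c * peval p (x :: 'a::comm_ring_1^'n)"
  by (simp add: pscale_eq peval_mult peval_Const)

text \<open>In a mixed radix system with large enough bases, the exponents are the digits of the weighted
  degree.\<close>

lemma separating_weights:
  fixes I :: "('v \<Rightarrow> nat) set"
  assumes "finite V" "finite I"
  shows "\<exists>w. \<forall>e\<in>I. \<forall>e'\<in>I. (\<Sum>i\<in>V. w i * e i) = (\<Sum>i\<in>V. w i * e' i) \<longrightarrow> (\<forall>i\<in>V. e i = e' i)"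
  using assms(1)
proof (induction V)
  case (insert v V)
  then obtain w where w: "\<And>e e'. e \<in> I \<Longrightarrow> e' \<in> I \<Longrightarrow>
      (\<Sum>i\<in>V. w i * e i) = (\<Sum>i\<in>V. w i * e' i) \<Longrightarrow> \<forall>i\<in>V. e i = e' i"
    by blast
  define B where "B = Suc (\<Sum>e\<in>I. e v)"
  have B: "e v < B" if "e \<in> I" for e
    using that assms(2) member_le_sum[of e I "\<lambda>e. e v"] by (simp add: B_def)
  define w' where "w' i = (if i = v then 1 else B * w i)" for i
  have w'_sum: "(\<Sum>i\<in>insert v V. w' i * e i) = e v + B * (\<Sum>i\<in>V. w i * e i)" for e
  proof -
    have "(\<Sum>i\<in>V. w' i * e i) = (\<Sum>i\<in>V. B * (w i * e i))"
      by (rule sum.cong) (use insert.hyps in \<open>auto simp: w'_def\<close>)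
    then show ?thesis using insert.hyps by (simp add: w'_def sum_distrib_left)
  qed
  have "\<forall>i\<in>insert v V. e i = e' i"
    if e: "e \<in> I" "e' \<in> I" and "(\<Sum>i\<in>insert v V. w' i * e i) = (\<Sum>i\<in>insert v V. w' i * e' i)"
    for e e'
  proof -
    have eq: "e v + B * (\<Sum>i\<in>V. w i * e i) = e' v + B * (\<Sum>i\<in>V. w i * e' i)"
      using that(3) by (simp add: w'_sum)
    have v: "e v = e' v"
      using arg_cong[OF eq, of "\<lambda>x. x mod B"] B[OF e(1)] B[OF e(2)] by simp
    have "B > 0" by (simp add: B_def)
    then have "(\<Sum>i\<in>V. w i * e i) = (\<Sum>i\<in>V. w i * e' i)"
      using eq v by simp
    from w[OF e this] v show ?thesis by simp
  qed
  then show ?case by blast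
qed simp

text \<open>Kronecker substitution: putting \<open>t ^ w i\<close> for \<open>x i\<close>, with separating weights \<open>w\<close>, turns distinct
  monomials into distinct powers of \<open>t\<close>, so that the sum becomes a nonzero univariate polynomial.\<close>

lemma nonvanishing_point:
  fixes a :: "('v \<Rightarrow> nat) \<Rightarrow> 'a::{idom,ring_char_0}"
  assumes "finite V" "finite I" and eb: "eb \<in> I" "a eb \<noteq> 0"
    and inj: "\<And>e e'. e \<in> I \<Longrightarrow> e' \<in> I \<Longrightarrow> \<forall>i\<in>V. e i = e' i \<Longrightarrow> e = e'"
  shows "\<exists>x. (\<Sum>e\<in>I. a e * (\<Prod>i\<in>V. x i ^ e i)) \<noteq> 0"
proof -
  obtain w where w: "\<And>e e'. e \<in> I \<Longrightarrow> e' \<in> I \<Longrightarrow>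
      (\<Sum>i\<in>V. w i * e i) = (\<Sum>i\<in>V. w i * e' i) \<Longrightarrow> \<forall>i\<in>V. e i = e' i"
    using separating_weights[OF assms(1,2)] by blast
  define d where "d e = (\<Sum>i\<in>V. w i * e i)" for e
  define P where "P = (\<Sum>e\<in>I. Polynomial.monom (a e) (d e))"
  have "coeff P (d eb) = (\<Sum>e\<in>I. if e = eb then a e else 0)"
    unfolding P_def coeff_sum coeff_monom
    by (rule sum.cong) (use inj w eb in \<open>auto simp: d_def\<close>)
  also have "\<dots> = a eb" using assms(2) eb by simp
  finally have "P \<noteq> 0" using eb by auto
  then have "finite {t. poly P t = 0}" by (rule poly_roots_finite)
  then have "{t. poly P t = 0} \<noteq> UNIV" using infinite_UNIV_char_0 by metis
  then obtain t where t: "poly P t \<noteq> 0" by auto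
  have "poly P t = (\<Sum>e\<in>I. a e * (\<Prod>i\<in>V. (t ^ w i) ^ e i))"
    by (simp add: P_def poly_sum poly_monom d_def power_sum power_mult)
  with t show ?thesis by metis
qed

lemma peval_eq_0_imp:
  fixes p :: "('n::finite, 'a::{idom,ring_char_0}) mpol"
  assumes "\<And>x. peval p x = 0"
  shows "p = 0"
proof (rule ccontr)
  assume "p \<noteq> 0"
  then obtain m0 where m0: "lookup p m0 \<noteq> 0"
    by (metis lookup_zero poly_mapping_eqI)
  have inj: "inj (lookup :: ('n \<Rightarrow>\<^sub>0 nat) \<Rightarrow> _)"
    by (metis injI poly_mapping_eqI)
  have "\<exists>x. (\<Sum>e\<in>lookup ` keys p. lookup p (Abs_poly_mapping e) * (\<Prod>i\<in>UNIV. x i ^ e i)) \<noteq> 0"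
    by (rule nonvanishing_point[where eb = "lookup m0"])
      (use m0 in \<open>auto simp: lookup_inverse in_keys_iff\<close>)
  then obtain x where "(\<Sum>e\<in>lookup ` keys p. lookup p (Abs_poly_mapping e) * (\<Prod>i\<in>UNIV. x i ^ e i)) \<noteq> 0"
    by blast
  then have "peval p (\<chi> i. x i) \<noteq> 0"
    by (simp add: peval_def sum.reindex[OF inj_on_subset[OF inj subset_UNIV]] lookup_inverse)
  with assms show False by blast
qed

section \<open>Derivatives\<close>

lemma pdiff_superset:
  assumes "finite K" "keys p \<subseteq> K"
  shows "pdiff i p = (\<Sum>m\<in>K. monom (m - Poly_Mapping.single i 1) (of_nat (lookup m i) * lookup p m))"
  unfolding pdiff_def
  by (rule sum.mono_neutral_left) (use assms in \<open>auto simp: in_keys_iff\<close>)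

lemma pdiff_single:
  "pdiff i (monom m a) = monom (m - Poly_Mapping.single i 1) (of_nat (lookup m i) * a)"
  by (simp add: pdiff_superset[of "{m}"])

lemma pdiff_add: "pdiff i (p + q) = pdiff i p + pdiff i q"
proof -
  have "keys (p + q) \<subseteq> keys p \<union> keys q" by (rule Poly_Mapping.keys_add)
  then show ?thesis
    by (simp add: pdiff_superset[of "keys p \<union> keys q"] Poly_Mapping.lookup_add
        Poly_Mapping.single_add distrib_left sum.distrib)
qed

lemma pdiff_commute: "pdiff i (pdiff j p) = pdiff j (pdiff i p)"
proof (induction p rule: poly_mapping_single_induct)
  case (single m a)
  have "m - Poly_Mapping.single j 1 - Poly_Mapping.single i 1
      = m - Poly_Mapping.single i 1 - Poly_Mapping.single j 1"
    by (rule poly_mapping_eqI) (simp add: Poly_Mapping.lookup_minus)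
  then show ?case
    by (cases "i = j") (simp_all add: pdiff_single Poly_Mapping.lookup_minus
        Poly_Mapping.lookup_single mult.left_commute)
qed (simp add: pdiff_add)

lemma pdiff_0 [simp]: "pdiff i 0 = 0"
  by (simp add: pdiff_def)

lemma pdiff_sum: "pdiff i (sum f A) = (\<Sum>a\<in>A. pdiff i (f a))"
  by (induction A rule: infinite_finite_induct) (simp_all add: pdiff_add)

lemma pdiff_pscale: "pdiff i (pscale c p) = pscale c (pdiff i (p :: ('n, 'a::field) mpol))"
  by (induction p rule: poly_mapping_single_induct)
    (simp_all add: pdiff_single pdiff_add pvs.scale_right_distrib ac_simps)

lemma pdiff_Const: "pdiff i (Const c) = 0"
  by (simp add: pdiff_single)

lemma peval_line_deriv:
  fixes p :: "('n::finite, complex) mpol"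
  shows "((\<lambda>t. peval p (x + t *s u)) has_field_derivative
    (\<Sum>i\<in>UNIV. u $ i * peval (pdiff i p) (x + t *s u))) (at t)"
proof (induction p rule: poly_mapping_single_induct)
  case (single m a)
  have *: "((\<lambda>t. \<Prod>i\<in>UNIV. (x $ i + t * u $ i) ^ lookup m i) has_field_derivative
      (\<Sum>i\<in>UNIV. (of_nat (lookup m i) * (u $ i * (x $ i + t * u $ i) ^ (lookup m i - 1)))
        * (\<Prod>j\<in>UNIV - {i}. (x $ j + t * u $ j) ^ lookup m j))) (at t)"
    by (rule has_field_derivative_prod) (auto intro!: derivative_eq_intros)
  have split: "(\<Prod>j\<in>UNIV. (x $ j + t * u $ j) ^ lookup (m - Poly_Mapping.single i 1) j)
     = (x $ i + t * u $ i) ^ (lookup m i - 1) * (\<Prod>j\<in>UNIV - {i}. (x $ j + t * u $ j) ^ lookup m j)"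
    for i
    by (subst prod.remove[of _ i])
      (auto simp: Poly_Mapping.lookup_minus Poly_Mapping.lookup_single when_def intro!: prod.cong)
  show ?case
    using DERIV_cmult[OF *, of a]
    by (simp add: peval_single pdiff_single split[simplified] sum_distrib_left ac_simps)
qed (simp add: peval_add pdiff_add distrib_left sum.distrib DERIV_add)

section \<open>Homogeneous components\<close>

abbreviation mdeg :: "('n::finite \<Rightarrow>\<^sub>0 nat) \<Rightarrow> nat"
  where "mdeg m \<equiv> (\<Sum>i\<in>UNIV. lookup m i)"

definition hcomp :: "nat \<Rightarrow> ('n::finite, complex) mpol \<Rightarrow> ('n, complex) mpol"
  where "hcomp k p = (\<Sum>m\<in>{m \<in> keys p. mdeg m = k}. monom m (lookup p m))"

lemma lookup_hcomp: "lookup (hcomp k p) m = (if mdeg m = k then lookup p m else 0)"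
proof -
  have "lookup (hcomp k p) m = (\<Sum>m'\<in>{m \<in> keys p. mdeg m = k}. if m' = m then lookup p m else 0)"
    unfolding hcomp_def Poly_Mapping.lookup_sum
    by (rule sum.cong) (auto simp: Poly_Mapping.lookup_single when_def)
  then show ?thesis by (simp add: in_keys_iff)
qed

lemma hcomp_add: "hcomp k (p + q) = hcomp k p + hcomp k q"
  by (rule poly_mapping_eqI) (simp add: lookup_hcomp Poly_Mapping.lookup_add)

lemma hcomp_0: "hcomp k 0 = 0"
  by (rule poly_mapping_eqI) (simp add: lookup_hcomp)

lemma hcomp_diff: "hcomp k (p - q) = hcomp k p - hcomp k q"
  by (rule poly_mapping_eqI) (simp add: lookup_hcomp Poly_Mapping.lookup_minus)

lemma hcomp_sum: "hcomp k (sum f A) = (\<Sum>a\<in>A. hcomp k (f a))"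
  by (induction A rule: infinite_finite_induct) (simp_all add: hcomp_0 hcomp_add)

lemma hcomp_in_Sym: "hcomp k p \<in> Sym k"
  by (auto simp: Sym_def in_keys_iff lookup_hcomp split: if_splits)

lemma SymD: "p \<in> Sym k \<Longrightarrow> lookup p m \<noteq> 0 \<Longrightarrow> mdeg m = k"
  by (auto simp: Sym_def in_keys_iff)

lemma hcomp_of_Sym: "p \<in> Sym d \<Longrightarrow> hcomp k p = (if k = d then p else 0)"
  by (rule poly_mapping_eqI) (auto simp: lookup_hcomp dest: SymD)

lemma monom_in_Sym: "mdeg m = k \<Longrightarrow> monom m a \<in> Sym k"
  by (simp add: Sym_def)

lemma Const_in_Sym: "Const c \<in> Sym 0"
  by (simp add: Sym_def)

lemma Var_in_Sym: "Var i \<in> Sym 1"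
  by (simp add: Sym_def Poly_Mapping.lookup_single when_def)

lemma Sym_mult:
  assumes "p \<in> Sym k" "q \<in> Sym l"
  shows "p * q \<in> Sym (k + l)"
  using Poly_Mapping.keys_mult[of p q] assms
  by (fastforce simp: Sym_def Poly_Mapping.lookup_add sum.distrib)

lemma Sym_prod: "(\<And>i. i \<in> A \<Longrightarrow> f i \<in> Sym (d i)) \<Longrightarrow> prod f A \<in> Sym (sum d A)"
proof (induction A rule: infinite_finite_induct)
  case (insert a A)
  then show ?case by (simp add: Sym_mult)
qed (use Const_in_Sym[of 1] in simp_all)

lemma Sym_power: "p \<in> Sym k \<Longrightarrow> p ^ n \<in> Sym (n * k)"
  using Sym_prod[of "{..<n}" "\<lambda>_. p" "\<lambda>_. k"] by simp

lemmas Sym_sum = pvs.subspace_sum[OF subspace_Sym]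

lemma hcomp_mult_Sym:
  assumes q: "q \<in> Sym d"
  shows "hcomp k (p * q) = (if d \<le> k then hcomp (k - d) p * q else 0)"
proof (induction p rule: poly_mapping_single_induct)
  case (single m a)
  have "hcomp k (monom m a * q) = (if k = mdeg m + d then monom m a * q else 0)"
    by (rule hcomp_of_Sym[OF Sym_mult[OF monom_in_Sym q]]) simp
  moreover have "hcomp (k - d) (monom m a) = (if k - d = mdeg m then monom m a else 0)"
    by (rule hcomp_of_Sym[OF monom_in_Sym]) simp
  ultimately show ?case by auto
qed (auto simp: distrib_right hcomp_add)

lemma finite_mdeg_le: "finite {m :: 'n::finite \<Rightarrow>\<^sub>0 nat. mdeg m \<le> k}"
proof -
  have "lookup ` {m :: 'n \<Rightarrow>\<^sub>0 nat. mdeg m \<le> k} \<subseteq> (\<Pi>\<^sub>E i\<in>UNIV. {..k})"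
    by (auto simp: PiE_def extensional_def) (meson finite UNIV_I member_le_sum le_trans zero_le)
  moreover have "finite (\<Pi>\<^sub>E i\<in>(UNIV :: 'n set). {..k})"
    by (intro finite_PiE) auto
  moreover have "inj_on lookup {m :: 'n \<Rightarrow>\<^sub>0 nat. mdeg m \<le> k}"
    by (rule inj_onI) (simp add: poly_mapping_eqI)
  ultimately show ?thesis by (meson finite_imageD finite_subset)
qed

lemma mdeg_bound_exists: "\<exists>N. \<forall>m\<in>keys p. mdeg m \<le> N"
  using finite_nat_set_iff_bounded_le[of "mdeg ` keys p"] by auto

lemma hcomp_eventually_0:
  obtains N where "\<And>k. k > N \<Longrightarrow> hcomp k p = 0"
proof -
  obtain N where N: "\<forall>m\<in>keys p. mdeg m \<le> N" using mdeg_bound_exists by blast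
  have "hcomp k p = 0" if "k > N" for k
  proof (rule poly_mapping_eqI)
    show "lookup (hcomp k p) m = lookup 0 m" for m
    proof (cases "m \<in> keys p")
      case True
      with N have "mdeg m \<le> N" by blast
      with that show ?thesis by (auto simp: lookup_hcomp)
    qed (simp add: lookup_hcomp in_keys_iff)
  qed
  then show ?thesis using that by blast
qed

section \<open>Linear dependence of families\<close>

lemma in_span_monomials:
  fixes p :: "('n, 'a::field) mpol"
  assumes "keys p \<subseteq> K"
  shows "p \<in> pvs.span ((\<lambda>m. monom m 1) ` K)"
proof -
  have "p = (\<Sum>m\<in>keys p. pscale (lookup p m) (monom m 1))"
    by (subst sum_single_lookup) simp
  also have "\<dots> \<in> pvs.span ((\<lambda>m. monom m 1) ` K)"
    by (intro pvs.span_sum pvs.span_scale pvs.span_base) (use assms in auto)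
  finally show ?thesis .
qed

text \<open>Indexed by \<open>I\<close> rather than stated for a set, because the vectors need not be distinct; a repetition
  is a relation by itself.\<close>

lemma family_dependent:
  fixes f :: "'i \<Rightarrow> ('k \<Rightarrow>\<^sub>0 'a::field)"
  assumes "finite I" "finite T" "f ` I \<subseteq> pvs.span T" "card T < card I"
  shows "\<exists>a. (\<exists>i\<in>I. a i \<noteq> 0) \<and> (\<Sum>i\<in>I. pscale (a i) (f i)) = 0"
proof (cases "inj_on f I")
  case True
  then have "card (f ` I) = card I" by (rule card_image)
  with assms pvs.independent_span_bound[of T "f ` I"] have "pvs.dependent (f ` I)"
    by auto
  then obtain u where "\<exists>v\<in>f ` I. u v \<noteq> 0" "(\<Sum>v\<in>f ` I. pscale (u v) v) = 0"
    using assms(1) by (auto simp: pvs.dependent_finite)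
  then show ?thesis
    using True by (intro exI[of _ "u \<circ> f"]) (auto simp: sum.reindex)
next
  case False
  then obtain i j where ij: "i \<in> I" "j \<in> I" "i \<noteq> j" "f i = f j"
    by (auto simp: inj_on_def)
  define a :: "'i \<Rightarrow> 'a" where "a k = (if k = i then 1 else if k = j then - 1 else 0)" for k
  have "(\<Sum>k\<in>I. pscale (a k) (f k)) = (\<Sum>k\<in>{i, j}. pscale (a k) (f k))"
    by (rule sum.mono_neutral_right) (use assms(1) ij in \<open>auto simp: a_def\<close>)
  also have "\<dots> = 0" using ij by (simp add: a_def)
  finally show ?thesis using ij by (intro exI[of _ a]) (auto simp: a_def)
qed

section \<open>Ideals\<close>

text \<open>A commutative ring is a module over itself, and the spans are the generated ideals. Here the rule
  that collapses iterated scalings is associativity read from right to left, which must not be a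
  simplification rule.\<close>

interpretation ideal: module "(*) :: 'a::comm_ring_1 \<Rightarrow> 'a \<Rightarrow> 'a"
  by unfold_locales (simp_all add: algebra_simps)

declare ideal.scale_scale [simp del]

lemma ideal_mult_left: "x \<in> ideal.span S \<Longrightarrow> r * x \<in> ideal.span S"
  by (rule ideal.span_scale)

lemma ideal_mult_right: "x \<in> ideal.span S \<Longrightarrow> x * r \<in> ideal.span S"
  using ideal.span_scale[of x S r] by (simp add: mult.commute)

lemma ideal_cong_mult:
  fixes a b c d :: "'a::comm_ring_1"
  assumes "a - b \<in> ideal.span S" "c - d \<in> ideal.span S"
  shows "a * c - b * d \<in> ideal.span S"
proof -
  have "a * c - b * d = (a - b) * c + b * (c - d)" by (simp add: algebra_simps)
  with assms show ?thesis by (simp add: ideal.span_add ideal_mult_left ideal_mult_right)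
qed

lemma ideal_cong_prod:
  fixes f g :: "'i \<Rightarrow> 'a::comm_ring_1"
  assumes "\<And>i. i \<in> A \<Longrightarrow> f i - g i \<in> ideal.span S"
  shows "prod f A - prod g A \<in> ideal.span S"
  using assms by (induction A rule: infinite_finite_induct) (auto simp: ideal.span_zero ideal_cong_mult)

lemma ideal_cong_power:
  fixes a b :: "'a::comm_ring_1"
  shows "a - b \<in> ideal.span S \<Longrightarrow> a ^ n - b ^ n \<in> ideal.span S"
  using ideal_cong_prod[of "{..<n}" "\<lambda>_. a" "\<lambda>_. b" S] by simp

lemma ideal_cong_sum:
  fixes f g :: "'i \<Rightarrow> 'a::comm_ring_1"
  assumes "\<And>i. i \<in> A \<Longrightarrow> f i - g i \<in> ideal.span S"
  shows "sum f A - sum g A \<in> ideal.span S"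
  using ideal.span_sum[of A "\<lambda>i. f i - g i" S] assms by (simp add: sum_subtractf)

lemma hcomp_in_ideal:
  assumes hom: "\<And>q. q \<in> H \<Longrightarrow> \<exists>d. q \<in> Sym d" and "h \<in> ideal.span H"
  shows "hcomp k h \<in> ideal.span H"
  using assms(2)
proof (induction rule: ideal.span_induct_alt)
  case base
  show ?case by (simp add: hcomp_0 ideal.span_zero)
next
  case (step c x y)
  obtain d where "x \<in> Sym d" using hom step.hyps by blast
  moreover have "x \<in> ideal.span H" using step.hyps by (rule ideal.span_base)
  ultimately show ?case
    using step.IH by (simp add: hcomp_add hcomp_mult_Sym ideal.span_add ideal_mult_left)
qed

lemma Var_power: "Var i ^ k = (monom (Poly_Mapping.single i k) 1 :: ('n::finite, 'a::comm_ring_1) mpol)"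
  by (induction k) (simp_all add: Poly_Mapping.mult_single flip: Poly_Mapping.single_add)

lemma prod_monom: "(\<Prod>i\<in>A. monom (f i) 1) = (monom (\<Sum>i\<in>A. f i) 1 :: ('n::finite, 'a::comm_ring_1) mpol)"
  by (induction A rule: infinite_finite_induct) (simp_all add: Poly_Mapping.mult_single)

lemma monom_eq_prod:
  "(monom m a :: ('n::finite, 'a::comm_ring_1) mpol) = Const a * (\<Prod>i\<in>UNIV. Var i ^ lookup m i)"
proof -
  have "(\<Sum>i\<in>UNIV. Poly_Mapping.single i (lookup m i)) = m"
    by (rule poly_mapping_eqI) (simp add: Poly_Mapping.lookup_sum Poly_Mapping.lookup_single when_def)
  then show ?thesis by (simp add: Var_power prod_monom Poly_Mapping.mult_single del: One_nat_def)
qed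

section \<open>The Nullstellensatz\<close>

lemma map_poly_Const_hom:
  fixes x :: "('n, complex) mpol"
  shows "ring_1_hom (\<lambda>p. poly (map_poly Const p) x)"
proof -
  interpret C: ring_1_hom "Const :: complex \<Rightarrow> ('n, complex) mpol"
    by (rule ring_1_hom_single)
  have "map_poly Const (p * q) = (map_poly Const p * map_poly Const q :: ('n, complex) mpol poly)" for p q
    by (rule poly_eqI) (simp add: coeff_map_poly coeff_mult C.hom_sum C.hom_mult)
  moreover have "map_poly Const (p + q) = (map_poly Const p + map_poly Const q :: ('n, complex) mpol poly)" for p q
    by (rule poly_eqI) (simp add: coeff_map_poly C.hom_add)
  ultimately show ?thesis
    by unfold_locales (simp_all add: map_poly_1)
qed

text \<open>If \<open>Var i - Const c\<close> were invertible modulo the ideal for every complex \<open>c\<close>, then infinitely many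
  of the uncountably many inverses would have the same bound on their degrees and would be linearly
  dependent. Clearing denominators in such a relation gives a nonzero univariate polynomial \<open>p\<close> with
  \<open>p (Var i)\<close> in the ideal. Since the factors of \<open>p\<close> are invertible, they can be split off one after
  the other until 1 lies in the ideal.\<close>

lemma nullstellensatz_step:
  fixes G :: "('n::finite, complex) mpol set"
  assumes "1 \<notin> ideal.span G"
  shows "\<exists>c. 1 \<notin> ideal.span (insert (Var i - Const c) G)"
proof (rule ccontr)
  assume "\<not> ?thesis"
  then have "\<exists>u. 1 - u * (Var i - Const c) \<in> ideal.span G" for c
    by (auto simp: ideal.span_insert)
  then obtain u where u: "\<And>c. 1 - u c * (Var i - Const c) \<in> ideal.span G" by metis
  define ev where "ev p = poly (map_poly Const p) (Var i :: ('n, complex) mpol)" for p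
  interpret ev: ring_1_hom ev unfolding ev_def by (rule map_poly_Const_hom)
  have ev_lin: "ev [:- c, 1:] = Var i - Const c" for c
    by (simp add: ev_def map_poly_pCons Poly_Mapping.single_uminus)
  have ev_const: "ev [:c:] = Const c" for c
    by (simp add: ev_def map_poly_pCons)
  have no_root: "ev p \<notin> ideal.span G" if "p \<noteq> 0" for p
    using that
  proof (induction "Polynomial.degree p" arbitrary: p)
    case 0
    then obtain c where c: "p = [:c:]" "c \<noteq> 0" by (metis degree_eq_zeroE pCons_0_0)
    have "(1 :: ('n, complex) mpol) = Const (1 / c) * ev p"
      using c by (simp add: ev_const Poly_Mapping.mult_single)
    with assms show ?case by (metis ideal_mult_left)
  next
    case (Suc n)
    have "Polynomial.degree p \<noteq> 0" using Suc.hyps(2) by simp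
    then have "\<not> constant (poly p)" by (simp add: constant_degree)
    then obtain r where "poly p r = 0" using fundamental_theorem_of_algebra by blast
    then obtain q where q: "p = [:- r, 1:] * q" by (metis poly_eq_0_iff_dvd dvdE)
    have "q \<noteq> 0" using q Suc.prems by auto
    moreover have "n = Polynomial.degree q"
      using Suc.hyps(2) \<open>q \<noteq> 0\<close> by (simp add: q degree_mult_eq del: mult_pCons_left)
    ultimately have "ev q \<notin> ideal.span G" using Suc.hyps(1) by blast
    moreover have "ev q = ev q * (1 - u r * (Var i - Const r)) + u r * ev p"
      unfolding q ev.hom_mult ev_lin by (simp only: algebra_simps mult_1_left)
    ultimately show ?case
      by (metis u ideal.span_add ideal_mult_left)
  qed
  have "\<exists>N. \<forall>c. \<forall>m\<in>keys (u c). mdeg m \<le> N c"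
    by (rule choice) (simp add: mdeg_bound_exists)
  then obtain N where N: "\<And>c. \<forall>m\<in>keys (u c). mdeg m \<le> N c" by blast
  have "\<exists>k. infinite {c. N c = k}"
  proof (rule ccontr)
    assume "\<not> ?thesis"
    then have "countable (\<Union>k. {c. N c = k})"
      by (intro countable_UN) (auto intro: countable_finite)
    moreover have "(\<Union>k. {c. N c = k}) = UNIV" by auto
    ultimately show False using uncountable_UNIV_complex by simp
  qed
  then obtain k where k: "infinite {c. N c = k}" by blast
  define T where "T = (\<lambda>m. monom m (1::complex)) ` {m :: 'n \<Rightarrow>\<^sub>0 nat. mdeg m \<le> k}"
  have T: "finite T" by (simp add: T_def finite_mdeg_le)
  obtain C where C: "finite C" "card C = Suc (card T)" "C \<subseteq> {c. N c = k}"
    using infinite_arbitrarily_large[OF k] by blast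
  have "u ` C \<subseteq> pvs.span T"
    unfolding T_def using C N by (auto intro!: in_span_monomials)
  then obtain a c0 where a: "c0 \<in> C" "a c0 \<noteq> 0" "(\<Sum>c\<in>C. pscale (a c) (u c)) = 0"
    using family_dependent[of C T u] C T by auto
  \<comment> \<open>the relation \<open>\<Sum>c\<in>C. a c / (Var i - c)\<close> multiplied by the common denominator\<close>
  define p where "p = (\<Sum>c\<in>C. [:a c:] * (\<Prod>c'\<in>C - {c}. [:- c', 1:]))"
  have "poly p c0 = (\<Sum>c\<in>C. if c = c0 then a c0 * (\<Prod>c'\<in>C - {c0}. c0 - c') else 0)"
    unfolding p_def poly_sum
    by (rule sum.cong) (use a C in \<open>auto simp: poly_prod intro!: prod_zero\<close>)
  also have "\<dots> \<noteq> 0" using a C by auto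
  finally have "p \<noteq> 0" by auto
  define L where "L c = Const (a c) * (\<Prod>c'\<in>C - {c}. Var i - Const c')" for c
  have "ev p = (\<Sum>c\<in>C. L c)"
    unfolding p_def ev.hom_sum ev.hom_mult ev.hom_prod ev_lin ev_const L_def ..
  moreover have "(\<Sum>c\<in>C. L c) - (\<Sum>c\<in>C. L c * (u c * (Var i - Const c))) \<in> ideal.span G"
  proof (rule ideal_cong_sum)
    fix c
    show "L c - L c * (u c * (Var i - Const c)) \<in> ideal.span G"
      using ideal_mult_left[OF u, of "L c" c] by (simp add: right_diff_distrib)
  qed
  moreover have "(\<Sum>c\<in>C. L c * (u c * (Var i - Const c)))
      = (\<Sum>c\<in>C. (\<Prod>c'\<in>C. Var i - Const c') * pscale (a c) (u c))"
  proof (rule sum.cong)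
    fix c assume "c \<in> C"
    then have "(\<Prod>c'\<in>C. Var i - Const c') = (Var i - Const c) * (\<Prod>c'\<in>C - {c}. Var i - Const c')"
      using C(1) by (simp add: prod.remove)
    then show "L c * (u c * (Var i - Const c)) = (\<Prod>c'\<in>C. Var i - Const c') * pscale (a c) (u c)"
      by (simp only: L_def pscale_eq ac_simps)
  qed simp
  moreover have "\<dots> = 0" using a by (simp flip: sum_distrib_left)
  ultimately have "ev p \<in> ideal.span G" by (metis diff_zero)
  with no_root \<open>p \<noteq> 0\<close> show False by blast
qed

lemma peval_cong_ideal:
  fixes g :: "('n::finite, 'a::comm_ring_1) mpol"
  assumes "\<And>i. Var i - Const (c $ i) \<in> ideal.span S"
  shows "g - Const (peval g c) \<in> ideal.span S"
proof (induction g rule: poly_mapping_single_induct)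
  case (single m a)
  interpret C: ring_1_hom "Const :: 'a \<Rightarrow> ('n, 'a) mpol"
    by (rule ring_1_hom_single)
  have "Const a * (\<Prod>i\<in>UNIV. Var i ^ lookup m i) - Const a * (\<Prod>i\<in>UNIV. Const (c $ i) ^ lookup m i)
    \<in> ideal.span S"
    by (intro ideal_cong_mult ideal_cong_prod ideal_cong_power assms) (simp add: ideal.span_zero)
  moreover have e: "monom m a = Const a * (\<Prod>i\<in>UNIV. Var i ^ lookup m i)"
    by (rule monom_eq_prod)
  ultimately show ?case
    unfolding e by (simp add: peval_mult peval_Const peval.hom_prod peval.hom_power peval_Var
        C.hom_mult C.hom_prod C.hom_power del: One_nat_def)
next
  case (add p q)
  have "p + q - Const (peval (p + q) c) = (p - Const (peval p c)) + (q - Const (peval q c))"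
    by (simp add: peval_add Poly_Mapping.single_add)
  with add show ?case by (simp only: ideal.span_add)
qed

text \<open>The coordinates of \<open>c\<close> are chosen one after the other, keeping the ideal proper. In the end the ideal
  contains all \<open>Var i - Const (c i)\<close>, and modulo these every polynomial is congruent to its value at
  \<open>c\<close>.\<close>

theorem nullstellensatz:
  fixes G :: "('n::finite, complex) mpol set"
  assumes "1 \<notin> ideal.span G"
  obtains c where "\<And>g. g \<in> G \<Longrightarrow> peval g c = 0"
proof -
  have "\<exists>c :: 'n \<Rightarrow> complex. 1 \<notin> ideal.span (G \<union> (\<lambda>i. Var i - Const (c i)) ` V)" if "finite V" for V
    using that
  proof (induction V)
    case empty
    with assms show ?case by simp
  next
    case (insert v V)
    then obtain c where "1 \<notin> ideal.span (G \<union> (\<lambda>i. Var i - Const (c i)) ` V)" by blast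
    from nullstellensatz_step[OF this, of v] obtain z where
      z: "1 \<notin> ideal.span (insert (Var v - Const z) (G \<union> (\<lambda>i. Var i - Const (c i)) ` V))" by blast
    have "insert (Var v - Const z) (G \<union> (\<lambda>i. Var i - Const (c i)) ` V)
        = G \<union> (\<lambda>i. Var i - Const ((c(v := z)) i)) ` insert v V"
      using insert.hyps by auto
    with z show ?case by metis
  qed
  from this[of UNIV] obtain c :: "'n \<Rightarrow> complex"
    where c: "1 \<notin> ideal.span (G \<union> range (\<lambda>i. Var i - Const (c i)))" (is "_ \<notin> ideal.span ?S")
    by auto
  show ?thesis
  proof
    fix g assume g: "g \<in> G"
    define z where "z = peval g (\<chi> i. c i)"
    have gz: "g - Const z \<in> ideal.span ?S"
      unfolding z_def by (rule peval_cong_ideal) (auto intro: ideal.span_base)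
    have "g \<in> ideal.span ?S" using g by (auto intro: ideal.span_base)
    from ideal.span_diff[OF this gz] have "Const z \<in> ideal.span ?S"
      by (simp only: diff_diff_eq2 add_diff_cancel_left')
    then have "Const (1 / z) * Const z \<in> ideal.span ?S" by (rule ideal_mult_left)
    then have "(1 :: ('n, complex) mpol) \<in> ideal.span ?S" if "z \<noteq> 0"
      using that by (simp add: Poly_Mapping.mult_single)
    with c have "z = 0" by blast
    then show "peval g (\<chi> i. c i) = 0" by (simp add: z_def)
  qed
qed

text \<open>Adding \<open>Var i - 1\<close> to \<open>H\<close> removes the last common zero 0, so the Nullstellensatz represents 1.
  Comparing the components of degree \<open>k\<close> in \<open>1 = h + u * (Var i - 1)\<close> shows that the
  component of \<open>u\<close> of degree \<open>k\<close> is congruent to \<open>- Var i ^ k\<close>, and it vanishes for large \<open>k\<close>.\<close>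

lemma Var_power_in_ideal:
  fixes H :: "('n::finite, complex) mpol set"
  assumes hom: "\<And>q. q \<in> H \<Longrightarrow> \<exists>d. q \<in> Sym d"
    and zero: "\<And>z. (\<And>q. q \<in> H \<Longrightarrow> peval q z = 0) \<Longrightarrow> z = 0"
  obtains k where "Var i ^ k \<in> ideal.span H"
proof -
  have "1 \<in> ideal.span (insert (Var i - 1) H)"
  proof (rule ccontr)
    assume "1 \<notin> ideal.span (insert (Var i - 1) H)"
    from nullstellensatz[OF this] obtain c where c: "\<And>g. g \<in> insert (Var i - 1) H \<Longrightarrow> peval g c = 0"
      by blast
    then have "c = 0" using zero by blast
    with c[of "Var i - 1"] show False
      by (simp add: peval.hom_diff peval_Var peval_1 del: One_nat_def)
  qed
  then obtain u where u: "1 - u * (Var i - 1) \<in> ideal.span H"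
    by (auto simp: ideal.span_insert)
  have Var_Sym: "Var i \<in> Sym (Suc 0)" using Var_in_Sym[of i] by simp
  have one_Sym: "(1 :: ('n, complex) mpol) \<in> Sym 0" using Const_in_Sym[of 1] by simp
  have comp: "hcomp k 1 - hcomp k (u * Var i) + hcomp k u \<in> ideal.span H" for k
  proof -
    have "1 - u * (Var i - 1) = 1 - u * Var i + u" by (simp add: algebra_simps)
    with hcomp_in_ideal[OF hom u, of k] show ?thesis by (simp only: hcomp_diff hcomp_add)
  qed
  have "hcomp k u + Var i ^ k \<in> ideal.span H" for k
  proof (induction k)
    case 0
    show ?case
      using comp[of 0] unfolding hcomp_mult_Sym[OF Var_Sym] hcomp_of_Sym[OF one_Sym]
      by (simp add: add.commute)
  next
    case (Suc k)
    have "hcomp (Suc k) u - hcomp k u * Var i \<in> ideal.span H"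
      using comp[of "Suc k"] unfolding hcomp_mult_Sym[OF Var_Sym] hcomp_of_Sym[OF one_Sym]
      by (simp del: One_nat_def)
    from ideal.span_add[OF this ideal_mult_right[OF Suc, of "Var i"]] show ?case
      by (simp add: algebra_simps del: One_nat_def)
  qed
  moreover obtain N where "\<And>k. k > N \<Longrightarrow> hcomp k u = 0" using hcomp_eventually_0 by blast
  ultimately have "Var i ^ Suc N \<in> ideal.span H" by (metis add_0 lessI)
  then show ?thesis using that by blast
qed

section \<open>Coefficients and determinants\<close>

lemma lookup_monom_mult:
  fixes p :: "('n, 'a::comm_ring_1) mpol"
  shows "lookup (monom a 1 * p) (a + b) = lookup p b"
  by (induction p rule: poly_mapping_single_induct)
    (simp_all add: Poly_Mapping.mult_single distrib_left Poly_Mapping.lookup_add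
      Poly_Mapping.lookup_single when_def)

lemma lookup_Var_power_ideal:
  fixes p :: "('n::finite, 'a::comm_ring_1) mpol"
  assumes "p \<in> ideal.span ((\<lambda>i. Var i ^ e i) ` A)" "\<And>i. i \<in> A \<Longrightarrow> lookup m i < e i"
  shows "lookup p m = 0"
  using assms(1)
proof (induction rule: ideal.span_induct_alt)
  case (step c x y)
  then obtain i where i: "i \<in> A" "x = Var i ^ e i" by blast
  have "lookup (c * monom (Poly_Mapping.single i (e i)) 1) m = 0"
  proof (induction c rule: poly_mapping_single_induct)
    case (single m' a)
    have "m' + Poly_Mapping.single i (e i) \<noteq> m"
      using assms(2)[OF i(1)] by (auto simp: Poly_Mapping.lookup_add)
    then show ?case by (simp add: Poly_Mapping.mult_single Poly_Mapping.lookup_single when_def)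
  qed (simp add: distrib_right Poly_Mapping.lookup_add)
  then show ?case using step.IH i by (simp add: Poly_Mapping.lookup_add Var_power del: One_nat_def)
qed simp

lemma det_cong_ideal:
  fixes A B :: "'a::comm_ring_1^'n^'n"
  assumes "\<And>i j. A $ i $ j - B $ i $ j \<in> ideal.span S"
  shows "det A - det B \<in> ideal.span S"
  unfolding det_def
  by (intro ideal_cong_sum ideal_cong_mult ideal_cong_prod assms) (simp add: ideal.span_zero)

text \<open>Modulo the ideal the matrix has a zero column.\<close>

lemma det_column_in_ideal:
  fixes A :: "'a::comm_ring_1^'n^'n"
  assumes "\<And>i. A $ i $ k \<in> ideal.span S"
  shows "det A \<in> ideal.span S"
proof -
  have "det A - det (\<chi> i j. if j = k then 0 else A $ i $ j) \<in> ideal.span S"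
    by (rule det_cong_ideal) (simp add: assms ideal.span_zero)
  moreover have "det (\<chi> i j. if j = k then 0 else A $ i $ j) = 0"
    using cramer_column[of k A 0] by (simp add: matrix_vector_mult_def cong: if_cong)
  ultimately show ?thesis by simp
qed

lemma Sym_det:
  fixes A :: "('n::finite, complex) mpol^'m^'m"
  assumes "\<And>i j. A $ i $ j \<in> Sym k"
  shows "det A \<in> Sym (CARD('m) * k)"
  unfolding det_def
proof (rule Sym_sum)
  fix p :: "'m \<Rightarrow> 'm"
  have "(\<Prod>i\<in>UNIV. A $ i $ p i) \<in> Sym (\<Sum>i\<in>(UNIV :: 'm set). k)"
    by (rule Sym_prod) (rule assms)
  moreover have "of_int (sign p) \<in> Sym 0"
    using Const_in_Sym[of "of_int (sign p)"] by simp
  ultimately show "of_int (sign p) * (\<Prod>i\<in>UNIV. A $ i $ p i) \<in> Sym (CARD('m) * k)"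
    using Sym_mult by fastforce
qed

text \<open>Two matrices \<open>E\<close> with the same product \<open>E *v x\<close> have determinants that agree modulo the entries
  of this product, and the diagonal matrix of the \<open>Var i ^ (M - 1)\<close> is one of them. The proof
  replaces the columns of \<open>E\<close> one after the other by unit vectors: by Cramer's rule
  \<open>Var k * det E\<close> is a determinant whose column \<open>k\<close> is \<open>Var k ^ M\<close> times a unit vector, up to terms that
  cannot contribute to the coefficient in question.\<close>

lemma coeff_det_Var_powers:
  fixes E :: "('n::finite, complex) mpol^'n^'n"
  assumes E: "E *v (\<chi> j. Var j) = (\<chi> i. Var i ^ M)" and M: "M > 0"
  shows "lookup (det E) (\<Sum>i\<in>UNIV. Poly_Mapping.single i (M - 1)) = 1"
proof -
  define ET where "ET T = (\<chi> i j. if j \<in> T then (if i = j then 1 else 0) else E $ i $ j)" for T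
  define \<mu> where "\<mu> T = (\<Sum>i\<in>- T. Poly_Mapping.single i (M - 1))" for T :: "'n set"
  have lookup_\<mu>: "lookup (\<mu> T) i = (if i \<in> T then 0 else M - 1)" for T i
    by (simp add: \<mu>_def Poly_Mapping.lookup_sum Poly_Mapping.lookup_single when_def)
  have split: "sum h UNIV = sum h T + sum h (- T)" for h :: "'n \<Rightarrow> ('n, complex) mpol" and T
    using sum.subset_diff[of T UNIV h] by (simp add: Compl_eq_Diff_UNIV add.commute)
  have "lookup (det (ET T)) (\<mu> T) = lookup (det (ET {})) (\<mu> {})" if "finite T" for T
    using that
  proof (induction T)
    case (insert k T)
    \<comment> \<open>the components of \<open>y\<close> in \<open>T\<close> are chosen such that the new column vanishes in the rows of \<open>T\<close>\<close>
    define y where "y = (\<chi> j. if j \<in> T then - (\<Sum>l\<in>- T. E $ j $ l * Var l) else Var j)"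
    have ETy: "(ET T *v y) $ i = (if i \<in> T then 0 else Var i ^ M - (\<Sum>l\<in>T. E $ i $ l * Var l))" for i
    proof -
      have "(ET T *v y) $ i = (\<Sum>j\<in>T. ET T $ i $ j * y $ j) + (\<Sum>j\<in>- T. ET T $ i $ j * y $ j)"
        unfolding matrix_vector_mult_def vec_lambda_beta by (rule split)
      also have "(\<Sum>j\<in>T. ET T $ i $ j * y $ j) = (\<Sum>j\<in>T. if j = i then y $ i else 0)"
        by (rule sum.cong) (auto simp: ET_def)
      also have "\<dots> = (if i \<in> T then y $ i else 0)" by simp
      also have "(\<Sum>j\<in>- T. ET T $ i $ j * y $ j) = (\<Sum>l\<in>- T. E $ i $ l * Var l)"
        by (rule sum.cong) (auto simp: ET_def y_def)
      finally have 1: "(ET T *v y) $ i = (if i \<in> T then y $ i else 0) + (\<Sum>l\<in>- T. E $ i $ l * Var l)" .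
      have "(\<Sum>l\<in>UNIV. E $ i $ l * Var l) = Var i ^ M"
        using E by (simp add: matrix_vector_mult_def vec_eq_iff)
      then have "(\<Sum>l\<in>- T. E $ i $ l * Var l) = Var i ^ M - (\<Sum>l\<in>T. E $ i $ l * Var l)"
        by (simp add: split[of _ T] algebra_simps)
      with 1 show ?thesis by (auto simp: y_def)
    qed
    define \<nu> where "\<nu> = \<mu> T + Poly_Mapping.single k 1"
    have \<nu>: "\<nu> = Poly_Mapping.single k M + \<mu> (insert k T)"
      by (rule poly_mapping_eqI)
        (use insert.hyps M in \<open>auto simp: \<nu>_def Poly_Mapping.lookup_add lookup_\<mu>
            Poly_Mapping.lookup_single when_def\<close>)
    define A where "A = (\<chi> i j. if j = k then (ET T *v y) $ i else ET T $ i $ j)"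
    define B where "B = (\<chi> i j. if j = k then (ET (insert k T) *v axis k (Var k ^ M)) $ i
        else ET (insert k T) $ i $ j)"
    have "det A = Var k * det (ET T)"
      unfolding A_def cramer_column using insert.hyps by (simp add: y_def)
    then have "lookup (det A) \<nu> = lookup (det (ET T)) (\<mu> T)"
      using lookup_monom_mult[of "Poly_Mapping.single k 1" "det (ET T)" "\<mu> T"]
      by (simp add: \<nu>_def add.commute)
    moreover have "det B = Var k ^ M * det (ET (insert k T))"
      unfolding B_def cramer_column by simp
    then have "lookup (det B) \<nu> = lookup (det (ET (insert k T))) (\<mu> (insert k T))"
      unfolding \<nu> Var_power by (simp add: lookup_monom_mult)
    moreover have "lookup (det A) \<nu> = lookup (det B) \<nu>"
    proof -
      define e where "e i = (if i \<in> T then 1 else M)" for i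
      have gen: "Var i ^ e i \<in> ideal.span ((\<lambda>i. Var i ^ e i) ` (- {k}))"
        if "i \<noteq> k" for i :: 'n using that by (auto intro: ideal.span_base)
      have genT: "Var i \<in> ideal.span ((\<lambda>i. Var i ^ e i) ` (- {k}))"
        if "i \<in> T" for i :: 'n using gen[of i] insert.hyps that by (auto simp: e_def)
      have "det A - det B \<in> ideal.span ((\<lambda>i. Var i ^ e i) ` (- {k}))"
      proof (rule det_cong_ideal)
        fix i j
        have axis: "(ET (insert k T) *v axis k (Var k ^ M)) $ i = (if i = k then Var k ^ M else 0)" for i
          by (simp add: matrix_vector_mult_def axis_def ET_def if_distrib cong: if_cong)
        consider "j \<noteq> k" | "j = k" "i \<in> T" | "j = k" "i \<notin> T" "i \<noteq> k" | "j = k" "i = k"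
          by blast
        then show "A $ i $ j - B $ i $ j \<in> ideal.span ((\<lambda>i. Var i ^ e i) ` (- {k}))"
        proof cases
          case 1
          then show ?thesis by (simp add: A_def B_def ET_def ideal.span_zero)
        next
          case 2
          then show ?thesis using insert.hyps
            by (auto simp: A_def B_def ETy axis ideal.span_zero simp del: One_nat_def)
        next
          case 3
          have "Var i ^ M \<in> ideal.span ((\<lambda>i. Var i ^ e i) ` (- {k}))"
            using gen[of i] 3 by (simp add: e_def)
          moreover have "(\<Sum>l\<in>T. E $ i $ l * Var l) \<in> ideal.span ((\<lambda>i. Var i ^ e i) ` (- {k}))"
            by (intro ideal.span_sum ideal_mult_left genT)
          ultimately have "Var i ^ M - (\<Sum>l\<in>T. E $ i $ l * Var l)
              \<in> ideal.span ((\<lambda>i. Var i ^ e i) ` (- {k}))"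
            by (rule ideal.span_diff)
          then show ?thesis
            using 3 by (simp add: A_def B_def ETy axis del: One_nat_def)
        next
          case 4
          have "(\<Sum>l\<in>T. E $ i $ l * Var l) \<in> ideal.span ((\<lambda>i. Var i ^ e i) ` (- {k}))"
            by (intro ideal.span_sum ideal_mult_left genT)
          from ideal.span_neg[OF this] show ?thesis
            using 4 insert.hyps by (simp add: A_def B_def ETy axis del: One_nat_def)
        qed
      qed
      then have "lookup (det A - det B) \<nu> = 0"
        by (rule lookup_Var_power_ideal)
          (use M in \<open>auto simp: \<nu>_def Poly_Mapping.lookup_add lookup_\<mu> e_def
            Poly_Mapping.lookup_single when_def\<close>)
      then show ?thesis by (simp add: Poly_Mapping.lookup_minus)
    qed
    ultimately show ?case using insert.IH by simp
  qed simp
  from this[of UNIV] have "lookup (det (ET UNIV)) (\<mu> UNIV) = lookup (det (ET {})) (\<mu> {})" by simp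
  moreover have "ET UNIV = mat 1" by (simp add: ET_def mat_def)
  moreover have "ET {} = E" by (simp add: ET_def)
  moreover have "\<mu> UNIV = 0" by (simp add: \<mu>_def)
  ultimately show ?thesis by (simp add: \<mu>_def)
qed

section \<open>Applying a functional in one of two sets of variables\<close>

text \<open>Polynomials in two sets of variables \<open>z\<close>, \<open>w\<close> are encoded as polynomials in \<open>z\<close> whose coefficients are
  polynomials in \<open>w\<close>; \<open>lvar\<close> and \<open>rvar\<close> substitute \<open>z\<close> and \<open>w\<close> for the variables. A functional
  \<open>\<rho>\<close> on the polynomials in \<open>z\<close> extends linearly over the polynomials in \<open>w\<close>.\<close>

definition apply_left :: "(('n, complex) mpol \<Rightarrow> complex) \<Rightarrow> ('n, ('n, complex) mpol) mpol
    \<Rightarrow> ('n, complex) mpol"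
  where "apply_left \<rho> P = (\<Sum>m\<in>keys P. Const (\<rho> (monom m 1)) * lookup P m)"

abbreviation lvar :: "('n, complex) mpol \<Rightarrow> ('n, ('n, complex) mpol) mpol"
  where "lvar \<equiv> Poly_Mapping.map Const"

abbreviation rvar :: "('n, complex) mpol \<Rightarrow> ('n, ('n, complex) mpol) mpol"
  where "rvar \<equiv> Const"

interpretation lvar: ring_1_hom "lvar :: ('n, complex) mpol \<Rightarrow> _"
  by (rule ring_1_hom_map[OF ring_1_hom_single])

interpretation rvar: ring_1_hom "rvar :: ('n, complex) mpol \<Rightarrow> _"
  by (rule ring_1_hom_single)

lemma apply_left_superset:
  assumes "finite K" "keys P \<subseteq> K"
  shows "apply_left \<rho> P = (\<Sum>m\<in>K. Const (\<rho> (monom m 1)) * lookup P m)"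
  unfolding apply_left_def
  by (rule sum.mono_neutral_left) (use assms in \<open>auto simp: in_keys_iff\<close>)

lemma apply_left_add: "apply_left \<rho> (P + Q) = apply_left \<rho> P + apply_left \<rho> Q"
proof -
  have "keys (P + Q) \<subseteq> keys P \<union> keys Q" by (rule Poly_Mapping.keys_add)
  then show ?thesis
    by (simp add: apply_left_superset[of "keys P \<union> keys Q"] Poly_Mapping.lookup_add
        distrib_left sum.distrib)
qed

lemma apply_left_0: "apply_left \<rho> 0 = 0"
  by (simp add: apply_left_def)

lemma apply_left_sum: "apply_left \<rho> (sum f A) = (\<Sum>a\<in>A. apply_left \<rho> (f a))"
  by (induction A rule: infinite_finite_induct) (simp_all add: apply_left_add apply_left_0)

lemma apply_left_diff: "apply_left \<rho> (P - Q) = apply_left \<rho> P - apply_left \<rho> Q"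
  using apply_left_add[of \<rho> "P - Q" Q] by simp

lemma apply_left_rvar_mult: "apply_left \<rho> (rvar q * P) = q * apply_left \<rho> P"
proof -
  have "lookup (rvar q * P) m = q * lookup P m" for m
    by (simp add: lookup_map_hom flip: Poly_Mapping.mult_map_scale_conv_mult)
  moreover from this have "keys (rvar q * P) \<subseteq> keys P" by (auto simp: in_keys_iff)
  ultimately have "apply_left \<rho> (rvar q * P) = (\<Sum>m\<in>keys P. Const (\<rho> (monom m 1)) * (q * lookup P m))"
    using apply_left_superset[of "keys P" "rvar q * P" \<rho>] by simp
  then show ?thesis by (simp add: apply_left_def sum_distrib_left mult.left_commute)
qed

lemma apply_left_lvar:
  assumes add: "\<And>p q. \<rho> (p + q) = \<rho> p + \<rho> q" and scale: "\<And>m a. \<rho> (monom m a) = a * \<rho> (monom m 1)"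
  shows "apply_left \<rho> (lvar p) = Const (\<rho> p)"
proof (induction p rule: poly_mapping_single_induct)
  case (single m a)
  show ?case
    by (simp add: apply_left_superset[of "{m}"] Poly_Mapping.mult_single scale[of m a] mult.commute)
qed (simp add: lvar.hom_add apply_left_add add Poly_Mapping.single_add)

lemma apply_left_lvar_rvar:
  assumes "\<And>p q. \<rho> (p + q) = \<rho> p + \<rho> q" "\<And>m a. \<rho> (monom m a) = a * \<rho> (monom m 1)"
  shows "apply_left \<rho> (lvar p * rvar q) = Const (\<rho> p) * q"
  using apply_left_rvar_mult[of \<rho> q "lvar p"] apply_left_lvar[OF assms] by (simp add: mult.commute)

lemma apply_left_mult_lvar_eq_0:
  assumes lin: "\<And>p q. \<rho> (p + q) = \<rho> p + \<rho> q" "\<And>m a. \<rho> (monom m a) = a * \<rho> (monom m 1)"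
    and f: "\<And>p. \<rho> (p * f) = 0"
  shows "apply_left \<rho> (P * lvar f) = 0"
proof (induction P rule: poly_mapping_single_induct)
  case (single m q)
  have "monom m q = lvar (monom m 1) * rvar q" by (simp add: Poly_Mapping.mult_single)
  then have "monom m q * lvar f = lvar (monom m 1 * f) * rvar q"
    by (simp only: lvar.hom_mult ac_simps)
  then show ?case by (simp add: apply_left_lvar_rvar[OF lin] f)
qed (simp add: distrib_right apply_left_add)

section \<open>The socle degree of a complete intersection of quadrics\<close>

lemma lvar_minus_rvar_in_ideal:
  fixes g :: "('n::finite, complex) mpol"
  shows "lvar g - rvar g \<in> ideal.span (range (\<lambda>j. lvar (Var j) - rvar (Var j)))" (is "_ \<in> ideal.span ?S")
proof (induction g rule: poly_mapping_single_induct)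
  case (single m a)
  have e: "monom m a = Const a * (\<Prod>i\<in>UNIV. Var i ^ lookup m i)" by (rule monom_eq_prod)
  have lv: "lvar (Var i) - rvar (Var i) \<in> ideal.span ?S" for i
    by (rule ideal.span_base) blast
  have lc: "lvar (Const a) - rvar (Const a) \<in> ideal.span ?S"
    by (simp add: ideal.span_zero)
  have "lvar (Const a) * (\<Prod>i\<in>UNIV. lvar (Var i) ^ lookup m i)
      - rvar (Const a) * (\<Prod>i\<in>UNIV. rvar (Var i) ^ lookup m i) \<in> ideal.span ?S"
    by (intro ideal_cong_mult ideal_cong_prod ideal_cong_power lv lc)
  then show ?case
    unfolding e lvar.hom_mult lvar.hom_prod lvar.hom_power rvar.hom_mult rvar.hom_prod rvar.hom_power .
next
  case (add p q)
  have "lvar (p + q) - rvar (p + q) = (lvar p - rvar p) + (lvar q - rvar q)"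
    by (simp add: lvar.hom_add rvar.hom_add)
  with add show ?case by (simp only: ideal.span_add)
qed

text \<open>Residue duality. Let \<open>n\<close> be the number of variables, and write \<open>f = A x\<close> with the linear forms
  \<open>a i j = (\<Sum>k. s i j k * x k)\<close> and \<open>x ^ M = C f\<close> with forms \<open>c i j\<close>. The functional
  \<open>\<rho> p\<close>, the coefficient of \<open>\<Prod>i. x i ^ (M - 1)\<close> in \<open>p * det C\<close>, vanishes on the ideal by Cramer's rule,
  vanishes in all degrees other than \<open>n\<close>, and is 1 at \<open>det A\<close>.

  In two sets of variables, the symmetry of \<open>s\<close> gives \<open>(A(z) + A(w)) (z - w) = f(z) - f(w)\<close>. By
  Cramer's rule, multiplication by \<open>B = det (A(z) + A(w))\<close> therefore maps every difference \<open>g(z) - g(w)\<close> into the ideal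
  generated by the \<open>f i(z) - f i(w)\<close>. Now apply \<open>\<rho>\<close> in the variables \<open>z\<close>. From \<open>B * g(w)\<close> only the
  part \<open>det A(z) * g(w)\<close> of degree \<open>n\<close> in \<open>z\<close> survives and gives \<open>g(w)\<close>; nothing survives from
  \<open>B * g(z)\<close>, whose degree in \<open>z\<close> is too large; and the right-hand side becomes an element of the ideal
  of \<open>f(w)\<close>.\<close>

theorem quadrics_generate_above_socle:
  fixes f :: "'n::finite \<Rightarrow> ('n, complex) mpol" and s :: "'n \<Rightarrow> 'n \<Rightarrow> 'n \<Rightarrow> complex"
  assumes f: "\<And>i. f i = (\<Sum>j\<in>UNIV. \<Sum>k\<in>UNIV. Const (s i j k) * (Var j * Var k))"
    and sym: "\<And>i j k. s i j k = s i k j"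
    and pow: "\<And>i. Var i ^ M \<in> ideal.span (range f)" and M: "M \<ge> 2"
    and g: "g \<in> Sym d" "d > CARD('n)"
  shows "g \<in> ideal.span (range f)"
proof -
  have Sym_term: "Const c * (Var j * Var k) \<in> Sym 2" for c and j k :: 'n
    using Sym_mult[OF Const_in_Sym Sym_mult[OF Var_in_Sym Var_in_Sym]] by (simp add: numeral_2_eq_2)
  have fSym: "f i \<in> Sym 2" for i
    unfolding f by (intro Sym_sum Sym_term)
  have "\<exists>c. (\<forall>j. c j \<in> Sym (M - 2)) \<and> Var i ^ M = (\<Sum>j\<in>UNIV. c j * f j)" for i
  proof -
    have "finite (range f)" by simp
    from pow[of i] obtain u where "Var i ^ M = (\<Sum>v\<in>range f. u v * v)"
      unfolding ideal.span_finite[OF \<open>finite (range f)\<close>] by blast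
    also have "\<dots> = (\<Sum>v\<in>range f. \<Sum>j\<in>UNIV. if j = inv f v then u v * f j else 0)"
      by (simp add: f_inv_into_f)
    also have "\<dots> = (\<Sum>j\<in>UNIV. (\<Sum>v\<in>range f. if j = inv f v then u v else 0) * f j)"
      by (subst sum.swap) (auto simp: sum_distrib_right intro!: sum.cong)
    finally obtain c where c: "Var i ^ M = (\<Sum>j\<in>UNIV. c j * f j)" by (rule that)
    have "Var i ^ M = hcomp M (Var i ^ M)"
      using hcomp_of_Sym[OF Sym_power[OF Var_in_Sym], of M i M] by simp
    also have "\<dots> = (\<Sum>j\<in>UNIV. hcomp (M - 2) (c j) * f j)"
      using M by (simp only: c hcomp_sum hcomp_mult_Sym[OF fSym]) simp
    finally show ?thesis
      by (intro exI[of _ "\<lambda>j. hcomp (M - 2) (c j)"]) (simp only: hcomp_in_Sym simp_thms)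
  qed
  then obtain c where cSym: "\<And>i j. c i j \<in> Sym (M - 2)"
    and c: "\<And>i. Var i ^ M = (\<Sum>j\<in>UNIV. c i j * f j)" by metis
  define Cm where "Cm = (\<chi> i j. c i j)"
  define a where "a i j = (\<Sum>k\<in>UNIV. Const (s i j k) * Var k)" for i j
  define Am where "Am = (\<chi> i j. a i j)"
  have aSym: "a i j \<in> Sym 1" for i j
    unfolding a_def using Sym_sum[OF Sym_mult[OF Const_in_Sym Var_in_Sym]] by fastforce
  have fa: "f i = (\<Sum>j\<in>UNIV. a i j * Var j)" for i
    by (simp only: f a_def sum_distrib_left ac_simps)
  define \<mu> where "\<mu> = (\<Sum>i\<in>(UNIV :: 'n set). Poly_Mapping.single i (M - 1))"
  have mdeg_\<mu>: "mdeg \<mu> = CARD('n) * (M - 1)"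
    by (simp add: \<mu>_def Poly_Mapping.lookup_sum Poly_Mapping.lookup_single when_def)
  define \<rho> where "\<rho> p = lookup (p * det Cm) \<mu>" for p
  have \<rho>_add: "\<rho> (p + q) = \<rho> p + \<rho> q" for p q
    by (simp add: \<rho>_def distrib_right Poly_Mapping.lookup_add)
  have \<rho>_scale: "\<rho> (Const z * p) = z * \<rho> p" for z p
    by (simp add: \<rho>_def pscale_mult_left pscale_eq[symmetric])
  have \<rho>_monom: "\<rho> (monom m z) = z * \<rho> (monom m 1)" for m z
    using \<rho>_scale[of z "monom m 1"] by (simp add: Poly_Mapping.mult_single)
  have \<rho>_0: "\<rho> 0 = 0" by (simp add: \<rho>_def)
  have \<rho>_sum: "\<rho> (sum h A) = (\<Sum>x\<in>A. \<rho> (h x))" for h :: "('n \<Rightarrow> 'n) \<Rightarrow> _" and A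
    by (induction A rule: infinite_finite_induct) (simp_all add: \<rho>_0 \<rho>_add)
  note apply_simps = apply_left_lvar_rvar[of \<rho>, OF \<rho>_add \<rho>_monom]
  have \<rho>_deg: "\<rho> p = 0" if "p \<in> Sym k" "k \<noteq> CARD('n)" for p k
  proof (rule ccontr)
    assume "\<rho> p \<noteq> 0"
    moreover have "p * det Cm \<in> Sym (k + CARD('n) * (M - 2))"
      by (intro Sym_mult that Sym_det) (simp add: Cm_def cSym)
    ultimately have "mdeg \<mu> = k + CARD('n) * (M - 2)"
      unfolding \<rho>_def by (metis SymD)
    moreover have "CARD('n) * (M - 1) = CARD('n) + CARD('n) * (M - 2)"
    proof -
      have "M - 1 = Suc (M - 2)" using M by simp
      then show ?thesis by (simp only: mult_Suc_right)
    qed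
    ultimately show False using mdeg_\<mu> that by simp
  qed
  have \<rho>_f: "\<rho> (p * f j) = 0" for p j
  proof -
    have v: "Cm *v (\<chi> j. f j) = (\<chi> i. Var i ^ M)"
      by (simp add: vec_eq_iff matrix_vector_mult_def Cm_def c[symmetric] del: One_nat_def)
    have "f j * det Cm = det (\<chi> i l. if l = j then (Cm *v (\<chi> j. f j)) $ i else Cm $ i $ l)"
      by (simp add: cramer_column)
    also have "\<dots> \<in> ideal.span ((\<lambda>i. Var i ^ M) ` UNIV)"
      unfolding v by (rule det_column_in_ideal[of _ j]) (auto intro: ideal.span_base)
    finally have "p * (f j * det Cm) \<in> ideal.span ((\<lambda>i. Var i ^ M) ` UNIV)"
      by (rule ideal_mult_left)
    then have "lookup (p * (f j * det Cm)) \<mu> = 0"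
      by (rule lookup_Var_power_ideal)
        (use M in \<open>simp add: \<mu>_def Poly_Mapping.lookup_sum Poly_Mapping.lookup_single when_def\<close>)
    then show ?thesis by (simp add: \<rho>_def mult.assoc)
  qed
  have \<rho>_det: "\<rho> (det Am) = 1"
  proof -
    have "Am *v (\<chi> j. Var j) = (\<chi> i. f i)"
      by (simp add: vec_eq_iff matrix_vector_mult_def Am_def fa[symmetric] del: One_nat_def)
    then have "(Cm ** Am) *v (\<chi> j. Var j) = Cm *v (\<chi> i. f i)"
      by (simp only: matrix_vector_mul_assoc[symmetric])
    also have "\<dots> = (\<chi> i. Var i ^ M)"
      by (simp add: vec_eq_iff matrix_vector_mult_def Cm_def c[symmetric] del: One_nat_def)
    finally have "(Cm ** Am) *v (\<chi> j. Var j) = (\<chi> i. Var i ^ M)" .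
    from coeff_det_Var_powers[OF this] M show ?thesis
      by (simp add: \<rho>_def \<mu>_def det_mul mult.commute)
  qed
  define B where "B = det (\<chi> i j. lvar (a i j) + rvar (a i j))"
  \<comment> \<open>expanding the products of the entries of \<open>A(z) + A(w)\<close>, with the factors from \<open>T\<close> taken in \<open>z\<close>\<close>
  have B_mult: "apply_left \<rho> (B * lvar h) = (\<Sum>p\<in>{p. p permutes UNIV}. \<Sum>T\<in>Pow UNIV.
      of_int (sign p) * (Const (\<rho> ((\<Prod>i\<in>T. a i (p i)) * h)) * (\<Prod>i\<in>UNIV - T. a i (p i))))" for h
  proof -
    have "B * lvar h = (\<Sum>p\<in>{p. p permutes UNIV}. \<Sum>T\<in>Pow UNIV.
        rvar (of_int (sign p)) * (lvar ((\<Prod>i\<in>T. a i (p i)) * h) * rvar (\<Prod>i\<in>UNIV - T. a i (p i))))"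
      unfolding B_def det_def
      by (simp add: prod_add sum_distrib_left sum_distrib_right lvar.hom_prod rvar.hom_prod
          lvar.hom_mult rvar.hom_of_int mult_ac del: Pow_UNIV)
    then show ?thesis by (simp only: apply_left_sum apply_left_rvar_mult apply_simps)
  qed
  have deg: "(\<Prod>i\<in>T. a i (p i)) * h \<in> Sym (card T + e)" if "h \<in> Sym e" for T p h e
    using Sym_mult[OF Sym_prod[of T "\<lambda>i. a i (p i)" "\<lambda>_. 1"] that] aSym by simp
  have "apply_left \<rho> (B * lvar g) = 0"
    unfolding B_mult using g by (intro sum.neutral) (auto simp: \<rho>_deg[OF deg[OF g(1)]])
  moreover have "apply_left \<rho> B = 1"
  proof -
    have "apply_left \<rho> B = apply_left \<rho> (B * lvar 1)" by (simp add: lvar.hom_one)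
    also have "\<dots> = (\<Sum>p\<in>{p. p permutes UNIV}. \<Sum>T\<in>Pow (UNIV :: 'n set). if T = UNIV
        then of_int (sign p) * Const (\<rho> (\<Prod>i\<in>UNIV. a i (p i))) else 0)"
      unfolding B_mult
    proof (rule sum.cong[OF refl], rule sum.cong[OF refl])
      fix p :: "'n \<Rightarrow> 'n" and T :: "'n set"
      show "of_int (sign p) * (Const (\<rho> ((\<Prod>i\<in>T. a i (p i)) * 1)) * (\<Prod>i\<in>UNIV - T. a i (p i)))
        = (if T = UNIV then of_int (sign p) * Const (\<rho> (\<Prod>i\<in>UNIV. a i (p i))) else 0)"
      proof (cases "T = UNIV")
        case False
        then have "card T \<noteq> CARD('n)" using card_subset_eq[of UNIV T] by auto
        moreover have "(\<Prod>i\<in>T. a i (p i)) * 1 \<in> Sym (card T + 0)"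
          by (rule deg) (use Const_in_Sym[of 1] in simp)
        ultimately have "\<rho> ((\<Prod>i\<in>T. a i (p i)) * 1) = 0" using \<rho>_deg by simp
        with False show ?thesis by simp
      qed simp
    qed
    also have "\<dots> = (\<Sum>p\<in>{p. p permutes UNIV}. of_int (sign p) * Const (\<rho> (\<Prod>i\<in>UNIV. a i (p i))))"
      by (intro sum.cong refl) (simp add: sum.delta')
    also have "\<dots> = Const (\<rho> (det Am))"
    proof -
      interpret C: ring_1_hom "Const :: complex \<Rightarrow> ('n, complex) mpol"
        by (rule ring_1_hom_single)
      have "\<rho> (of_int n * p) = of_int n * \<rho> p" for n p
        using \<rho>_scale[of "of_int n" p] by (simp add: C.hom_of_int)
      then show ?thesis
        by (simp add: det_def Am_def \<rho>_sum C.hom_sum C.hom_mult C.hom_of_int)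
    qed
    finally show ?thesis by (simp add: \<rho>_det)
  qed
  then have "apply_left \<rho> (B * rvar g) = g"
    using apply_left_rvar_mult[of \<rho> g B] by (simp add: mult.commute)
  moreover have "apply_left \<rho> (B * (lvar g - rvar g)) \<in> ideal.span (range f)"
  proof -
    define S where "S = range (\<lambda>i. lvar (f i) - rvar (f i))"
    have "B * y \<in> ideal.span S" if "y \<in> ideal.span (range (\<lambda>j. lvar (Var j) - rvar (Var j)))" for y
      using that
    proof (induction rule: ideal.span_induct_alt)
      case base
      show ?case by (simp add: ideal.span_zero)
    next
      case (step r x y)
      then obtain k where k: "x = lvar (Var k) - rvar (Var k)" by blast
      define N where "N = (\<chi> i j. lvar (a i j) + rvar (a i j))"
      define v :: "('n, ('n, complex) mpol) mpol^'n" where "v = (\<chi> j. lvar (Var j) - rvar (Var j))"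
      have Nv: "(N *v v) $ i = lvar (f i) - rvar (f i)" for i
      proof -
        have lC: "lvar (Const z) = rvar (Const z)" for z :: complex by simp
        have "(\<Sum>j\<in>UNIV. rvar (a i j) * lvar (Var j)) = (\<Sum>j\<in>UNIV. \<Sum>k\<in>UNIV.
            rvar (Const (s i j k)) * rvar (Var k) * lvar (Var j))"
          by (simp only: a_def rvar.hom_sum rvar.hom_mult sum_distrib_right)
        also have "\<dots> = (\<Sum>k\<in>UNIV. \<Sum>j\<in>UNIV. rvar (Const (s i k j)) * lvar (Var j) * rvar (Var k))"
          by (subst sum.swap) (simp only: sym[of i] ac_simps)
        also have "\<dots> = (\<Sum>k\<in>UNIV. lvar (a i k) * rvar (Var k))"
          by (simp only: a_def lvar.hom_sum lvar.hom_mult sum_distrib_right lC)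
        finally have cross: "(\<Sum>j\<in>UNIV. rvar (a i j) * lvar (Var j)) = (\<Sum>k\<in>UNIV. lvar (a i k) * rvar (Var k))" .
        have "(N *v v) $ i = (\<Sum>j\<in>UNIV. lvar (a i j) * lvar (Var j)) + (\<Sum>j\<in>UNIV. rvar (a i j) * lvar (Var j))
            - (\<Sum>j\<in>UNIV. lvar (a i j) * rvar (Var j)) - (\<Sum>j\<in>UNIV. rvar (a i j) * rvar (Var j))"
          by (simp only: matrix_vector_mult_def N_def v_def vec_lambda_beta sum.distrib[symmetric]
              sum_subtractf[symmetric]) (simp only: algebra_simps)
        also have "\<dots> = (\<Sum>j\<in>UNIV. lvar (a i j) * lvar (Var j)) - (\<Sum>j\<in>UNIV. rvar (a i j) * rvar (Var j))"
          unfolding cross by simp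
        also have "\<dots> = lvar (f i) - rvar (f i)"
          by (simp only: fa lvar.hom_sum lvar.hom_mult rvar.hom_sum rvar.hom_mult)
        finally show ?thesis .
      qed
      have "x * B = det (\<chi> i j. if j = k then (N *v v) $ i else N $ i $ j)"
        unfolding cramer_column by (simp add: k B_def N_def v_def)
      also have "\<dots> \<in> ideal.span S"
        by (rule det_column_in_ideal[of _ k]) (auto simp: Nv S_def intro: ideal.span_base)
      finally have "r * (x * B) \<in> ideal.span S" by (rule ideal_mult_left)
      moreover have "B * (r * x + y) = r * (x * B) + B * y" by (simp only: algebra_simps)
      ultimately show ?case using step.IH by (simp only: ideal.span_add)
    qed
    then have "B * (lvar g - rvar g) \<in> ideal.span S"
      using lvar_minus_rvar_in_ideal by blast
    then show ?thesis
    proof (induction rule: ideal.span_induct_alt)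
      case base
      show ?case by (simp add: apply_left_0 ideal.span_zero)
    next
      case (step r x y)
      then obtain i where i: "x = lvar (f i) - rvar (f i)" by (auto simp: S_def)
      have "apply_left \<rho> (r * lvar (f i)) = 0"
        by (rule apply_left_mult_lvar_eq_0[OF \<rho>_add \<rho>_monom \<rho>_f])
      moreover have "apply_left \<rho> (r * rvar (f i)) = f i * apply_left \<rho> r"
        using apply_left_rvar_mult[of \<rho> "f i" r] by (simp add: mult.commute)
      ultimately have "apply_left \<rho> (r * x + y) = apply_left \<rho> y - f i * apply_left \<rho> r"
        by (simp add: i right_diff_distrib apply_left_add apply_left_diff)
      moreover have "f i * apply_left \<rho> r \<in> ideal.span (range f)"
        by (rule ideal_mult_right) (auto intro: ideal.span_base)
      ultimately show ?case using step.IH by (simp only: ideal.span_diff)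
    qed
  qed
  ultimately have "- g \<in> ideal.span (range f)"
    by (simp add: right_diff_distrib apply_left_diff)
  then show ?thesis by (metis ideal.span_neg minus_minus)
qed

section \<open>Systems of quadrics without a common zero\<close>

lemma mdeg_Suc:
  fixes m :: "'n::finite \<Rightarrow>\<^sub>0 nat"
  assumes "mdeg m = Suc d"
  obtains j m' where "m = Poly_Mapping.single j 1 + m'" "mdeg m' = d"
proof -
  obtain j where j: "lookup m j > 0"
    using assms by (metis nat.simps(3) neq0_conv sum.neutral)
  define m' where "m' = m - Poly_Mapping.single j 1"
  have m: "m = Poly_Mapping.single j 1 + m'"
    by (rule poly_mapping_eqI)
      (use j in \<open>auto simp: m'_def Poly_Mapping.lookup_add Poly_Mapping.lookup_minus
          Poly_Mapping.lookup_single when_def\<close>)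
  then have "mdeg m = 1 + mdeg m'"
    by (simp add: Poly_Mapping.lookup_add Poly_Mapping.lookup_single when_def sum.distrib)
  with m assms that show ?thesis by simp
qed

lemma Sym_2_matrix:
  assumes "q \<in> Sym 2"
  shows "\<exists>s. (\<forall>j k. s j k = s k j)
    \<and> q = (\<Sum>j\<in>UNIV. \<Sum>k\<in>UNIV. Const (s j k) * (Var j * Var k))"
proof -
  define form where "form s = (\<Sum>j\<in>UNIV. \<Sum>k\<in>UNIV. Const (s j k) * (Var j * Var k))"
    for s :: "'a \<Rightarrow> 'a \<Rightarrow> complex"
  define Q where "Q = {form s | s. \<forall>j k. s j k = s k j}"
  have "pvs.subspace Q"
  proof (rule pvs.subspaceI)
    have "form (\<lambda>_ _. 0) \<in> Q" unfolding Q_def by blast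
    then show "0 \<in> Q" by (simp add: form_def)
  next
    fix x y assume "x \<in> Q" "y \<in> Q"
    then obtain s t where st: "x = form s" "y = form t"
      "\<And>j k. s j k = s k j" "\<And>j k. t j k = t k j" by (auto simp: Q_def)
    have "x + y = form (\<lambda>j k. s j k + t j k)"
      by (simp add: st(1,2) form_def Poly_Mapping.single_add distrib_right sum.distrib)
    moreover have "\<forall>j k. s j k + t j k = s k j + t k j" using st(3,4) by metis
    ultimately show "x + y \<in> Q" unfolding Q_def by blast
  next
    fix c x assume "x \<in> Q"
    then obtain s where s: "x = form s" "\<And>j k. s j k = s k j" by (auto simp: Q_def)
    have "(Const (c * s j k) :: ('a, complex) mpol) = Const c * Const (s j k)" for j k
      by (simp add: Poly_Mapping.mult_single)
    then have "pscale c x = form (\<lambda>j k. c * s j k)"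
      by (simp only: s(1) form_def pscale_eq sum_distrib_left mult.assoc)
    moreover have "\<forall>j k. c * s j k = c * s k j" using s(2) by metis
    ultimately show "pscale c x \<in> Q" unfolding Q_def by blast
  qed
  moreover have "monom m 1 \<in> Q" if m2: "mdeg m = 2" for m
  proof -
    obtain j m' where j: "m = Poly_Mapping.single j 1 + m'" "mdeg m' = 1"
      by (rule mdeg_Suc[of m 1]) (use m2 in auto)
    obtain k m'' where k: "m' = Poly_Mapping.single k 1 + m''" "mdeg m'' = 0"
      by (rule mdeg_Suc[of m' 0]) (use j in auto)
    have "m'' = 0" by (rule poly_mapping_eqI) (use k(2) in simp)
    then have m: "monom m 1 = Var j * (Var k :: ('a, complex) mpol)"
      by (simp add: j k Poly_Mapping.mult_single)
    define e :: "'a \<Rightarrow> 'a \<Rightarrow> 'a \<Rightarrow> 'a \<Rightarrow> complex"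
      where "e j k a b = (if a = j then if b = k then 1 / 2 else 0 else 0)" for j k a b
    have form_e: "form (e j k) = Const (1 / 2) * (Var j * Var k)" for j k
    proof -
      have "form (e j k) = (\<Sum>a\<in>UNIV. if a = j then Const (1 / 2) * (Var j * Var k) else 0)"
        unfolding form_def
      proof (intro sum.cong refl)
        fix a
        have "(\<Sum>b\<in>UNIV. Const (e j k a b) * (Var a * Var b))
            = (\<Sum>b\<in>UNIV. if b = k then (if a = j then Const (1 / 2) * (Var j * Var k) else 0) else 0)"
          by (rule sum.cong) (auto simp: e_def)
        then show "(\<Sum>b\<in>UNIV. Const (e j k a b) * (Var a * Var b))
            = (if a = j then Const (1 / 2) * (Var j * Var k) else 0)" by simp
      qed
      then show ?thesis by simp
    qed
    have "form (\<lambda>a b. e j k a b + e k j a b) = form (e j k) + form (e k j)"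
      by (simp add: form_def Poly_Mapping.single_add distrib_right sum.distrib)
    also have "\<dots> = (Const (1 / 2) + Const (1 / 2)) * (Var j * Var k)"
      unfolding form_e mult.commute[of "Var k"] by (rule distrib_right[symmetric])
    also have "Const (1 / 2) + Const (1 / 2) = (1 :: ('a, complex) mpol)"
      by (simp flip: Poly_Mapping.single_add)
    finally have "monom m 1 = form (\<lambda>a b. e j k a b + e k j a b)" using m by simp
    moreover have "\<forall>a b. e j k a b + e k j a b = e j k b a + e k j b a" by (auto simp: e_def)
    ultimately show ?thesis unfolding Q_def by blast
  qed
  ultimately have "pvs.span ((\<lambda>m. monom m 1) ` {m. mdeg m = 2}) \<subseteq> Q"
    by (intro pvs.span_minimal) auto
  moreover have "q \<in> pvs.span ((\<lambda>m. monom m 1) ` {m. mdeg m = 2})"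
    by (rule in_span_monomials) (use assms in \<open>auto simp: Sym_def\<close>)
  ultimately show ?thesis by (auto simp: Q_def form_def)
qed

text \<open>One of the exponents is determined by the others.\<close>

lemma card_mdeg_le: "card {m :: 'n::finite \<Rightarrow>\<^sub>0 nat. mdeg m = d} \<le> (d + 1) ^ (CARD('n) - 1)"
proof -
  define i0 :: 'n where "i0 = undefined"
  define r where "r m = restrict (lookup m) (- {i0})" for m :: "'n \<Rightarrow>\<^sub>0 nat"
  have le: "lookup m i \<le> mdeg m" for m :: "'n \<Rightarrow>\<^sub>0 nat" and i
    by (rule member_le_sum) auto
  have "inj_on r {m. mdeg m = d}"
  proof (rule inj_onI)
    fix m m' assume m: "m \<in> {m. mdeg m = d}" "m' \<in> {m. mdeg m = d}" "r m = r m'"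
    have eq: "lookup m i = lookup m' i" if "i \<noteq> i0" for i
      using fun_cong[OF m(3), of i] that by (simp add: r_def)
    have "mdeg m = lookup m i0 + (\<Sum>i\<in>- {i0}. lookup m i)"
      "mdeg m' = lookup m' i0 + (\<Sum>i\<in>- {i0}. lookup m' i)"
      by (simp_all add: sum.remove[of UNIV i0] Compl_eq_Diff_UNIV)
    moreover have "(\<Sum>i\<in>- {i0}. lookup m i) = (\<Sum>i\<in>- {i0}. lookup m' i)"
      by (rule sum.cong) (auto simp: eq)
    ultimately have "lookup m i0 = lookup m' i0" using m by simp
    with eq show "m = m'" by (metis poly_mapping_eqI)
  qed
  moreover have "r m \<in> (\<Pi>\<^sub>E i\<in>- {i0}. {..d})" if "mdeg m = d" for m
    using le[of m] that by (simp add: r_def restrict_PiE_iff)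
  then have "r ` {m. mdeg m = d} \<subseteq> (\<Pi>\<^sub>E i\<in>- {i0}. {..d})" by blast
  moreover have "finite (\<Pi>\<^sub>E i\<in>- {i0}. {..d})" by (intro finite_PiE) auto
  ultimately have "card {m :: 'n \<Rightarrow>\<^sub>0 nat. mdeg m = d} \<le> card (\<Pi>\<^sub>E i\<in>- {i0}. {..d})"
    by (meson card_inj_on_le)
  also have "\<dots> = (d + 1) ^ (CARD('n) - 1)"
    by (simp add: card_PiE Compl_eq_Diff_UNIV card_Diff_singleton)
  finally show ?thesis .
qed

text \<open>Noether normalization. More quadrics than variables are algebraically dependent, for reasons of
  dimension: with \<open>n\<close> variables, there are \<open>K ^ n\<close> products of \<open>n * K\<close> of the chosen \<open>n + 1\<close> quadrics in
  which all but \<open>f0\<close> have exponents less than \<open>K\<close>, while the forms of degree \<open>2 * n * K\<close> have dimension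
  at most \<open>(2 * n * K + 1) ^ (n - 1)\<close>. At a point \<open>x\<close> where the relation does not vanish, replacing
  each \<open>g\<close> by \<open>g - x g * f0\<close> turns the relation into the statement that a power of \<open>f0\<close> lies in the ideal of
  the new quadrics. Modulo this ideal all old generators are multiples of the nilpotent \<open>f0\<close>.\<close>

lemma drop_generator:
  fixes F H :: "('n::finite, complex) mpol set"
  assumes H: "pvs.subspace H" "H \<subseteq> Sym 2"
    and F: "finite F" "F \<subseteq> H" "card F > CARD('n)"
    and pow: "\<And>i. \<exists>k. Var i ^ k \<in> ideal.span F"
  obtains F' where "finite F'" "F' \<subseteq> H" "card F' < card F" "\<And>i. \<exists>k. Var i ^ k \<in> ideal.span F'"
proof -
  define n where "n = CARD('n)"
  obtain G where G: "G \<subseteq> F" "card G = Suc n" "finite G"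
    by (rule obtain_subset_with_card_n[of "Suc n" F]) (use F in \<open>auto simp: n_def\<close>)
  then obtain f0 where f0: "f0 \<in> G" by fastforce
  define V where "V = G - {f0}"
  have V: "finite V" "card V = n" "f0 \<notin> V" "G = insert f0 V"
    using G f0 by (auto simp: V_def)
  \<comment> \<open>large enough for \<open>((2 * n + 1) * K) ^ (n - 1) < K ^ n\<close>\<close>
  define K where "K = Suc ((2 * n + 1) ^ (n - 1))"
  define I where "I = (\<Pi>\<^sub>E g\<in>V. {..<K})"
  have I: "finite I" "card I = K ^ n"
    using V by (auto simp: I_def card_PiE intro!: finite_PiE)
  define \<phi> where "\<phi> e = (\<Prod>g\<in>V. g ^ e g) * f0 ^ (n * K - sum e V)" for e
  have sum_le: "sum e V \<le> n * K" if "e \<in> I" for e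
  proof -
    have "sum e V \<le> (\<Sum>g\<in>V. K)"
      by (rule sum_mono) (use that in \<open>auto simp: I_def PiE_def Pi_def less_imp_le\<close>)
    with V show ?thesis by simp
  qed
  have "\<phi> e \<in> Sym (2 * n * K)" if "e \<in> I" for e
  proof -
    have "(\<Prod>g\<in>V. g ^ e g) \<in> Sym (\<Sum>g\<in>V. e g * 2)"
      by (intro Sym_prod Sym_power) (use H F G V in blast)
    moreover have "f0 ^ (n * K - sum e V) \<in> Sym ((n * K - sum e V) * 2)"
      by (intro Sym_power) (use H F G f0 in blast)
    ultimately have "\<phi> e \<in> Sym ((\<Sum>g\<in>V. e g * 2) + (n * K - sum e V) * 2)"
      unfolding \<phi>_def by (rule Sym_mult)
    moreover have "(\<Sum>g\<in>V. e g * 2) + (n * K - sum e V) * 2 = 2 * n * K"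
      using sum_le[OF that] by (simp flip: sum_distrib_right)
    ultimately show ?thesis by simp
  qed
  define T where "T = (\<lambda>m. monom m (1::complex)) ` {m :: 'n \<Rightarrow>\<^sub>0 nat. mdeg m = 2 * n * K}"
  have fin: "finite {m :: 'n \<Rightarrow>\<^sub>0 nat. mdeg m = 2 * n * K}"
    by (rule finite_subset[OF _ finite_mdeg_le[of "2 * n * K"]]) auto
  then have T: "finite T" by (simp add: T_def)
  have "card T \<le> (2 * n * K + 1) ^ (n - 1)"
    unfolding T_def using card_image_le[OF fin] card_mdeg_le[where 'n = 'n] le_trans
    unfolding n_def by blast
  also have "\<dots> \<le> ((2 * n + 1) * K) ^ (n - 1)"
    by (rule power_mono) (auto simp: K_def)
  also have "\<dots> = (2 * n + 1) ^ (n - 1) * K ^ (n - 1)" by (rule power_mult_distrib)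
  also have "\<dots> < K * K ^ (n - 1)" by (simp add: K_def)
  also have "\<dots> = K ^ n" by (metis n_def power_eq_if zero_less_card_finite less_irrefl)
  finally have card: "card T < card I" using I by simp
  have "\<phi> ` I \<subseteq> pvs.span T"
    unfolding T_def using \<open>\<And>e. e \<in> I \<Longrightarrow> \<phi> e \<in> Sym (2 * n * K)\<close>
    by (auto intro!: in_span_monomials simp: Sym_def)
  from family_dependent[OF I(1) T this card] obtain a eb
    where a: "eb \<in> I" "a eb \<noteq> 0" "(\<Sum>e\<in>I. pscale (a e) (\<phi> e)) = 0" by blast
  have "\<exists>x. (\<Sum>e\<in>I. a e * (\<Prod>g\<in>V. x g ^ e g)) \<noteq> 0"
  proof (rule nonvanishing_point[of V I eb a])
    show "e = e'" if "e \<in> I" "e' \<in> I" "\<forall>g\<in>V. e g = e' g" for e e'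
      using that unfolding I_def by (intro PiE_ext[of e V "\<lambda>_. {..<K}" e']) auto
  qed (use V I a in auto)
  then obtain x where x: "(\<Sum>e\<in>I. a e * (\<Prod>g\<in>V. x g ^ e g)) \<noteq> 0" by blast
  define F' where "F' = (\<lambda>g. g - pscale (x g) f0) ` V \<union> (F - G)"
  have V_cong: "g - Const (x g) * f0 \<in> ideal.span F'" if "g \<in> V" for g
    by (rule ideal.span_base) (use that in \<open>auto simp: F'_def pscale_eq\<close>)
  have f0_pow: "f0 ^ (n * K) \<in> ideal.span F'"
  proof -
    interpret C: ring_1_hom "Const :: complex \<Rightarrow> ('n, complex) mpol"
      by (rule ring_1_hom_single)
    have "(\<Sum>e\<in>I. Const (a e) * \<phi> e) - (\<Sum>e\<in>I. Const (a e) *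
        ((\<Prod>g\<in>V. (Const (x g) * f0) ^ e g) * f0 ^ (n * K - sum e V))) \<in> ideal.span F'"
      unfolding \<phi>_def
      by (intro ideal_cong_sum ideal_cong_mult ideal_cong_prod ideal_cong_power V_cong)
        (simp_all add: ideal.span_zero)
    moreover have "Const (a e) * ((\<Prod>g\<in>V. (Const (x g) * f0) ^ e g) * f0 ^ (n * K - sum e V))
        = Const (a e * (\<Prod>g\<in>V. x g ^ e g)) * f0 ^ (n * K)" if "e \<in> I" for e
    proof -
      have "f0 ^ sum e V * f0 ^ (n * K - sum e V) = f0 ^ (n * K)"
        using sum_le[OF that] by (simp flip: power_add)
      then show ?thesis
        by (simp add: power_mult_distrib prod.distrib C.hom_mult C.hom_prod C.hom_power power_sum[symmetric]
            mult.assoc)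
    qed
    moreover have "(\<Sum>e\<in>I. Const (a e) * \<phi> e) = 0" using a(3) by (simp add: pscale_eq)
    ultimately have "- (Const (\<Sum>e\<in>I. a e * (\<Prod>g\<in>V. x g ^ e g)) * f0 ^ (n * K)) \<in> ideal.span F'"
      by (simp add: C.hom_sum sum_distrib_right cong: sum.cong)
    from ideal_mult_left[OF ideal.span_neg[OF this], of "Const (1 / (\<Sum>e\<in>I. a e * (\<Prod>g\<in>V. x g ^ e g)))"]
    show ?thesis using x by (simp add: Poly_Mapping.mult_single mult.assoc[symmetric])
  qed
  have F_cong: "\<exists>r. h - r * f0 \<in> ideal.span F'" if "h \<in> ideal.span F" for h
    using that
  proof (induction rule: ideal.span_induct_alt)
    case base
    show ?case by (rule exI[of _ 0]) (simp add: ideal.span_zero)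
  next
    case (step c g y)
    have "\<exists>r. g - r * f0 \<in> ideal.span F'"
    proof (cases "g \<in> G")
      case True
      then consider "g = f0" | "g \<in> V" using V by blast
      then show ?thesis
      proof cases
        case 1
        then show ?thesis by (intro exI[of _ 1]) (simp add: ideal.span_zero)
      qed (use V_cong in blast)
    next
      case False
      with step have "g \<in> F'" by (auto simp: F'_def)
      then show ?thesis by (intro exI[of _ 0]) (simp add: ideal.span_base)
    qed
    with step obtain r r' where "g - r * f0 \<in> ideal.span F'" "y - r' * f0 \<in> ideal.span F'" by blast
    then have "c * (g - r * f0) + (y - r' * f0) \<in> ideal.span F'"
      by (intro ideal.span_add ideal_mult_left)
    also have "c * (g - r * f0) + (y - r' * f0) = c * g + y - (c * r + r') * f0"
      by (simp add: algebra_simps)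
    finally show ?case by blast
  qed
  show ?thesis
  proof
    show "finite F'" using V F by (simp add: F'_def)
    show "F' \<subseteq> H"
      using V F G H f0 by (auto simp: F'_def intro!: pvs.subspace_diff pvs.subspace_scale)
    have "card F' \<le> card ((\<lambda>g. g - pscale (x g) f0) ` V) + card (F - G)"
      unfolding F'_def by (rule card_Un_le)
    also have "\<dots> \<le> n + (card F - Suc n)"
      using card_image_le[OF V(1)] V(2) G by (simp add: card_Diff_subset)
    also have "\<dots> < card F" using F by (simp add: n_def)
    finally show "card F' < card F" .
    show "\<exists>k. Var i ^ k \<in> ideal.span F'" for i
    proof -
      obtain k where "Var i ^ k \<in> ideal.span F" using pow by blast
      then obtain r where "Var i ^ k - r * f0 \<in> ideal.span F'" using F_cong by blast
      then have "(Var i ^ k) ^ (n * K) - (r * f0) ^ (n * K) \<in> ideal.span F'" by (rule ideal_cong_power)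
      moreover have "(r * f0) ^ (n * K) \<in> ideal.span F'"
        unfolding power_mult_distrib by (rule ideal_mult_left[OF f0_pow])
      ultimately have "(Var i ^ k) ^ (n * K) \<in> ideal.span F'"
        using ideal.span_add by fastforce
      then show ?thesis by (metis power_mult)
    qed
  qed
qed

lemma few_generators:
  fixes F H :: "('n::finite, complex) mpol set"
  assumes H: "pvs.subspace H" "H \<subseteq> Sym 2"
    and "finite F" "F \<subseteq> H" "\<And>i. \<exists>k. Var i ^ k \<in> ideal.span F"
  shows "\<exists>F'. finite F' \<and> F' \<subseteq> H \<and> card F' \<le> CARD('n) \<and> (\<forall>i. \<exists>k. Var i ^ k \<in> ideal.span F')"
  using assms(3-)
proof (induction "card F" arbitrary: F rule: less_induct)
  case less
  show ?case
  proof (cases "card F > CARD('n)")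
    case True
    obtain F' where F': "finite F'" "F' \<subseteq> H" "card F' < card F" "\<And>i. \<exists>k. Var i ^ k \<in> ideal.span F'"
      using drop_generator[OF H less.prems(1,2) True less.prems(3)] by blast
    from less.hyps[OF F'(3,1,2,4)] show ?thesis .
  next
    case False
    with less.prems show ?thesis by (intro exI[of _ F]) auto
  qed
qed

theorem no_common_zero_imp_in_ideal:
  fixes H :: "('n::finite, complex) mpol set"
  assumes H: "pvs.subspace H" "H \<subseteq> Sym 2"
    and zero: "\<And>z. (\<And>q. q \<in> H \<Longrightarrow> peval q z = 0) \<Longrightarrow> z = 0"
    and g: "g \<in> Sym d" "d > CARD('n)"
  shows "g \<in> ideal.span H"
proof -
  have "\<exists>F. finite F \<and> F \<subseteq> H \<and> (\<exists>k. Var i ^ k \<in> ideal.span F)" for i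
  proof -
    obtain k where "Var i ^ k \<in> ideal.span H"
      by (rule Var_power_in_ideal[of H i]) (use H zero in auto)
    then obtain t r where t: "finite t" "t \<subseteq> H" "Var i ^ k = (\<Sum>a\<in>t. r a * a)"
      unfolding ideal.span_explicit by blast
    then have "Var i ^ k \<in> ideal.span t"
      by (simp only:) (intro ideal.span_sum ideal_mult_left ideal.span_base)
    with t show ?thesis by blast
  qed
  then obtain t where t: "\<And>i. finite (t i)" "\<And>i. t i \<subseteq> H" "\<And>i. \<exists>k. Var i ^ k \<in> ideal.span (t i)"
    by metis
  have "\<exists>F'. finite F' \<and> F' \<subseteq> H \<and> card F' \<le> CARD('n) \<and> (\<forall>i. \<exists>k. Var i ^ k \<in> ideal.span F')"
  proof (rule few_generators[OF H, of "\<Union>i. t i"])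
    show "\<exists>k. Var i ^ k \<in> ideal.span (\<Union>i. t i)" for i
      using t(3)[of i] ideal.span_mono[of "t i" "\<Union>i. t i"] by blast
  qed (use t in auto)
  then obtain F where F: "finite F" "F \<subseteq> H" "card F \<le> CARD('n)" "\<And>i. \<exists>k. Var i ^ k \<in> ideal.span F"
    by blast
  obtain \<iota> :: "_ \<Rightarrow> 'n" where \<iota>: "inj_on \<iota> F"
    using card_le_inj[OF F(1) _ F(3)] by auto
  define f where "f j = (if j \<in> \<iota> ` F then inv_into F \<iota> j else 0)" for j
  have F_f: "F \<subseteq> range f"
  proof
    fix q assume "q \<in> F"
    then have "f (\<iota> q) = q" using \<iota> by (simp add: f_def)
    then show "q \<in> range f" by (metis rangeI)
  qed
  have f_H: "f j \<in> H" for j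
    using F(2) H(1) inv_into_into[of j \<iota> F] by (auto simp: f_def pvs.subspace_0)
  obtain k where k: "\<And>i. Var i ^ k i \<in> ideal.span F" using F(4) by metis
  define M where "M = (\<Sum>i\<in>UNIV. k i) + 2"
  have "Var i ^ M \<in> ideal.span (range f)" for i
  proof -
    have "k i \<le> M" using member_le_sum[of i UNIV k] by (simp add: M_def)
    then have "(Var i :: ('n, complex) mpol) ^ M = Var i ^ (M - k i) * Var i ^ k i"
      by (simp flip: power_add)
    also have "\<dots> \<in> ideal.span F" by (rule ideal_mult_left[OF k])
    finally show ?thesis using ideal.span_mono[OF F_f] by blast
  qed
  moreover have "\<exists>s. (\<forall>j k. s j k = s k j)
    \<and> f i = (\<Sum>j\<in>UNIV. \<Sum>k\<in>UNIV. Const (s j k) * (Var j * Var k))" for i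
    by (rule Sym_2_matrix) (use f_H H in blast)
  then have "\<exists>s. \<forall>i. (\<forall>j k. s i j k = s i k j)
    \<and> f i = (\<Sum>j\<in>UNIV. \<Sum>k\<in>UNIV. Const (s i j k) * (Var j * Var k))"
    by (intro choice allI)
  then obtain s where s: "\<And>i j k. s i j k = s i k j"
    "\<And>i. f i = (\<Sum>j\<in>UNIV. \<Sum>k\<in>UNIV. Const (s i j k) * (Var j * Var k))" by blast
  ultimately have "g \<in> ideal.span (range f)"
    using quadrics_generate_above_socle[OF s(2,1) _ _ g, of M] by (simp add: M_def)
  moreover have "ideal.span (range f) \<subseteq> ideal.span H" by (rule ideal.span_mono) (use f_H in blast)
  ultimately show ?thesis by blast
qed

lemma hcomp_ideal_in_span:
  fixes H :: "('n::finite, complex) mpol set"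
  assumes H: "H \<subseteq> Sym d" and "h \<in> ideal.span H"
  shows "hcomp (k + d) h \<in> pvs.span {p * q | p q. p \<in> Sym k \<and> q \<in> H}"
  using assms(2)
proof (induction rule: ideal.span_induct_alt)
  case base
  show ?case by (simp add: hcomp_0 pvs.span_zero)
next
  case (step c x y)
  then have "x \<in> Sym d" using H by blast
  then have "hcomp (k + d) (c * x + y) = hcomp k c * x + hcomp (k + d) y"
    by (simp add: hcomp_add hcomp_mult_Sym)
  moreover have "hcomp k c * x \<in> pvs.span {p * q | p q. p \<in> Sym k \<and> q \<in> H}"
    by (rule pvs.span_base) (use step hcomp_in_Sym in blast)
  ultimately show ?case using step.IH by (simp add: pvs.span_add)
qed

section \<open>The rank of the multiplication map\<close>

lemma independent_monomials: "pvs.independent ((\<lambda>m. monom m (1::'a::field)) ` K)"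
proof -
  have "pvs.independent ((\<lambda>m. monom m (1::'a)) ` L)" if fin: "finite L" for L :: "('n \<Rightarrow>\<^sub>0 nat) set"
  proof
    assume "pvs.dependent ((\<lambda>m. monom m (1::'a)) ` L)"
    then obtain u where "\<exists>v\<in>(\<lambda>m. monom m (1::'a)) ` L. u v \<noteq> 0"
      and u: "(\<Sum>v\<in>(\<lambda>m. monom m (1::'a)) ` L. pscale (u v) v) = 0"
      unfolding pvs.dependent_finite[OF finite_imageI[OF fin]] by blast
    then obtain m0 where m0: "m0 \<in> L" "u (monom m0 1) \<noteq> 0" by blast
    have inj: "inj_on (\<lambda>m. monom m (1::'a)) L"
      by (rule inj_onI) (metis Poly_Mapping.lookup_single_eq Poly_Mapping.lookup_single_not_eq zero_neq_one)
    have "0 = lookup (\<Sum>m\<in>L. pscale (u (monom m 1)) (monom m 1)) m0"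
      using u by (simp add: sum.reindex[OF inj])
    also have "\<dots> = u (monom m0 1)"
      using fin m0 by (simp add: Poly_Mapping.lookup_sum Poly_Mapping.lookup_single when_def)
    finally show False using m0 by simp
  qed
  note indep = this
  show ?thesis
  proof
    assume "pvs.dependent ((\<lambda>m. monom m (1::'a)) ` K)"
    then have "\<exists>t u. finite t \<and> t \<subseteq> (\<lambda>m. monom m (1::'a)) ` K
      \<and> (\<Sum>v\<in>t. pscale (u v) v) = 0 \<and> (\<exists>v\<in>t. u v \<noteq> 0)"
      by (simp only: pvs.dependent_explicit)
    then obtain t u where t: "finite t" "t \<subseteq> (\<lambda>m. monom m (1::'a)) ` K"
      "(\<Sum>v\<in>t. pscale (u v) v) = 0" "\<exists>v\<in>t. u v \<noteq> 0"
      by (elim exE conjE)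
    have "pvs.dependent t"
      unfolding pvs.dependent_finite[OF t(1)] using t(3,4) by (intro exI[of _ u] conjI)
    moreover obtain L where "L \<subseteq> K" "finite L" "t = (\<lambda>m. monom m (1::'a)) ` L"
      using finite_subset_image[OF t(1,2)] by (elim exE conjE)
    ultimately show False using indep by blast
  qed
qed

lemma Sym_eq_span: "Sym k = pvs.span ((\<lambda>m. monom m 1) ` {m. mdeg m = k})"
proof
  show "Sym k \<subseteq> pvs.span ((\<lambda>m. monom m 1) ` {m. mdeg m = k})"
    by (auto intro!: in_span_monomials simp: Sym_def)
  show "pvs.span ((\<lambda>m. monom m 1) ` {m. mdeg m = k}) \<subseteq> Sym k"
    by (rule pvs.span_minimal[OF _ subspace_Sym]) (auto intro: monom_in_Sym)
qed

lemma card_mdeg_4: "card {m :: 4 \<Rightarrow>\<^sub>0 nat. mdeg m = 5} = 56"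
proof -
  have "bij_betw (\<lambda>m :: 4 \<Rightarrow>\<^sub>0 nat. [lookup m 1, lookup m 2, lookup m 3, lookup m 4])
      {m. mdeg m = 5} {l. length l = 4 \<and> sum_list l = 5}"
    unfolding bij_betw_def
  proof
    show "inj_on (\<lambda>m :: 4 \<Rightarrow>\<^sub>0 nat. [lookup m 1, lookup m 2, lookup m 3, lookup m 4]) {m. mdeg m = 5}"
    proof (rule inj_onI)
      fix m m' :: "4 \<Rightarrow>\<^sub>0 nat"
      assume "[lookup m 1, lookup m 2, lookup m 3, lookup m 4] = [lookup m' 1, lookup m' 2, lookup m' 3, lookup m' 4]"
      then have "\<forall>i. lookup m i = lookup m' i" by (simp add: forall_4)
      then show "m = m'" by (simp add: poly_mapping_eqI)
    qed
    show "(\<lambda>m :: 4 \<Rightarrow>\<^sub>0 nat. [lookup m 1, lookup m 2, lookup m 3, lookup m 4]) ` {m. mdeg m = 5}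
        = {l. length l = 4 \<and> sum_list l = 5}"
    proof (intro equalityI subsetI)
      fix l :: "nat list" assume "l \<in> {l. length l = 4 \<and> sum_list l = 5}"
      then obtain a b c d where l: "l = [a, b, c, d]" "a + b + c + d = 5"
        by (auto simp: numeral_eq_Suc length_Suc_conv)
      define m :: "4 \<Rightarrow>\<^sub>0 nat" where "m = Poly_Mapping.single 1 a + Poly_Mapping.single 2 b
        + Poly_Mapping.single 3 c + Poly_Mapping.single 4 d"
      have "[lookup m 1, lookup m 2, lookup m 3, lookup m 4] = l"
        by (simp add: m_def l Poly_Mapping.lookup_add Poly_Mapping.lookup_single)
      moreover from this have "mdeg m = 5" using l by (simp add: sum_4)
      ultimately show "l \<in> (\<lambda>m :: 4 \<Rightarrow>\<^sub>0 nat. [lookup m 1, lookup m 2, lookup m 3, lookup m 4]) ` {m. mdeg m = 5}"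
        by (metis (mono_tags, lifting) image_eqI mem_Collect_eq)
    qed (auto simp: sum_4)
  qed
  then have "card {m :: 4 \<Rightarrow>\<^sub>0 nat. mdeg m = 5} = (5 + 4 - 1) choose 5"
    by (simp only: bij_betw_same_card card_length_sum_list)
  also have "\<dots> = 56" by (simp add: numeral_eq_Suc)
  finally show ?thesis .
qed

lemma tensor_mult_image:
  "tensor_mult ` tensor_space U W = {mult_free x | x. keys x \<subseteq> U \<times> W}"
  unfolding tensor_space_def by (force simp: quotient_def tensor_mult_class image_iff)

lemma mult_free_closed:
  assumes "pvs.subspace S" "\<And>u w. u \<in> U \<Longrightarrow> w \<in> W \<Longrightarrow> u * w \<in> S" "keys x \<subseteq> U \<times> W"
  shows "mult_free x \<in> S"
  unfolding mult_free_def
  by (intro pvs.subspace_sum[OF assms(1)] pvs.subspace_scale[OF assms(1)] assms(2)) (use assms(3) in auto)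

text \<open>The quintic forms have dimension 56. If \<open>z\<close> is a common zero, the image consists of forms vanishing at
  \<open>z\<close> and misses the fifth power of a variable that is nonzero at \<open>z\<close>. Otherwise every quintic lies in the
  ideal of the Hesse system, and comparing components shows that cubic multipliers suffice.\<close>

theorem mu_rank_le_iff_common_zero:
  fixes \<phi> :: "(4, real) mpol"
  shows "mu_rank \<phi> \<le> 55 \<longleftrightarrow> (\<exists>z. z \<noteq> 0 \<and> (\<forall>q\<in>hesse_system \<phi>. peval q z = 0))"
proof -
  define H where "H = hesse_system \<phi>"
  define A where "A = {mult_free x | x. keys x \<subseteq> Sym 3 \<times> H}"
  define T where "T = (\<lambda>m. monom m (1::complex)) ` {m :: 4 \<Rightarrow>\<^sub>0 nat. mdeg m = 5}"
  have H: "pvs.subspace H" "H \<subseteq> Sym 2"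
    using hesse_system_Sym by (simp_all add: H_def hesse_system_def)
  have rank: "mu_rank \<phi> = pvs.dim A"
    by (simp add: mu_rank_def A_def H_def tensor_mult_image)
  have inj: "inj (\<lambda>m :: 4 \<Rightarrow>\<^sub>0 nat. monom m (1::complex))"
    by (rule injI) (metis Poly_Mapping.lookup_single_eq Poly_Mapping.lookup_single_not_eq zero_neq_one)
  have T: "pvs.independent T" "card T = 56" "finite T" "Sym 5 = pvs.span T"
    unfolding T_def Sym_eq_span using independent_monomials card_mdeg_4 inj
    by (auto simp: card_image[OF inj_on_subset[OF inj]] intro: card_ge_0_finite)
  have A_Sym: "A \<subseteq> Sym 5"
    using mult_free_closed[OF subspace_Sym[of 5], of "Sym 3" H] Sym_mult[of _ 3 _ 2] H(2)
    by (fastforce simp: A_def)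
  have prod_A: "p * q \<in> A" if "p \<in> Sym 3" "q \<in> H" for p q
  proof -
    have "p * q = mult_free (Poly_Mapping.single (p, q) 1)" by (simp add: mult_free_single)
    with that show ?thesis unfolding A_def by fastforce
  qed
  show ?thesis
  proof
    assume le: "mu_rank \<phi> \<le> 55"
    show "\<exists>z. z \<noteq> 0 \<and> (\<forall>q\<in>hesse_system \<phi>. peval q z = 0)"
    proof (rule ccontr)
      assume "\<not> ?thesis"
      then have zero: "z = 0" if "\<And>q. q \<in> H \<Longrightarrow> peval q z = 0" for z
        using that by (auto simp: H_def)
      have "Sym 5 \<subseteq> pvs.span A"
      proof
        fix g :: "(4, complex) mpol" assume g: "g \<in> Sym 5"
        have "g \<in> ideal.span H"
          by (rule no_common_zero_imp_in_ideal[OF H zero g]) auto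
        from hcomp_ideal_in_span[OF H(2) this, of 3]
        have "g \<in> pvs.span {p * q | p q. p \<in> Sym 3 \<and> q \<in> H}"
          by (simp add: hcomp_of_Sym[OF g])
        moreover have "{p * q | p q. p \<in> Sym 3 \<and> q \<in> H} \<subseteq> A" using prod_A by blast
        ultimately show "g \<in> pvs.span A" using pvs.span_mono by blast
      qed
      moreover have "pvs.span A \<subseteq> Sym 5" by (rule pvs.span_minimal[OF A_Sym subspace_Sym])
      ultimately have "pvs.span A = pvs.span T" using T by auto
      then have "pvs.dim A = 56" using T pvs.dim_eq_card[of T A] by simp
      with le rank show False by simp
    qed
  next
    assume "\<exists>z. z \<noteq> 0 \<and> (\<forall>q\<in>hesse_system \<phi>. peval q z = 0)"
    then obtain z where z: "z \<noteq> 0" "\<And>q. q \<in> H \<Longrightarrow> peval q z = 0" by (auto simp: H_def)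
    obtain i where i: "z $ i \<noteq> 0" using z(1) by (auto simp: vec_eq_iff)
    define S where "S = {p :: (4, complex) mpol. peval p z = 0}"
    have S: "pvs.subspace S"
      by (rule pvs.subspaceI) (auto simp: S_def peval.hom_zero peval_add peval_pscale)
    have "A \<subseteq> S"
      using mult_free_closed[OF S, of "Sym 3" H] z(2) by (auto simp: A_def S_def peval_mult)
    then have A_S: "pvs.span A \<subseteq> S" by (rule pvs.span_minimal[OF _ S])
    obtain B where B: "B \<subseteq> A" "pvs.independent B" "A \<subseteq> pvs.span B" "card B = pvs.dim A"
      by (rule pvs.basis_exists[of A]) 
    define p where "p = (Var i ^ 5 :: (4, complex) mpol)"
    have "p \<notin> S" using i by (simp add: p_def S_def peval.hom_power peval_Var del: One_nat_def)
    then have p: "p \<notin> pvs.span B" using A_S pvs.span_mono[OF B(1)] by blast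
    then have "pvs.independent (insert p B)" using B(2) by (simp add: pvs.independent_insert)
    moreover have "p \<in> Sym 5"
      unfolding p_def using Sym_power[OF Var_in_Sym, of i 5] by simp
    then have "insert p B \<subseteq> pvs.span T" using B(1) A_Sym T by auto
    ultimately have "finite (insert p B)" "card (insert p B) \<le> 56"
      using pvs.independent_span_bound[of T "insert p B"] T by auto
    moreover have "p \<notin> B" using p pvs.span_base by blast
    ultimately show "mu_rank \<phi> \<le> 55" using B(4) rank by (simp add: card_insert_if)
  qed
qed

section \<open>Directional derivatives\<close>

definition ddiff :: "'a::field^'n \<Rightarrow> ('n::finite, 'a) mpol \<Rightarrow> ('n, 'a) mpol"
  where "ddiff z p = (\<Sum>i\<in>UNIV. pscale (z $ i) (pdiff i p))"

lemma ddiff_commute: "ddiff z (ddiff w p) = ddiff w (ddiff z p)"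
proof -
  have *: "ddiff z (ddiff w p) = (\<Sum>i\<in>UNIV. \<Sum>j\<in>UNIV. pscale (z $ i * w $ j) (pdiff i (pdiff j p)))" for z w
    by (simp add: ddiff_def pdiff_sum pdiff_pscale pvs.scale_sum_right)
  show ?thesis
    unfolding * by (subst sum.swap) (simp add: pdiff_commute mult.commute)
qed

lemma ddiff_Const: "ddiff z (Const c) = 0"
  by (simp add: ddiff_def pdiff_Const)

lemma ddiff_0: "ddiff z 0 = 0"
  by (simp add: ddiff_def)

lemma ddiff_add_left: "ddiff (z + w) p = ddiff z p + ddiff w p"
  by (simp add: ddiff_def pvs.scale_left_distrib sum.distrib)

lemma ddiff_scale_left: "ddiff (c *s z) p = pscale c (ddiff z p)"
  by (simp add: ddiff_def pvs.scale_sum_right)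

lemma ddiff_add_right: "ddiff z (p + q) = ddiff z p + ddiff z q"
  by (simp add: ddiff_def pdiff_add pvs.scale_right_distrib sum.distrib)

lemma ddiff_pscale: "ddiff z (pscale c p) = pscale c (ddiff z p)"
  by (simp add: ddiff_def pdiff_pscale pvs.scale_sum_right mult.commute)

lemma peval_ddiff: "peval (ddiff z p) x = (\<Sum>i\<in>UNIV. z $ i * peval (pdiff i p) x)"
  by (simp add: ddiff_def peval.hom_sum peval_pscale)

lemma peval_ddiff_ddiff:
  "peval (ddiff z (ddiff w p)) x = (\<Sum>i\<in>UNIV. \<Sum>j\<in>UNIV. z $ i * w $ j * hess_at p x $ i $ j)"
  by (simp add: ddiff_def pdiff_sum pdiff_pscale peval.hom_sum peval_pscale hess_at_def hess_def
      sum_distrib_left mult.assoc)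

lemma peval_ddiff_line:
  fixes p :: "('n::finite, complex) mpol"
  shows "((\<lambda>t. peval p (x + t *s u)) has_field_derivative peval (ddiff u p) (x + t *s u)) (at t)"
  using peval_line_deriv[of p x u t] by (simp add: peval_ddiff)

lemma peval_const_along:
  fixes p :: "('n::finite, complex) mpol"
  assumes "ddiff u p = 0"
  shows "peval p (x + t *s u) = peval p x"
proof -
  have "((\<lambda>t. peval p (x + t *s u)) has_field_derivative 0) (at t)" for t
    using peval_ddiff_line[of p x u t] by (simp add: assms peval.hom_zero)
  then have "\<exists>c. \<forall>t\<in>UNIV. peval p (x + t *s u) = c"
    by (intro has_field_derivative_zero_constant) auto
  then have "peval p (x + t *s u) = peval p (x + 0 *s u)" by (metis UNIV_I)
  then show ?thesis by simp
qed

lemma peval_affine_along: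
  fixes p :: "('n::finite, complex) mpol"
  assumes "ddiff u (ddiff u p) = 0"
  shows "peval p (x + t *s u) = peval p x + t * peval (ddiff u p) x"
proof -
  have "((\<lambda>t. peval p (x + t *s u) - t * peval (ddiff u p) x) has_field_derivative 0) (at t)" for t
  proof -
    have "((\<lambda>t. peval p (x + t *s u) - t * peval (ddiff u p) x) has_field_derivative
        peval (ddiff u p) (x + t *s u) - peval (ddiff u p) x) (at t)"
      by (auto intro!: derivative_eq_intros peval_ddiff_line)
    then show ?thesis by (simp add: peval_const_along[OF assms])
  qed
  then have "\<exists>c. \<forall>t\<in>UNIV. peval p (x + t *s u) - t * peval (ddiff u p) x = c"
    by (intro has_field_derivative_zero_constant) auto
  then have "peval p (x + t *s u) - t * peval (ddiff u p) x
      = peval p (x + 0 *s u) - 0 * peval (ddiff u p) x" by (metis UNIV_I)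
  then show ?thesis by (simp add: algebra_simps)
qed

lemma peval_biaffine:
  fixes p :: "('n::finite, complex) mpol"
  assumes "ddiff z (ddiff z p) = 0" "ddiff w (ddiff w p) = 0"
  shows "peval p (x + s *s z + t *s w) = peval p x + s * peval (ddiff z p) x + t * peval (ddiff w p) x
    + s * t * peval (ddiff z (ddiff w p)) x"
proof -
  have "ddiff z (ddiff z (ddiff w p)) = ddiff w (ddiff z (ddiff z p))"
    by (simp only: ddiff_commute[of z w])
  then have "ddiff z (ddiff z (ddiff w p)) = 0" by (simp add: assms ddiff_0)
  then show ?thesis
    unfolding peval_affine_along[OF assms(2)] peval_affine_along[OF assms(1)]
    by (simp only: peval_affine_along[of z "ddiff w p"]) (simp only: algebra_simps)
qed

lemma peval_const_imp:
  fixes p :: "('n::finite, 'a::{idom,ring_char_0}) mpol"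
  assumes "\<And>x. peval p x = c"
  shows "p = Const c"
  using peval_eq_0_imp[of "p - Const c"] assms by (simp add: peval.hom_diff peval_Const)

definition line_poly :: "complex^'n \<Rightarrow> complex^'n \<Rightarrow> ('n::finite, complex) mpol \<Rightarrow> complex poly"
  where "line_poly x u p = (\<Sum>m\<in>keys p. smult (lookup p m) (\<Prod>i\<in>UNIV. [:x $ i, u $ i:] ^ lookup m i))"

lemma poly_line_poly: "poly (line_poly x u p) t = peval p (x + t *s u)"
  by (simp add: line_poly_def peval_def poly_sum poly_prod)

lemma pderiv_line_poly: "pderiv (line_poly x u p) = line_poly x u (ddiff u p)"
proof -
  have "poly (pderiv (line_poly x u p)) t = poly (line_poly x u (ddiff u p)) t" for t
  proof (rule DERIV_unique)
    show "(poly (line_poly x u p) has_field_derivative poly (pderiv (line_poly x u p)) t) (at t)"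
      by (rule poly_DERIV)
    have "(\<lambda>t. peval p (x + t *s u)) = poly (line_poly x u p)"
      by (rule ext) (simp only: poly_line_poly)
    then show "(poly (line_poly x u p) has_field_derivative poly (line_poly x u (ddiff u p)) t) (at t)"
      using peval_ddiff_line[of p x u t] by (simp add: poly_line_poly)
  qed
  then show ?thesis by (simp add: poly_eq_poly_eq_iff[symmetric] fun_eq_iff)
qed

section \<open>A symmetric four by four determinant\<close>

lemma det_4:
  fixes A :: "'a::comm_ring_1^4^4"
  shows "det A = A$1$1 * (A$2$2 * (A$3$3 * A$4$4 - A$3$4 * A$4$3) - A$2$3 * (A$3$2 * A$4$4 - A$3$4 * A$4$2)
        + A$2$4 * (A$3$2 * A$4$3 - A$3$3 * A$4$2))
    - A$1$2 * (A$2$1 * (A$3$3 * A$4$4 - A$3$4 * A$4$3) - A$2$3 * (A$3$1 * A$4$4 - A$3$4 * A$4$1)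
        + A$2$4 * (A$3$1 * A$4$3 - A$3$3 * A$4$1))
    + A$1$3 * (A$2$1 * (A$3$2 * A$4$4 - A$3$4 * A$4$2) - A$2$2 * (A$3$1 * A$4$4 - A$3$4 * A$4$1)
        + A$2$4 * (A$3$1 * A$4$2 - A$3$2 * A$4$1))
    - A$1$4 * (A$2$1 * (A$3$2 * A$4$3 - A$3$3 * A$4$2) - A$2$2 * (A$3$1 * A$4$3 - A$3$3 * A$4$1)
        + A$2$3 * (A$3$1 * A$4$2 - A$3$2 * A$4$1))"
proof -
  have f1: "finite {2::4, 3, 4}" "1 \<notin> {2::4, 3, 4}" by auto
  have f2: "finite {3::4, 4}" "2 \<notin> {3::4, 4}" by auto
  have f3: "finite {4::4}" "3 \<notin> {4::4}" by auto
  show ?thesis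
    unfolding det_def UNIV_4
    unfolding sum_over_permutations_insert[OF f1]
    unfolding sum_over_permutations_insert[OF f2]
    unfolding sum_over_permutations_insert[OF f3]
    unfolding permutes_sing
    by (simp add: sign_swap_id permutation_swap_id sign_compose sign_id swap_id_eq
        permutation_compose algebra_simps)
qed

text \<open>The determinant of the symmetric matrix with diagonal blocks \<open>((k1, al), (al, k2))\<close> and
  \<open>((x, y), (y, z))\<close> and upper right block \<open>((a, b), (d, e))\<close>, grouped by degree in the upper right block.\<close>

definition symdet :: "'a::comm_ring_1 \<Rightarrow> 'a \<Rightarrow> 'a \<Rightarrow> 'a \<Rightarrow> 'a \<Rightarrow> 'a \<Rightarrow> 'a \<Rightarrow> 'a \<Rightarrow> 'a \<Rightarrow> 'a \<Rightarrow> 'a"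
  where "symdet k1 k2 al a b d e x y z = (k1 * k2 - al * al) * (x * z - y * y)
    - ((k2 * a * a + k1 * d * d - 2 * al * a * d) * z + (k2 * b * b + k1 * e * e - 2 * al * b * e) * x
      - 2 * (k2 * a * b + k1 * d * e - al * (a * e + b * d)) * y) + (a * e - b * d) * (a * e - b * d)"

lemma det_4_symmetric:
  fixes A :: "'a::comm_ring_1^4^4"
  assumes "\<And>i j. A $ i $ j = A $ j $ i"
  shows "det A = symdet (A$1$1) (A$2$2) (A$1$2) (A$1$3) (A$1$4) (A$2$3) (A$2$4) (A$3$3) (A$3$4) (A$4$4)"
  unfolding det_4 symdet_def assms[of 2 1] assms[of 3 1] assms[of 4 1] assms[of 3 2] assms[of 4 2] assms[of 4 3]
  by (simp add: algebra_simps)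

text \<open>The right-hand side is the determinant of the Schur complement of the first diagonal block, cleared
  of denominators.\<close>

lemma symdet_schur:
  "(k1 * k2 - al * al) * symdet k1 k2 al a b d e x y z =
    ((k1 * k2 - al * al) * x - (k2 * a * a + k1 * d * d - 2 * al * a * d))
      * ((k1 * k2 - al * al) * z - (k2 * b * b + k1 * e * e - 2 * al * b * e))
    - ((k1 * k2 - al * al) * y - (k2 * a * b + k1 * d * e - al * (a * e + b * d)))
      * ((k1 * k2 - al * al) * y - (k2 * a * b + k1 * d * e - al * (a * e + b * d)))"
  unfolding symdet_def by (simp add: algebra_simps)

text \<open>With \<open>k1 = k2 = 0\<close> the entries of the cleared Schur complement are divisible by \<open>al\<close>.\<close>

lemma symdet_schur_isotropic:
  "symdet 0 0 al a b d e x y z =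
    - ((2 * a * d - al * x) * (2 * b * e - al * z) - (a * e + b * d - al * y) * (a * e + b * d - al * y))"
  unfolding symdet_def by (simp add: algebra_simps)

section \<open>Binary quadratic matrices with constant determinant\<close>

lemma quartic_zero:
  fixes a0 :: complex
  assumes "\<And>s. a0 + a1 * s + a2 * s^2 + a3 * s^3 + a4 * s^4 = 0"
  shows "a0 = 0" "a1 = 0" "a2 = 0" "a3 = 0" "a4 = 0"
proof -
  have "poly [:a0, a1, a2, a3, a4:] s = 0" for s
    using assms[of s] by (simp add: algebra_simps power2_eq_square power3_eq_cube power4_eq_xxxx)
  then have "[:a0, a1, a2, a3, a4:] = 0" using poly_all_0_iff_0 by blast
  then show "a0 = 0" "a1 = 0" "a2 = 0" "a3 = 0" "a4 = 0" by auto
qed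

text \<open>The polarization of the determinant of the symmetric matrix \<open>((u, m), (m, v))\<close>.\<close>

abbreviation mixdet :: "'a::comm_ring_1 \<Rightarrow> 'a \<Rightarrow> 'a \<Rightarrow> 'a \<Rightarrow> 'a \<Rightarrow> 'a \<Rightarrow> 'a"
  where "mixdet u m v u' m' v' \<equiv> u * v' + v * u' - 2 * m * m'"

lemma const_det_quadratic:
  fixes c :: complex
  assumes "\<And>s. (Au * s^2 + Bu * s + Cu) * (Av * s^2 + Bv * s + Cv)
    - (Am * s^2 + Bm * s + Cm) * (Am * s^2 + Bm * s + Cm) = c"
  shows "Au * Av - Am * Am = 0" "mixdet Au Am Av Bu Bm Bv = 0"
    "mixdet Au Am Av Cu Cm Cv + (Bu * Bv - Bm * Bm) = 0" "mixdet Bu Bm Bv Cu Cm Cv = 0"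
    "Cu * Cv - Cm * Cm = c"
proof -
  have "(Cu * Cv - Cm * Cm - c) + mixdet Bu Bm Bv Cu Cm Cv * s
    + (mixdet Au Am Av Cu Cm Cv + (Bu * Bv - Bm * Bm)) * s^2 + mixdet Au Am Av Bu Bm Bv * s^3
    + (Au * Av - Am * Am) * s^4 = 0" for s
    using assms[of s] by (simp add: algebra_simps power2_eq_square power3_eq_cube power4_eq_xxxx)
  note * = quartic_zero[OF this]
  show "Au * Av - Am * Am = 0" "mixdet Au Am Av Bu Bm Bv = 0"
    "mixdet Au Am Av Cu Cm Cv + (Bu * Bv - Bm * Bm) = 0" "mixdet Bu Bm Bv Cu Cm Cv = 0"
    "Cu * Cv - Cm * Cm = c"
    using * by auto
qed

text \<open>Here \<open>\<theta>\<close> is the value of the form \<open>Z\<close> at the vector \<open>(- q, p)\<close> orthogonal to \<open>w = (p, q)\<close>. The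
  coefficients of degree 3 and 4 in \<open>s\<close>, \<open>t\<close> say that \<open>N\<close>, \<open>S\<close> and \<open>R\<close> vanish at this vector and that
  \<open>N\<close> is degenerate; for \<open>w \<noteq> 0\<close> this makes \<open>N\<close> a multiple of \<open>w w\<^sup>T\<close>. The quadratic coefficients
  become \<open>p * p * k1 * \<theta> = - eS * eS\<close>, \<open>p * p * k2 * \<theta> = - eR * eR\<close> and \<open>Nu * \<theta> = 2 * eS * eR\<close>
  with two numbers \<open>eS\<close> and \<open>eR\<close>, whose elimination gives the first equation. The second one comes from
  the constant coefficient \<open>det Z = c\<close>.\<close>

lemma const_det_biquadratic:
  fixes c k1 k2 p q :: complex
  assumes k: "k1 \<noteq> 0" "k2 \<noteq> 0"
    and T: "\<And>s t.
      (- (k1 * s^2 + k2 * t^2) * (p * p) + s * t * Nu + s * Su + t * Ru + Zu)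
        * (- (k1 * s^2 + k2 * t^2) * (q * q) + s * t * Nv + s * Sv + t * Rv + Zv)
      - (- (k1 * s^2 + k2 * t^2) * (p * q) + s * t * Nm + s * Sm + t * Rm + Zm)
        * (- (k1 * s^2 + k2 * t^2) * (p * q) + s * t * Nm + s * Sm + t * Rm + Zm) = c"
  defines "\<theta> \<equiv> p * p * Zv + q * q * Zu - 2 * p * q * Zm"
  shows "\<theta> * \<theta> * (Nu * Nu - 4 * k1 * k2 * (p * p * p * p)) = 0"
    "p * p * c + (p * Zm - q * Zu) * (p * Zm - q * Zu) = Zu * \<theta>"
proof -
  let ?W = "\<lambda>u m v. p * p * v + q * q * u - 2 * (p * q) * m"
  have q: "(- k1 * (p * p) * s^2 + (t * Nu + Su) * s + (- k2 * (p * p) * t^2 + Ru * t + Zu))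
        * (- k1 * (q * q) * s^2 + (t * Nv + Sv) * s + (- k2 * (q * q) * t^2 + Rv * t + Zv))
      - (- k1 * (p * q) * s^2 + (t * Nm + Sm) * s + (- k2 * (p * q) * t^2 + Rm * t + Zm))
        * (- k1 * (p * q) * s^2 + (t * Nm + Sm) * s + (- k2 * (p * q) * t^2 + Rm * t + Zm)) = c" for s t
  proof -
    have "- k1 * W * s^2 + (t * N + S) * s + (- k2 * W * t^2 + R * t + Z)
        = - (k1 * s^2 + k2 * t^2) * W + s * t * N + s * S + t * R + Z" for W N S R Z
      by (simp add: algebra_simps)
    then show ?thesis by (simp only: T)
  qed
  note cs = const_det_quadratic[OF q]
  note ct = const_det_quadratic[OF cs(5)]
  have WN: "?W Nu Nm Nv = 0" and WS: "?W Su Sm Sv = 0"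
  proof -
    have "k1 * (t * ?W Nu Nm Nv + ?W Su Sm Sv) = 0" for t
      using cs(2)[of t] by (simp add: algebra_simps)
    then have *: "t * ?W Nu Nm Nv + ?W Su Sm Sv = 0" for t using k by simp
    show "?W Su Sm Sv = 0" using *[of 0] by simp
    with *[of 1] show "?W Nu Nm Nv = 0" by simp
  qed
  have WR: "?W Ru Rm Rv = 0"
  proof -
    have "k2 * ?W Ru Rm Rv = 0" using ct(2) by (simp add: algebra_simps)
    with k show ?thesis by simp
  qed
  have R: "Ru * Rv - Rm * Rm = k2 * \<theta>"
    using ct(3) by (simp add: \<theta>_def algebra_simps)
  have detZ: "Zu * Zv - Zm * Zm = c" by (rule ct(5))
  have s2: "(Su * Sv - Sm * Sm - k1 * \<theta>) + (mixdet Nu Nm Nv Su Sm Sv - k1 * ?W Ru Rm Rv) * t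
      + (Nu * Nv - Nm * Nm) * t^2 + 0 * t^3 + 0 * t^4 = 0" for t
    using cs(3)[of t] by (simp add: \<theta>_def algebra_simps power2_eq_square)
  have S: "Su * Sv - Sm * Sm = k1 * \<theta>" and N: "Nu * Nv - Nm * Nm = 0"
    using quartic_zero[OF s2] by simp_all
  have s1: "mixdet Su Sm Sv Zu Zm Zv + (mixdet Nu Nm Nv Zu Zm Zv + mixdet Su Sm Sv Ru Rm Rv) * t
      + (mixdet Nu Nm Nv Ru Rm Rv - k2 * ?W Su Sm Sv) * t^2 + (- k2 * ?W Nu Nm Nv) * t^3 + 0 * t^4 = 0" for t
    using cs(4)[of t] by (simp add: algebra_simps power2_eq_square power3_eq_cube)
  have st: "mixdet Nu Nm Nv Zu Zm Zv + mixdet Su Sm Sv Ru Rm Rv = 0"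
    using quartic_zero(2)[OF s1] .
  define eS where "eS = p * Sm - q * Su"
  define eR where "eR = p * Rm - q * Ru"
  define eN where "eN = p * Nm - q * Nu"
  have e: "p * p * (u * v - m * m) = u * ?W u m v - (p * m - q * u) * (p * m - q * u)" for u m v
    by (simp add: algebra_simps)
  have "eN * eN = 0" using e[of Nu Nv Nm] WN N by (simp add: eN_def)
  then have eN: "p * Nm = q * Nu" by (simp add: eN_def)
  have pS: "p * p * (k1 * \<theta>) = - (eS * eS)" using e[of Su Sv Sm] WS S by (simp add: eS_def)
  have pR: "p * p * (k2 * \<theta>) = - (eR * eR)" using e[of Ru Rv Rm] WR R by (simp add: eR_def)
  have NZ: "p * p * mixdet Nu Nm Nv Zu Zm Zv = Nu * \<theta>"
  proof -
    have "p * p * Nv = 2 * q * (p * Nm) - q * q * Nu" using WN by (simp add: algebra_simps)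
    then have v: "p * p * Nv = q * q * Nu" by (simp add: eN)
    have "p * p * mixdet Nu Nm Nv Zu Zm Zv = p * p * Nu * Zv + (p * p * Nv) * Zu - 2 * p * (p * Nm) * Zm"
      by (simp add: algebra_simps)
    also have "\<dots> = Nu * \<theta>" unfolding v eN \<theta>_def by (simp add: algebra_simps)
    finally show ?thesis .
  qed
  have SR: "p * p * mixdet Su Sm Sv Ru Rm Rv = - (2 * eS * eR)"
  proof -
    have Sv: "p * p * Sv = 2 * p * q * Sm - q * q * Su" using WS by (simp add: algebra_simps)
    have Rv: "p * p * Rv = 2 * p * q * Rm - q * q * Ru" using WR by (simp add: algebra_simps)
    have "p * p * mixdet Su Sm Sv Ru Rm Rv = Su * (p * p * Rv) + (p * p * Sv) * Ru - 2 * p * p * Sm * Rm"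
      by (simp add: algebra_simps)
    also have "\<dots> = - (2 * eS * eR)" unfolding Sv Rv eS_def eR_def by (simp add: algebra_simps)
    finally show ?thesis .
  qed
  have N\<theta>: "Nu * \<theta> = 2 * eS * eR"
  proof -
    have "p * p * (mixdet Nu Nm Nv Zu Zm Zv + mixdet Su Sm Sv Ru Rm Rv) = 0" by (simp only: st mult_zero_right)
    then have "p * p * mixdet Nu Nm Nv Zu Zm Zv + p * p * mixdet Su Sm Sv Ru Rm Rv = 0"
      by (simp only: distrib_left)
    then show ?thesis unfolding NZ SR by simp
  qed
  have "(Nu * \<theta>) * (Nu * \<theta>) = 4 * (- (eS * eS)) * (- (eR * eR))" unfolding N\<theta> by simp
  also have "\<dots> = 4 * (p * p * (k1 * \<theta>)) * (p * p * (k2 * \<theta>))" by (simp only: pS pR)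
  finally show "\<theta> * \<theta> * (Nu * Nu - 4 * k1 * k2 * (p * p * p * p)) = 0"
    by (simp add: algebra_simps)
  show "p * p * c + (p * Zm - q * Zu) * (p * Zm - q * Zu) = Zu * \<theta>"
    unfolding detZ[symmetric] \<theta>_def by (simp add: algebra_simps)
qed

section \<open>The Hessian determinant along a transversal line\<close>

lemma lead_coeff_pderiv:
  fixes p :: "complex poly"
  shows "lead_coeff (pderiv p) = of_nat (Polynomial.degree p) * lead_coeff p"
  by (cases "Polynomial.degree p") (simp_all add: degree_pderiv coeff_pderiv coeff_eq_0)

text \<open>For degree \<open>d\<close> the leading coefficients would give \<open>d * (d - 1) = 2 * d * d\<close>.\<close>

lemma poly_mult_second_derivative:
  fixes B :: "complex poly"
  assumes "B * pderiv (pderiv B) = smult 2 (pderiv B * pderiv B)"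
  shows "pderiv B = 0"
proof (rule ccontr)
  assume "pderiv B \<noteq> 0"
  define d where "d = Polynomial.degree B"
  define l where "l = lead_coeff B"
  have d: "d \<noteq> 0" using \<open>pderiv B \<noteq> 0\<close> by (simp add: d_def pderiv_eq_0_iff)
  then have l: "l \<noteq> 0" by (auto simp: d_def l_def)
  have "lead_coeff (B * pderiv (pderiv B)) = l * (of_nat (d - 1) * (of_nat d * l))"
    by (simp only: lead_coeff_mult lead_coeff_pderiv) (simp only: degree_pderiv d_def l_def)
  moreover have "lead_coeff (smult 2 (pderiv B * pderiv B)) = 2 * (of_nat d * l * (of_nat d * l))"
    by (simp only: lead_coeff_smult lead_coeff_mult lead_coeff_pderiv d_def l_def)
  ultimately have "l * (of_nat (d - 1) * (of_nat d * l)) = 2 * (of_nat d * l * (of_nat d * l))"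
    by (simp only: assms)
  then have "(l * l * of_nat d) * of_nat (d - 1) = (l * l * of_nat d) * (2 * of_nat d)"
    by (simp only: mult_ac)
  then have "(of_nat (d - 1) :: complex) = 2 * of_nat d"
    using d l by (auto simp only: mult_cancel_left mult_eq_0_iff of_nat_eq_0_iff)
  then have "d - 1 = 2 * d" by (metis of_nat_eq_iff of_nat_mult of_nat_numeral)
  with d show False by simp
qed

text \<open>The factors \<open>A - g\<close> and \<open>A + g\<close> are units, and so \<open>A\<close> is constant.\<close>

lemma difference_of_squares_const:
  fixes A g :: "complex poly"
  assumes "A * A - g * g = [:c:]" "c \<noteq> 0"
  shows "pderiv A = 0"
proof -
  have eq: "(A - g) * (A + g) = [:c:]" using assms(1) by (simp add: algebra_simps)
  then have nz: "A - g \<noteq> 0" "A + g \<noteq> 0" using assms(2) by auto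
  have "Polynomial.degree (A - g) + Polynomial.degree (A + g) = 0"
    using degree_mult_eq[OF nz] by (simp add: eq)
  then have "pderiv (A - g) = 0" "pderiv (A + g) = 0" by (simp_all add: pderiv_eq_0_iff)
  then have "2 * pderiv A = 0" by (simp only: mult_2 pderiv_diff pderiv_add) (simp add: add_eq_0_iff)
  then show ?thesis by (metis mult_eq_0_iff zero_neq_numeral)
qed

lemma polys_eqI: "(\<And>x. poly p x = poly q x) \<Longrightarrow> p = (q :: complex poly)"
  by (simp add: poly_eq_poly_eq_iff[symmetric] fun_eq_iff)

text \<open>The functions in the hypothesis are the entries of the Hessian matrix along the line with parameter
  \<open>r\<close> and the plane with coordinates \<open>s\<close>, \<open>t\<close>, and \<open>A\<close> is the mixed derivative. Multiplying by
  \<open>\<delta> = k1 * k2 - A\<^sup>2\<close> makes the Schur complement polynomial, and its determinant \<open>\<delta> * c\<close> does not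
  involve \<open>s\<close> and \<open>t\<close>. Let \<open>\<kappa>\<^sup>2 = k1 * k2\<close>. If \<open>\<theta> \<noteq> 0\<close>, then \<open>Nu = \<plusminus> 2 * \<kappa> * p\<^sup>2\<close>, which is
  the differential equation \<open>B * B'' = 2 * B'\<^sup>2\<close> for \<open>B = A \<plusminus> \<kappa>\<close> and has only constant polynomial
  solutions. If \<open>\<theta> = 0\<close>, then \<open>- c * \<delta> * p\<^sup>2\<close> is a square, and so \<open>A\<^sup>2 - \<kappa>\<^sup>2\<close> is the square of a
  polynomial, which again leaves only constant \<open>A\<close>.\<close>

lemma pivot_line_nonisotropic:
  fixes A q :: "complex poly" and k1 k2 c :: complex
  assumes k: "k1 \<noteq> 0" "k2 \<noteq> 0" and c: "c \<noteq> 0"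
    and p: "p = pderiv A" and Huu: "Huu = pderiv p"
    and det: "\<And>s t r. symdet k1 k2 (poly A r)
      (poly w1u r + t * poly p r) (poly w1v r + t * poly q r)
      (poly w2u r + s * poly p r) (poly w2v r + s * poly q r)
      (poly H0uu r + s * poly H1uu r + t * poly H2uu r + s * t * poly Huu r)
      (poly H0uv r + s * poly H1uv r + t * poly H2uv r + s * t * poly Huv r)
      (poly H0vv r + s * poly H1vv r + t * poly H2vv r + s * t * poly Hvv r) = c"
  shows "pderiv A = 0"
proof (rule ccontr)
  assume "pderiv A \<noteq> 0"
  define \<delta> where "\<delta> = [:k1 * k2:] - A * A"
  define Z where "Z x1 y1 x2 y2 h = \<delta> * h - smult k2 (x1 * y1) - smult k1 (x2 * y2) + A * (x1 * y2 + y1 * x2)"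
    for x1 y1 x2 y2 h
  define Zu where "Zu = Z w1u w1u w2u w2u H0uu"
  define Zm where "Zm = Z w1u w1v w2u w2v H0uv"
  define Zv where "Zv = Z w1v w1v w2v w2v H0vv"
  define \<theta> where "\<theta> = p * p * Zv + q * q * Zu - smult 2 (p * q * Zm)"
  define Nu where "Nu = \<delta> * Huu + smult 2 (A * (p * p))"
  have \<theta>_eq: "poly \<theta> r = poly p r * poly p r * poly Zv r + poly q r * poly q r * poly Zu r
      - 2 * poly p r * poly q r * poly Zm r" for r
    by (simp add: \<theta>_def)
  have key: "poly \<theta> r * poly \<theta> r * (poly Nu r * poly Nu r
        - 4 * k1 * k2 * (poly p r * poly p r * poly p r * poly p r)) = 0 \<and>
      poly p r * poly p r * (poly \<delta> r * c) + (poly p r * poly Zm r - poly q r * poly Zu r)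
        * (poly p r * poly Zm r - poly q r * poly Zu r) = poly Zu r * poly \<theta> r" for r
  proof -
    define a where "a = poly A r"
    define d where "d = poly \<delta> r"
    have d: "d = k1 * k2 - a * a" by (simp add: d_def \<delta>_def a_def)
    \<comment> \<open>an entry of the cleared Schur complement, sorted by powers of \<open>s\<close> and \<open>t\<close>\<close>
    define T where "T x1 y1 x2 y2 b e h0 h1 h2 h s t =
      - (k1 * s^2 + k2 * t^2) * (b * e) + s * t * (d * h + 2 * a * (b * e))
      + s * (d * h1 - k1 * (b * y2 + e * x2) + a * (b * y1 + e * x1))
      + t * (d * h2 - k2 * (b * y1 + e * x1) + a * (b * y2 + e * x2))
      + (d * h0 - k2 * (x1 * y1) - k1 * (x2 * y2) + a * (x1 * y2 + y1 * x2))"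
      for x1 y1 x2 y2 b e h0 h1 h2 h s t :: complex
    have T_schur: "d * (h0 + s * h1 + t * h2 + s * t * h) - (k2 * (x1 + t * b) * (y1 + t * e)
        + k1 * (x2 + s * b) * (y2 + s * e) - a * ((x1 + t * b) * (y2 + s * e) + (y1 + t * e) * (x2 + s * b)))
      = T x1 y1 x2 y2 b e h0 h1 h2 h s t" for x1 y1 x2 y2 b e h0 h1 h2 h s t
      by (simp add: T_def algebra_simps power2_eq_square)
    have Td: "d * (h0 + s * h1 + t * h2 + s * t * h) - (k2 * (x1 + t * b) * (x1 + t * b)
        + k1 * (x2 + s * b) * (x2 + s * b) - 2 * a * (x1 + t * b) * (x2 + s * b))
      = T x1 x1 x2 x2 b b h0 h1 h2 h s t" for x1 x2 b h0 h1 h2 h s t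
      by (simp add: T_def algebra_simps power2_eq_square)
    have T: "T (poly w1u r) (poly w1u r) (poly w2u r) (poly w2u r) (poly p r) (poly p r)
          (poly H0uu r) (poly H1uu r) (poly H2uu r) (poly Huu r) s t
        * T (poly w1v r) (poly w1v r) (poly w2v r) (poly w2v r) (poly q r) (poly q r)
          (poly H0vv r) (poly H1vv r) (poly H2vv r) (poly Hvv r) s t
        - T (poly w1u r) (poly w1v r) (poly w2u r) (poly w2v r) (poly p r) (poly q r)
          (poly H0uv r) (poly H1uv r) (poly H2uv r) (poly Huv r) s t
        * T (poly w1u r) (poly w1v r) (poly w2u r) (poly w2v r) (poly p r) (poly q r)
          (poly H0uv r) (poly H1uv r) (poly H2uv r) (poly Huv r) s t = d * c" for s t
      unfolding Td[symmetric]
      unfolding T_schur[symmetric]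
      using symdet_schur[of k1 k2 "poly A r"
        "poly w1u r + t * poly p r" "poly w1v r + t * poly q r" "poly w2u r + s * poly p r" "poly w2v r + s * poly q r"
        "poly H0uu r + s * poly H1uu r + t * poly H2uu r + s * t * poly Huu r"
        "poly H0uv r + s * poly H1uv r + t * poly H2uv r + s * t * poly Huv r"
        "poly H0vv r + s * poly H1vv r + t * poly H2vv r + s * t * poly Hvv r"]
      unfolding d a_def det by (rule sym)
    have Z_eq: "poly (Z x1 y1 x2 y2 h) r = d * poly h r - k2 * (poly x1 r * poly y1 r)
        - k1 * (poly x2 r * poly y2 r) + a * (poly x1 r * poly y2 r + poly y1 r * poly x2 r)"
      for x1 y1 x2 y2 h
      by (simp add: Z_def d_def a_def)
    have N_eq: "poly Nu r = d * poly Huu r + 2 * a * (poly p r * poly p r)"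
      by (simp add: Nu_def d_def a_def)
    note * = const_det_biquadratic[OF k T[unfolded T_def]]
    show ?thesis
      using * unfolding \<theta>_eq N_eq Zu_def Zm_def Zv_def Z_eq d_def[symmetric] by blast
  qed
  have key1: "\<theta> * \<theta> * (Nu * Nu - smult (4 * k1 * k2) (p * p * p * p)) = 0"
    by (rule polys_eqI) (use key in simp)
  have key2: "p * p * smult c \<delta> + (p * Zm - q * Zu) * (p * Zm - q * Zu) = Zu * \<theta>"
  proof (rule polys_eqI)
    show "poly (p * p * smult c \<delta> + (p * Zm - q * Zu) * (p * Zm - q * Zu)) r = poly (Zu * \<theta>) r" for r
      using conjunct2[OF key[of r]] by (simp add: algebra_simps)
  qed
  define \<kappa> where "\<kappa> = csqrt (k1 * k2)"
  have \<kappa>: "\<kappa> * \<kappa> = k1 * k2" "\<kappa> \<noteq> 0"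
    using power2_csqrt[of "k1 * k2"] k by (auto simp: \<kappa>_def power2_eq_square)
  show False
  proof (cases "\<theta> = 0")
    case False
    have "(Nu - smult (2 * \<kappa>) (p * p)) * (Nu + smult (2 * \<kappa>) (p * p))
        = Nu * Nu - smult (4 * (\<kappa> * \<kappa>)) (p * p * p * p)"
      by (simp add: algebra_simps)
    also have "\<dots> = 0" using key1 False by (simp add: \<kappa> mult.assoc)
    finally have "Nu = smult (2 * \<kappa>) (p * p) \<or> Nu = - smult (2 * \<kappa>) (p * p)"
      by (auto simp: eq_neg_iff_add_eq_0)
    then obtain \<epsilon> where \<epsilon>: "\<epsilon> * \<epsilon> = \<kappa> * \<kappa>" "Nu = smult (2 * \<epsilon>) (p * p)"
      by (metis minus_mult_minus mult_minus_right smult_minus_left)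
    define B where "B = A + [:\<epsilon>:]"
    have pB: "pderiv B = p" by (simp add: B_def p pderiv_add pderiv_pCons)
    have \<delta>B: "\<delta> = - ((A - [:\<epsilon>:]) * B)"
      using \<epsilon>(1) \<kappa>(1) by (simp add: \<delta>_def B_def algebra_simps)
    have "(A - [:\<epsilon>:]) * (B * Huu - smult 2 (p * p)) = - (Nu - smult (2 * \<epsilon>) (p * p))"
      unfolding Nu_def \<delta>B B_def by (simp add: algebra_simps smult_diff_right smult_add_right)
    also have "\<dots> = 0" using \<epsilon>(2) by simp
    finally have "A - [:\<epsilon>:] = 0 \<or> B * Huu = smult 2 (p * p)" by auto
    moreover have "A - [:\<epsilon>:] \<noteq> 0"
      using \<open>pderiv A \<noteq> 0\<close> by (auto simp: pderiv_pCons)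
    ultimately have "B * pderiv (pderiv B) = smult 2 (pderiv B * pderiv B)"
      by (simp add: pB Huu)
    from poly_mult_second_derivative[OF this] show False
      using \<open>pderiv A \<noteq> 0\<close> pB p by simp
  next
    case True
    define e where "e = p * Zm - q * Zu"
    have e: "e * e = p * p * smult (- c) \<delta>"
      using key2 True by (simp add: e_def eq_neg_iff_add_eq_0 add.commute)
    then have "p ^ 2 dvd e ^ 2" unfolding power2_eq_square by (metis dvd_triv_left)
    then have "p dvd e" by (simp add: pow_divides_pow_iff)
    then obtain f where f: "e = p * f" by (elim dvdE)
    have "p * p * (f * f) = p * p * smult (- c) \<delta>" using e by (simp add: f ac_simps)
    moreover have "p * p \<noteq> 0" using \<open>pderiv A \<noteq> 0\<close> p by simp
    ultimately have ff: "f * f = smult (- c) \<delta>" using mult_left_cancel by blast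
    define g where "g = smult (1 / csqrt c) f"
    have "csqrt c * csqrt c = c" using power2_csqrt[of c] by (simp add: power2_eq_square)
    then have "g * g = smult (1 / c) (f * f)" by (simp add: g_def)
    also have "\<dots> = - \<delta>" using c unfolding ff smult_smult by simp
    also have "\<dots> = A * A - [:k1 * k2:]" by (simp add: \<delta>_def)
    finally have "A * A - g * g = [:k1 * k2:]" by simp
    from difference_of_squares_const[OF this] k \<open>pderiv A \<noteq> 0\<close> show False by simp
  qed
qed

text \<open>After division by \<open>X ^ (2 * n)\<close>, the value of the determinant at \<open>r\<close> is minus the square of
  \<open>P * wv - Q * wu\<close>.\<close>

lemma isotropic_kernel:
  fixes P Q A wu wv h1 h2 h3 :: "complex poly"
  assumes zero: "(smult 2 (X ^ n * P * wu) - X ^ Suc n * A * h1) * (smult 2 (X ^ n * Q * wv) - X ^ Suc n * A * h3)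
      - (X ^ n * P * wv + X ^ n * Q * wu - X ^ Suc n * A * h2)
        * (X ^ n * P * wv + X ^ n * Q * wu - X ^ Suc n * A * h2) = 0"
    and X: "X = [:- r, 1:]"
  shows "poly P r * poly wv r = poly Q r * poly wu r"
proof -
  define F where "F = (smult 2 (P * wu) - X * A * h1) * (smult 2 (Q * wv) - X * A * h3)
      - (P * wv + Q * wu - X * A * h2) * (P * wv + Q * wu - X * A * h2)"
  have "X ^ n * X ^ n * F = 0" using zero by (simp add: F_def algebra_simps)
  then have "F = 0" by (simp add: X)
  then have "poly F r = 0" by simp
  then have "(poly P r * poly wv r - poly Q r * poly wu r) * (poly P r * poly wv r - poly Q r * poly wu r) = 0"
    by (simp add: F_def X algebra_simps)
  then show ?thesis by simp
qed

text \<open>The case in which both constant second derivatives are 0. Let \<open>r\<close> be a zero of \<open>A\<close>, and divide the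
  gradient \<open>(p, q)\<close> of \<open>A\<close> by the highest possible power \<open>n\<close> of \<open>X = [:- r, 1:]\<close>. As \<open>p = pderiv A\<close>, the
  polynomial \<open>A\<close> is divisible by one more power, so its contribution to the coefficients of
  \<open>s\<^sup>2\<close> and \<open>t\<^sup>2\<close> in the determinant of the Schur complement is of higher order. The vanishing of
  these coefficients makes the divided gradient at \<open>r\<close> parallel to both \<open>w1\<close> and \<open>w2\<close>. But \<open>w1\<close> and
  \<open>w2\<close> are linearly independent at \<open>r\<close>, since the square of their determinant \<open>D\<close> is \<open>c\<close>.\<close>

lemma pivot_line_isotropic:
  fixes A q :: "complex poly" and c :: complex
  assumes c: "c \<noteq> 0" and p: "p = pderiv A"
    and det: "\<And>s t r. symdet 0 0 (poly A r)
      (poly w1u r + t * poly p r) (poly w1v r + t * poly q r)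
      (poly w2u r + s * poly p r) (poly w2v r + s * poly q r)
      (poly H0uu r + s * poly H1uu r + t * poly H2uu r + s * t * poly Huu r)
      (poly H0uv r + s * poly H1uv r + t * poly H2uv r + s * t * poly Huv r)
      (poly H0vv r + s * poly H1vv r + t * poly H2vv r + s * t * poly Hvv r) = c"
  shows "pderiv A = 0"
proof (rule ccontr)
  assume nz: "pderiv A \<noteq> 0"
  have S: "(2 * (poly p r * poly w1u r) - poly A r * poly H1uu r)
        * (2 * (poly q r * poly w1v r) - poly A r * poly H1vv r)
      - (poly p r * poly w1v r + poly q r * poly w1u r - poly A r * poly H1uv r)
        * (poly p r * poly w1v r + poly q r * poly w1u r - poly A r * poly H1uv r) = 0"
    and Z: "(2 * poly w1u r * poly w2u r - poly A r * poly H0uu r)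
        * (2 * poly w1v r * poly w2v r - poly A r * poly H0vv r)
      - (poly w1u r * poly w2v r + poly w1v r * poly w2u r - poly A r * poly H0uv r)
        * (poly w1u r * poly w2v r + poly w1v r * poly w2u r - poly A r * poly H0uv r) = - c" for r
  proof -
    have "(0 * s^2 + (2 * (poly p r * poly w1u r) - poly A r * poly H1uu r) * s
          + (2 * poly w1u r * poly w2u r - poly A r * poly H0uu r))
        * (0 * s^2 + (2 * (poly q r * poly w1v r) - poly A r * poly H1vv r) * s
          + (2 * poly w1v r * poly w2v r - poly A r * poly H0vv r))
      - (0 * s^2 + (poly p r * poly w1v r + poly q r * poly w1u r - poly A r * poly H1uv r) * s
          + (poly w1u r * poly w2v r + poly w1v r * poly w2u r - poly A r * poly H0uv r))
        * (0 * s^2 + (poly p r * poly w1v r + poly q r * poly w1u r - poly A r * poly H1uv r) * s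
          + (poly w1u r * poly w2v r + poly w1v r * poly w2u r - poly A r * poly H0uv r)) = - c" for s
      using det[of r 0 s] unfolding symdet_schur_isotropic by (simp add: algebra_simps)
    note * = const_det_quadratic[OF this]
    show "(2 * (poly p r * poly w1u r) - poly A r * poly H1uu r)
        * (2 * (poly q r * poly w1v r) - poly A r * poly H1vv r)
      - (poly p r * poly w1v r + poly q r * poly w1u r - poly A r * poly H1uv r)
        * (poly p r * poly w1v r + poly q r * poly w1u r - poly A r * poly H1uv r) = 0"
      using *(3) by simp
    show "(2 * poly w1u r * poly w2u r - poly A r * poly H0uu r)
        * (2 * poly w1v r * poly w2v r - poly A r * poly H0vv r)
      - (poly w1u r * poly w2v r + poly w1v r * poly w2u r - poly A r * poly H0uv r)
        * (poly w1u r * poly w2v r + poly w1v r * poly w2u r - poly A r * poly H0uv r) = - c"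
      using *(5) .
  qed
  have R: "(2 * (poly p r * poly w2u r) - poly A r * poly H2uu r)
        * (2 * (poly q r * poly w2v r) - poly A r * poly H2vv r)
      - (poly p r * poly w2v r + poly q r * poly w2u r - poly A r * poly H2uv r)
        * (poly p r * poly w2v r + poly q r * poly w2u r - poly A r * poly H2uv r) = 0" for r
  proof -
    have "(0 * t^2 + (2 * (poly p r * poly w2u r) - poly A r * poly H2uu r) * t
          + (2 * poly w1u r * poly w2u r - poly A r * poly H0uu r))
        * (0 * t^2 + (2 * (poly q r * poly w2v r) - poly A r * poly H2vv r) * t
          + (2 * poly w1v r * poly w2v r - poly A r * poly H0vv r))
      - (0 * t^2 + (poly p r * poly w2v r + poly q r * poly w2u r - poly A r * poly H2uv r) * t
          + (poly w1u r * poly w2v r + poly w1v r * poly w2u r - poly A r * poly H0uv r))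
        * (0 * t^2 + (poly p r * poly w2v r + poly q r * poly w2u r - poly A r * poly H2uv r) * t
          + (poly w1u r * poly w2v r + poly w1v r * poly w2u r - poly A r * poly H0uv r)) = - c" for t
      using det[of r t 0] unfolding symdet_schur_isotropic by (simp add: algebra_simps)
    from const_det_quadratic(3)[OF this] show ?thesis by simp
  qed
  have "Polynomial.degree A \<noteq> 0" using nz by (simp add: pderiv_eq_0_iff)
  then have "\<not> constant (poly A)" by (simp add: constant_degree)
  then obtain r where r: "poly A r = 0" using fundamental_theorem_of_algebra by blast
  define X where "X = [:- r, 1:]"
  have A0: "A \<noteq> 0" using nz by auto
  define n where "n = (if q = 0 then order r p else min (order r p) (order r q))"
  have p0: "p \<noteq> 0" using nz p by simp
  have "X ^ n dvd p" "X ^ n dvd q"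
    unfolding X_def by (auto simp: n_def order_divides)
  then obtain P Q where P: "p = X ^ n * P" and Q: "q = X ^ n * Q" by (elim dvdE)
  have PQ: "poly P r \<noteq> 0 \<or> poly Q r \<noteq> 0"
  proof (rule ccontr)
    assume "\<not> ?thesis"
    then have "X dvd P" "X dvd Q" by (simp_all add: X_def poly_eq_0_iff_dvd)
    then have "X ^ Suc n dvd p" "X ^ Suc n dvd q"
      unfolding P Q by (simp_all add: mult_dvd_mono mult.commute)
    then have "Suc n \<le> order r p" "q = 0 \<or> Suc n \<le> order r q"
      using p0 unfolding X_def order_divides by blast+
    then show False by (auto simp: n_def split: if_splits)
  qed
  have "order r A = Suc (order r p)"
    unfolding p by (rule order_pderiv[OF A0 r])
  moreover have "n \<le> order r p" by (simp add: n_def)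
  ultimately have "X ^ Suc n dvd A" unfolding X_def order_divides by simp
  then obtain B where B: "A = X ^ Suc n * B" by (elim dvdE)
  have e1: "poly P r * poly w1v r = poly Q r * poly w1u r"
  proof (rule isotropic_kernel[OF _ X_def])
    show "(smult 2 (X ^ n * P * w1u) - X ^ Suc n * B * H1uu) * (smult 2 (X ^ n * Q * w1v) - X ^ Suc n * B * H1vv)
      - (X ^ n * P * w1v + X ^ n * Q * w1u - X ^ Suc n * B * H1uv)
          * (X ^ n * P * w1v + X ^ n * Q * w1u - X ^ Suc n * B * H1uv) = 0"
      unfolding P[symmetric] Q[symmetric] B[symmetric] by (rule polys_eqI) (use S in simp)
  qed
  have e2: "poly P r * poly w2v r = poly Q r * poly w2u r"
  proof (rule isotropic_kernel[OF _ X_def])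
    show "(smult 2 (X ^ n * P * w2u) - X ^ Suc n * B * H2uu) * (smult 2 (X ^ n * Q * w2v) - X ^ Suc n * B * H2vv)
      - (X ^ n * P * w2v + X ^ n * Q * w2u - X ^ Suc n * B * H2uv)
          * (X ^ n * P * w2v + X ^ n * Q * w2u - X ^ Suc n * B * H2uv) = 0"
      unfolding P[symmetric] Q[symmetric] B[symmetric] by (rule polys_eqI) (use R in simp)
  qed
  define D where "D = poly w1u r * poly w2v r - poly w1v r * poly w2u r"
  have "poly P r * D = poly w1u r * (poly P r * poly w2v r) - (poly P r * poly w1v r) * poly w2u r"
    by (simp add: D_def algebra_simps)
  also have "\<dots> = 0" unfolding e1 e2 by (simp add: mult_ac)
  finally have PD: "poly P r * D = 0" .
  have "poly Q r * D = (poly Q r * poly w1u r) * poly w2v r - poly w1v r * (poly Q r * poly w2u r)"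
    by (simp add: D_def algebra_simps)
  also have "\<dots> = 0" unfolding e1[symmetric] e2[symmetric] by (simp add: mult_ac)
  finally have QD: "poly Q r * D = 0" .
  have "D * D = c" using Z[of r] by (simp add: r D_def algebra_simps)
  with PD QD show False using PQ c by auto
qed

section \<open>Constancy of the mixed derivative\<close>

lemma ddiff_three: "ddiff a (ddiff b (ddiff c p)) = ddiff c (ddiff a (ddiff b p))"
  by (simp only: ddiff_commute[of b c] ddiff_commute[of a c])

lemma ddiff_ddiff_ddiff_const:
  assumes "ddiff z (ddiff z p) = Const k"
  shows "ddiff z (ddiff z (ddiff b p)) = 0"
  by (simp add: ddiff_three[of z z b] assms ddiff_Const)

definition four_rows :: "'a^4 \<Rightarrow> 'a^4 \<Rightarrow> 'a^4 \<Rightarrow> 'a^4 \<Rightarrow> 'a^4^4"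
  where "four_rows a b c d = (\<chi> i. if i = 1 then a else if i = 2 then b else if i = 3 then c else d)"

lemma four_rows_nth [simp]:
  "four_rows a b c d $ 1 = a" "four_rows a b c d $ 2 = b" "four_rows a b c d $ 3 = c" "four_rows a b c d $ 4 = d"
  by (simp_all add: four_rows_def)

lemma peval_det_hess: "peval (det (hess p)) x = det (hess_at p x)"
  by (simp add: peval.hom_det hess_at_def)

lemma congruent_hess:
  "(E ** hess_at p x ** transpose E) $ i $ j = peval (ddiff (E $ i) (ddiff (E $ j) p)) x"
proof -
  have "(E ** hess_at p x ** transpose E) $ i $ j
      = (\<Sum>l\<in>UNIV. \<Sum>k\<in>UNIV. E $ i $ k * E $ j $ l * hess_at p x $ k $ l)"
    by (simp add: matrix_matrix_mult_def transpose_def sum_distrib_left mult_ac)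
  also have "\<dots> = (\<Sum>k\<in>UNIV. \<Sum>l\<in>UNIV. E $ i $ k * E $ j $ l * hess_at p x $ k $ l)"
    by (rule sum.swap)
  finally show ?thesis by (simp add: peval_ddiff_ddiff)
qed

text \<open>Let \<open>\<alpha>\<close> be the mixed derivative. Since the two pure second derivatives are constant, derivatives that
  contain \<open>z1\<close> or \<open>z2\<close> twice besides further directions vanish. Consequently \<open>\<alpha>\<close> and its gradient
  do not change along the plane of \<open>z1\<close> and \<open>z2\<close>, and every entry of the Hessian matrix is affine in each
  of the plane coordinates \<open>s\<close>, \<open>t\<close>, with coefficients that are polynomials in the parameter of a line
  in direction \<open>u\<close>. In the basis \<open>z1\<close>, \<open>z2\<close>, \<open>u\<close>, \<open>v\<close> this is the situation of
  \<open>pivot_line_nonisotropic\<close> or \<open>pivot_line_isotropic\<close>.\<close>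

lemma mixed_derivative_constant_along:
  fixes \<Phi> :: "(4, complex) mpol"
  assumes det: "det (hess \<Phi>) = Const \<kappa>" "\<kappa> \<noteq> 0"
    and E: "det (four_rows z1 z2 u v) \<noteq> 0"
    and k1: "ddiff z1 (ddiff z1 \<Phi>) = Const k1" and k2: "ddiff z2 (ddiff z2 \<Phi>) = Const k2"
    and k: "k1 = 0 \<longleftrightarrow> k2 = 0"
  shows "ddiff u (ddiff z1 (ddiff z2 \<Phi>)) = 0"
proof (rule ccontr)
  define \<alpha> where "\<alpha> = ddiff z1 (ddiff z2 \<Phi>)"
  assume "ddiff u (ddiff z1 (ddiff z2 \<Phi>)) \<noteq> 0"
  then obtain x0 where x0: "peval (ddiff u \<alpha>) x0 \<noteq> 0"
    using peval_eq_0_imp[of "ddiff u \<alpha>"] by (auto simp: \<alpha>_def)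
  define L where "L = line_poly x0 u"
  have L: "poly (L p) r = peval p (x0 + r *s u)" for p r
    by (simp add: L_def poly_line_poly)
  define A where "A = L \<alpha>"
  define p where "p = L (ddiff u \<alpha>)"
  define q where "q = L (ddiff v \<alpha>)"
  define c where "c = det (four_rows z1 z2 u v) * \<kappa> * det (four_rows z1 z2 u v)"
  have c: "c \<noteq> 0" using det E by (simp add: c_def)
  have p: "p = pderiv A" by (simp add: p_def A_def L_def pderiv_line_poly)
  have \<alpha>': "ddiff z2 (ddiff z1 \<Phi>) = \<alpha>" by (simp add: \<alpha>_def ddiff_commute[of z2 z1])
  have z1\<alpha>: "ddiff z1 \<alpha> = 0" unfolding \<alpha>_def by (rule ddiff_ddiff_ddiff_const[OF k1])
  have z2\<alpha>: "ddiff z2 \<alpha> = 0" unfolding \<alpha>'[symmetric] by (rule ddiff_ddiff_ddiff_const[OF k2])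
  have \<alpha>2: "ddiff z1 (ddiff z2 (ddiff b \<Phi>)) = ddiff b \<alpha>" for b
    unfolding \<alpha>_def by (rule ddiff_three)
  have z1b: "ddiff z1 (ddiff z1 (ddiff b \<Phi>)) = 0" for b by (rule ddiff_ddiff_ddiff_const[OF k1])
  have z2b: "ddiff z2 (ddiff z2 (ddiff b \<Phi>)) = 0" for b by (rule ddiff_ddiff_ddiff_const[OF k2])
  have z1\<alpha>b: "ddiff z1 (ddiff b \<alpha>) = 0" and z2\<alpha>b: "ddiff z2 (ddiff b \<alpha>) = 0" for b
    using z1\<alpha> z2\<alpha> by (simp_all add: ddiff_commute[of _ b] ddiff_0)
  define pt where "pt r s t = x0 + r *s u + s *s z1 + t *s z2" for r s t
  have e12: "peval \<alpha> (pt r s t) = poly A r" for r s t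
    unfolding pt_def A_def L
    using peval_biaffine[of z1 \<alpha> z2 "x0 + r *s u" s t] by (simp add: z1\<alpha> z2\<alpha> ddiff_0 peval.hom_zero)
  have e1: "peval (ddiff z1 (ddiff b \<Phi>)) (pt r s t)
      = poly (L (ddiff z1 (ddiff b \<Phi>))) r + t * poly (L (ddiff b \<alpha>)) r" for b r s t
  proof -
    have 0: "ddiff z2 (ddiff z1 (ddiff b \<Phi>)) = ddiff b \<alpha>"
      using \<alpha>2[of b] by (simp add: ddiff_commute[of z2 z1])
    show ?thesis
      unfolding pt_def L
      using peval_biaffine[of z1 "ddiff z1 (ddiff b \<Phi>)" z2 "x0 + r *s u" s t]
      by (simp add: z1b 0 z1\<alpha>b z2\<alpha>b ddiff_0 peval.hom_zero)
  qed
  have e2: "peval (ddiff z2 (ddiff b \<Phi>)) (pt r s t)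
      = poly (L (ddiff z2 (ddiff b \<Phi>))) r + s * poly (L (ddiff b \<alpha>)) r" for b r s t
    unfolding pt_def L
    using peval_biaffine[of z1 "ddiff z2 (ddiff b \<Phi>)" z2 "x0 + r *s u" s t]
    by (simp add: z2b \<alpha>2 z1\<alpha>b z2\<alpha>b ddiff_0 peval.hom_zero)
  have e3: "peval (ddiff b (ddiff d \<Phi>)) (pt r s t)
      = poly (L (ddiff b (ddiff d \<Phi>))) r + s * poly (L (ddiff z1 (ddiff b (ddiff d \<Phi>)))) r
        + t * poly (L (ddiff z2 (ddiff b (ddiff d \<Phi>)))) r
        + s * t * poly (L (ddiff z1 (ddiff z2 (ddiff b (ddiff d \<Phi>))))) r" for b d r s t
  proof -
    have "ddiff z1 (ddiff z1 (ddiff b (ddiff d \<Phi>))) = 0"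
      using z1b[of d] by (simp only: ddiff_three[of z1 z1 b] ddiff_0)
    moreover have "ddiff z2 (ddiff z2 (ddiff b (ddiff d \<Phi>))) = 0"
      using z2b[of d] by (simp only: ddiff_three[of z2 z2 b] ddiff_0)
    ultimately show ?thesis unfolding pt_def L by (rule peval_biaffine)
  qed
  define H where "H b d = L (ddiff z1 (ddiff z2 (ddiff b (ddiff d \<Phi>))))" for b d
  have Huu: "H u u = pderiv p"
  proof -
    have "ddiff z1 (ddiff z2 (ddiff u (ddiff u \<Phi>))) = ddiff u (ddiff u \<alpha>)"
      unfolding \<alpha>2[of u, symmetric] by (rule ddiff_three)
    then show ?thesis by (simp add: H_def p_def L_def pderiv_line_poly)
  qed
  have symdet: "symdet k1 k2 (poly A r)
      (poly (L (ddiff z1 (ddiff u \<Phi>))) r + t * poly p r) (poly (L (ddiff z1 (ddiff v \<Phi>))) r + t * poly q r)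
      (poly (L (ddiff z2 (ddiff u \<Phi>))) r + s * poly p r) (poly (L (ddiff z2 (ddiff v \<Phi>))) r + s * poly q r)
      (poly (L (ddiff u (ddiff u \<Phi>))) r + s * poly (L (ddiff z1 (ddiff u (ddiff u \<Phi>)))) r
        + t * poly (L (ddiff z2 (ddiff u (ddiff u \<Phi>)))) r + s * t * poly (H u u) r)
      (poly (L (ddiff u (ddiff v \<Phi>))) r + s * poly (L (ddiff z1 (ddiff u (ddiff v \<Phi>)))) r
        + t * poly (L (ddiff z2 (ddiff u (ddiff v \<Phi>)))) r + s * t * poly (H u v) r)
      (poly (L (ddiff v (ddiff v \<Phi>))) r + s * poly (L (ddiff z1 (ddiff v (ddiff v \<Phi>)))) r
        + t * poly (L (ddiff z2 (ddiff v (ddiff v \<Phi>)))) r + s * t * poly (H v v) r) = c" for r s t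
  proof -
    define F where "F = four_rows z1 z2 u v"
    define M where "M = F ** hess_at \<Phi> (pt r s t) ** transpose F"
    have M: "M $ i $ j = peval (ddiff (F $ i) (ddiff (F $ j) \<Phi>)) (pt r s t)" for i j
      unfolding M_def by (rule congruent_hess)
    have "det M = c"
      by (simp add: M_def det_mul c_def F_def peval_det_hess[symmetric] det(1) peval_Const)
    moreover have "M $ i $ j = M $ j $ i" for i j unfolding M by (simp only: ddiff_commute)
    ultimately have *: "symdet (M$1$1) (M$2$2) (M$1$2) (M$1$3) (M$1$4) (M$2$3) (M$2$4) (M$3$3) (M$3$4) (M$4$4) = c"
      using det_4_symmetric[of M] by simp
    have F: "F $ 1 = z1" "F $ 2 = z2" "F $ 3 = u" "F $ 4 = v" by (simp_all add: F_def)
    show ?thesis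
      using *
      unfolding M F k1 k2 peval_Const \<alpha>_def[symmetric]
      unfolding e12 e1 e2
      unfolding e3 p_def q_def H_def .
  qed
  have "pderiv A = 0"
  proof (cases "k1 = 0")
    case True
    then have "k2 = 0" using k by simp
    from pivot_line_isotropic[OF c p symdet[unfolded True this]] show ?thesis .
  next
    case False
    then have "k2 \<noteq> 0" using k by simp
    from pivot_line_nonisotropic[OF False this c p Huu symdet] show ?thesis .
  qed
  then have "poly p 0 = 0" by (simp add: p)
  with x0 show False by (simp add: p_def L)
qed

text \<open>The preceding lemma applies with \<open>u\<close> and \<open>v\<close> exchanged as well, so that the derivatives of the mixed
  derivative vanish along a basis.\<close>

theorem mixed_derivative_constant:
  fixes \<Phi> :: "(4, complex) mpol"
  assumes det: "det (hess \<Phi>) = Const \<kappa>" "\<kappa> \<noteq> 0"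
    and E: "det (four_rows z1 z2 u v) \<noteq> 0"
    and k1: "ddiff z1 (ddiff z1 \<Phi>) = Const k1" and k2: "ddiff z2 (ddiff z2 \<Phi>) = Const k2"
    and k: "k1 = 0 \<longleftrightarrow> k2 = 0"
  shows "\<exists>a. ddiff z1 (ddiff z2 \<Phi>) = Const a"
proof -
  define \<alpha> where "\<alpha> = ddiff z1 (ddiff z2 \<Phi>)"
  have u: "ddiff u \<alpha> = 0"
    unfolding \<alpha>_def by (rule mixed_derivative_constant_along[OF det E k1 k2 k])
  have "det (four_rows z1 z2 v u) = - det (four_rows z1 z2 u v)"
    by (simp add: det_4 algebra_simps)
  then have E': "det (four_rows z1 z2 v u) \<noteq> 0" using E by simp
  have v: "ddiff v \<alpha> = 0"
    unfolding \<alpha>_def by (rule mixed_derivative_constant_along[OF det E' k1 k2 k])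
  have z1: "ddiff z1 \<alpha> = 0" unfolding \<alpha>_def by (rule ddiff_ddiff_ddiff_const[OF k1])
  have z2: "ddiff z2 \<alpha> = 0"
    unfolding \<alpha>_def ddiff_commute[of z1 z2] by (rule ddiff_ddiff_ddiff_const[OF k2])
  have "peval \<alpha> x = peval \<alpha> 0" for x
  proof -
    define F where "F = transpose (four_rows z1 z2 u v)"
    have "invertible F" using E by (simp add: F_def invertible_det_nz)
    then obtain G where "F ** G = mat 1" by (auto simp: invertible_def)
    then have "F *v (G *v x) = x" by (simp add: matrix_vector_mul_assoc)
    then obtain y where y: "F *v y = x" by blast
    have "x = y $ 1 *s z1 + y $ 2 *s z2 + y $ 3 *s u + y $ 4 *s v"
      unfolding y[symmetric] F_def
      by (simp add: vec_eq_iff matrix_vector_mult_def transpose_def sum_4 mult.commute)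
    then have "ddiff x \<alpha> = 0"
      by (simp add: ddiff_add_left ddiff_scale_left u v z1 z2)
    from peval_const_along[OF this, of 0 1] show ?thesis by simp
  qed
  then show ?thesis unfolding \<alpha>_def[symmetric] using peval_const_imp by blast
qed

section \<open>Constant pivots and common zeros of the Hesse system\<close>

definition cvec :: "real^'n \<Rightarrow> complex^'n"
  where "cvec x = (\<chi> i. complex_of_real (x $ i))"

definition cnj_vec :: "complex^'n \<Rightarrow> complex^'n"
  where "cnj_vec z = (\<chi> i. cnj (z $ i))"

lemma ring_1_hom_of_real: "ring_1_hom complex_of_real"
  by unfold_locales simp_all

interpretation complexify: ring_1_hom "complexify :: ('n, real) mpol \<Rightarrow> _"
  unfolding complexify_def by (rule ring_1_hom_map[OF ring_1_hom_of_real])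

lemma complexify_single: "complexify (monom m a) = monom m (complex_of_real a)"
  by (simp add: complexify_def)

lemma peval_complexify: "peval (complexify p) (cvec x) = complex_of_real (peval p x)"
  by (induction p rule: poly_mapping_single_induct)
    (simp_all add: complexify_single peval_single complexify.hom_add peval_add cvec_def)

lemma peval_complexify_cnj: "peval (complexify p) (cnj_vec z) = cnj (peval (complexify p) z)"
  by (induction p rule: poly_mapping_single_induct)
    (simp_all add: complexify_single peval_single complexify.hom_add peval_add cnj_vec_def)

lemma complexify_pdiff: "complexify (pdiff i p) = pdiff i (complexify p)"
  by (induction p rule: poly_mapping_single_induct)
    (simp_all add: complexify_single pdiff_single complexify.hom_add pdiff_add)

lemma complexify_ddiff: "complexify (ddiff \<xi> p) = ddiff (cvec \<xi>) (complexify p)"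
proof -
  have "complexify (pscale c q) = pscale (complex_of_real c) (complexify q)" for c :: real and q :: "('a, real) mpol"
    by (simp add: pscale_eq complexify.hom_mult complexify_single)
  then show ?thesis
    by (simp add: ddiff_def complexify.hom_sum complexify_pdiff cvec_def)
qed

lemma hess_complexify: "det (hess (complexify p)) = complexify (det (hess p))"
  by (simp add: complexify.hom_det hess_def complexify_pdiff)

lemma peval_ddiff_ddiff_cnj:
  "peval (ddiff (cnj_vec z) (ddiff (cnj_vec w) (complexify p))) (cnj_vec x)
    = cnj (peval (ddiff z (ddiff w (complexify p))) x)"
proof -
  have "hess_at (complexify p) (cnj_vec x) $ i $ j = cnj (hess_at (complexify p) x $ i $ j)" for i j
    by (simp add: hess_at_def hess_def peval_complexify_cnj flip: complexify_pdiff)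
  then show ?thesis by (simp add: peval_ddiff_ddiff) (simp add: cnj_vec_def)
qed

lemma ddiff_ddiff_cnj_const:
  fixes p :: "('n::finite, real) mpol"
  assumes "ddiff z (ddiff z (complexify p)) = Const k"
  shows "ddiff (cnj_vec z) (ddiff (cnj_vec z) (complexify p)) = Const (cnj k)"
proof (rule peval_const_imp)
  fix x :: "complex^'n"
  have "x = cnj_vec (cnj_vec x)" by (simp add: cnj_vec_def)
  then show "peval (ddiff (cnj_vec z) (ddiff (cnj_vec z) (complexify p))) x = cnj k"
    using peval_ddiff_ddiff_cnj[of z z p "cnj_vec x"] by (simp add: assms peval_Const)
qed

lemma constant_pivot_iff: "constant_pivot \<phi> \<xi> \<longleftrightarrow> \<xi> \<noteq> 0 \<and> (\<exists>k. ddiff \<xi> (ddiff \<xi> \<phi>) = Const k)"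
proof -
  have "(hess_at \<phi> x *v \<xi>) \<bullet> \<xi> = peval (ddiff \<xi> (ddiff \<xi> \<phi>)) x" for x
    unfolding peval_ddiff_ddiff inner_vec_def matrix_vector_mult_def
    by (simp add: sum_distrib_left mult_ac)
  moreover have "(\<exists>c. \<forall>x. peval p x = c) \<longleftrightarrow> (\<exists>k. p = Const k)" for p :: "('a, real) mpol"
    using peval_const_imp peval_Const by metis
  ultimately show ?thesis by (simp add: constant_pivot_def)
qed

lemma pivot_of_complex:
  assumes "\<xi> \<noteq> 0" "ddiff (cvec \<xi>) (ddiff (cvec \<xi>) (complexify \<phi>)) = Const k"
  shows "constant_pivot \<phi> \<xi>"
proof -
  have "complex_of_real (peval (ddiff \<xi> (ddiff \<xi> \<phi>)) x) = k" for x
    using assms(2) by (simp add: complexify_ddiff peval_Const flip: peval_complexify)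
  then have "peval (ddiff \<xi> (ddiff \<xi> \<phi>)) x = Re k" for x by (metis Re_complex_of_real)
  then have "ddiff \<xi> (ddiff \<xi> \<phi>) = Const (Re k)" by (rule peval_const_imp)
  with assms(1) show ?thesis by (auto simp: constant_pivot_iff)
qed

lemma peval_hess_form: "peval (hess_form \<phi> c) z = peval (ddiff z (ddiff z (complexify \<phi>))) c"
proof -
  have "peval (monom (Poly_Mapping.single i 1 + Poly_Mapping.single j 1) a) z = a * (z $ i * z $ j)" for i j a
  proof -
    have "monom (Poly_Mapping.single i 1 + Poly_Mapping.single j 1) a = Const a * (Var i * Var j)"
      by (simp add: Poly_Mapping.mult_single)
    then show ?thesis by (simp only: peval_mult peval_Const peval_Var)
  qed
  then show ?thesis
    by (simp only: hess_form_def peval.hom_sum peval_ddiff_ddiff mult.commute)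
qed

lemma common_zero_iff:
  "(\<forall>q\<in>hesse_system \<phi>. peval q z = 0) \<longleftrightarrow> (\<exists>k. ddiff z (ddiff z (complexify \<phi>)) = Const k)"
proof
  assume zero: "\<forall>q\<in>hesse_system \<phi>. peval q z = 0"
  have "peval (ddiff z (ddiff z (complexify \<phi>))) a = peval (ddiff z (ddiff z (complexify \<phi>))) 0" for a
  proof -
    have "hess_form \<phi> a - hess_form \<phi> 0 \<in> hesse_system \<phi>"
      unfolding hesse_system_def by (rule pvs.span_base) blast
    with zero have "peval (hess_form \<phi> a - hess_form \<phi> 0) z = 0" by blast
    then show ?thesis by (simp add: peval.hom_diff peval_hess_form)
  qed
  then show "\<exists>k. ddiff z (ddiff z (complexify \<phi>)) = Const k" using peval_const_imp by blast
next
  assume "\<exists>k. ddiff z (ddiff z (complexify \<phi>)) = Const k"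
  then obtain k where k: "ddiff z (ddiff z (complexify \<phi>)) = Const k" by blast
  have "hesse_system \<phi> \<subseteq> {q. peval q z = 0}"
    unfolding hesse_system_def
  proof (rule pvs.span_minimal)
    show "{hess_form \<phi> a - hess_form \<phi> b |a b. True} \<subseteq> {q. peval q z = 0}"
      by (auto simp: peval.hom_diff peval_hess_form k peval_Const)
    show "pvs.subspace {q. peval q z = 0}"
      by (rule pvs.subspaceI) (auto simp: peval.hom_zero peval_add peval_pscale)
  qed
  then show "\<forall>q\<in>hesse_system \<phi>. peval q z = 0" by blast
qed

text \<open>If no choice of \<open>u\<close>, \<open>v\<close> works, unit vectors show that all 2 by 2 minors of the rows \<open>z\<close> and \<open>cnj_vec z\<close>
  vanish, and then \<open>z\<close> becomes real on multiplication by the conjugate of one of its nonzero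
  coordinates.\<close>

lemma complex_line_cases:
  fixes z :: "complex^4"
  assumes "z \<noteq> 0"
  obtains u v where "det (four_rows z (cnj_vec z) u v) \<noteq> 0"
  | c \<xi> where "\<xi> \<noteq> 0" "cvec \<xi> = c *s z"
proof (cases "\<exists>u v. det (four_rows z (cnj_vec z) u v) \<noteq> 0")
  case True
  then show ?thesis using that by blast
next
  case False
  then have 0: "det (four_rows z (cnj_vec z) u v) = 0" for u v by blast
  have minors: "z $ i * cnj (z $ j) = z $ j * cnj (z $ i)" for i j
  proof -
    have "\<forall>i j. z $ i * cnj (z $ j) = z $ j * cnj (z $ i)"
      using 0[of "axis 1 1" "axis 2 1"] 0[of "axis 1 1" "axis 3 1"] 0[of "axis 1 1" "axis 4 1"]
        0[of "axis 2 1" "axis 3 1"] 0[of "axis 2 1" "axis 4 1"] 0[of "axis 3 1" "axis 4 1"]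
      by (simp add: det_4 axis_def cnj_vec_def forall_4)
    then show ?thesis by blast
  qed
  obtain i where i: "z $ i \<noteq> 0" using assms by (auto simp: vec_eq_iff)
  define c where "c = cnj (z $ i)"
  define \<xi> where "\<xi> = (\<chi> j. Re (c * z $ j))"
  have real: "complex_of_real (Re (c * z $ j)) = c * z $ j" for j
  proof -
    have "cnj (c * z $ j) = c * z $ j" using minors[of i j] by (simp add: c_def mult.commute)
    then show ?thesis by (metis Reals_cnj_iff of_real_Re)
  qed
  have cv: "cvec \<xi> = c *s z" 
    by (simp only: vec_eq_iff cvec_def \<xi>_def vec_lambda_beta real vector_smult_component) simp
  have "\<xi> \<noteq> 0"
  proof
    assume "\<xi> = 0"
    then have "(c *s z) $ i = 0" unfolding cv[symmetric] by (simp add: cvec_def)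
    with i show False by (simp add: c_def)
  qed
  with cv that show ?thesis by blast
qed

text \<open>When \<open>z\<close> and its conjugate are independent, all three second derivatives in these two directions are
  constant; the real and the imaginary part of \<open>z\<close> are combinations of them, and one of the two is
  nonzero.\<close>

theorem pivot_iff_common_zero:
  fixes \<phi> :: "(4, real) mpol"
  assumes det: "det (hess \<phi>) = 1 \<or> det (hess \<phi>) = - 1"
  shows "(\<exists>\<xi>. constant_pivot \<phi> \<xi>) \<longleftrightarrow> (\<exists>z. z \<noteq> 0 \<and> (\<forall>q\<in>hesse_system \<phi>. peval q z = 0))"
proof
  assume "\<exists>\<xi>. constant_pivot \<phi> \<xi>"
  then obtain \<xi> k where \<xi>: "\<xi> \<noteq> 0" "ddiff \<xi> (ddiff \<xi> \<phi>) = Const k" by (auto simp: constant_pivot_iff)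
  have "ddiff (cvec \<xi>) (ddiff (cvec \<xi>) (complexify \<phi>)) = Const (complex_of_real k)"
    by (simp add: \<xi>(2) complexify_single flip: complexify_ddiff)
  moreover have "cvec \<xi> \<noteq> 0" using \<xi>(1) by (auto simp: vec_eq_iff cvec_def)
  ultimately show "\<exists>z. z \<noteq> 0 \<and> (\<forall>q\<in>hesse_system \<phi>. peval q z = 0)"
    unfolding common_zero_iff by blast
next
  define \<Phi> where "\<Phi> = complexify \<phi>"
  assume "\<exists>z. z \<noteq> 0 \<and> (\<forall>q\<in>hesse_system \<phi>. peval q z = 0)"
  then obtain z k where z: "z \<noteq> 0" and k: "ddiff z (ddiff z \<Phi>) = Const k"
    unfolding common_zero_iff \<Phi>_def by blast
  obtain \<kappa> where \<kappa>: "det (hess \<Phi>) = Const \<kappa>" "\<kappa> \<noteq> 0"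
  proof (rule that)
    show "det (hess \<Phi>) = Const (if det (hess \<phi>) = 1 then 1 else - 1)"
      using det by (auto simp: \<Phi>_def hess_complexify complexify.hom_one complexify.hom_uminus
          Poly_Mapping.single_uminus)
  qed simp
  from z show "\<exists>\<xi>. constant_pivot \<phi> \<xi>"
  proof (cases rule: complex_line_cases)
    case (1 u v)
    have k': "ddiff (cnj_vec z) (ddiff (cnj_vec z) \<Phi>) = Const (cnj k)"
      unfolding \<Phi>_def by (rule ddiff_ddiff_cnj_const) (use k in \<open>simp add: \<Phi>_def\<close>)
    obtain a where a: "ddiff z (ddiff (cnj_vec z) \<Phi>) = Const a"
      using mixed_derivative_constant[OF \<kappa> 1 k k'] by auto
    have comb: "\<exists>l. ddiff w (ddiff w \<Phi>) = Const l" if w: "w = b *s z + c *s cnj_vec z" for w b c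
    proof -
      have "ddiff w (ddiff w \<Phi>) = pscale b (ddiff z (ddiff w \<Phi>)) + pscale c (ddiff (cnj_vec z) (ddiff w \<Phi>))"
        by (simp add: w ddiff_add_left ddiff_scale_left)
      also have "\<dots> = Const (b * (b * k + c * a) + c * (b * a + c * cnj k))"
        by (simp add: w ddiff_add_left ddiff_scale_left ddiff_add_right ddiff_pscale k k' a
            ddiff_commute[of "cnj_vec z" z] Poly_Mapping.single_add[symmetric])
      finally show ?thesis by blast
    qed
    define \<xi> where "\<xi> = (\<chi> i. Re (z $ i))"
    define \<eta> where "\<eta> = (\<chi> i. Im (z $ i))"
    have "cvec \<xi> = (1 / 2) *s z + (1 / 2) *s cnj_vec z"
      by (simp add: vec_eq_iff cvec_def \<xi>_def cnj_vec_def complex_eq_iff)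
    then have \<xi>: "\<exists>l. ddiff (cvec \<xi>) (ddiff (cvec \<xi>) \<Phi>) = Const l" by (rule comb)
    have "cvec \<eta> = (- \<i> / 2) *s z + (\<i> / 2) *s cnj_vec z"
      by (simp add: vec_eq_iff cvec_def \<eta>_def cnj_vec_def complex_eq_iff)
    then have \<eta>: "\<exists>l. ddiff (cvec \<eta>) (ddiff (cvec \<eta>) \<Phi>) = Const l" by (rule comb)
    have "\<xi> \<noteq> 0 \<or> \<eta> \<noteq> 0"
      using z by (auto simp: vec_eq_iff \<xi>_def \<eta>_def complex_eq_iff)
    with \<xi> \<eta> show ?thesis using pivot_of_complex unfolding \<Phi>_def by blast
  next
    case (2 c \<xi>)
    have "ddiff (cvec \<xi>) (ddiff (cvec \<xi>) \<Phi>) = Const (c * c * k)"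
      by (simp add: 2 ddiff_scale_left ddiff_pscale k mult.assoc)
    with 2 show ?thesis using pivot_of_complex unfolding \<Phi>_def by blast
  qed
qed

theorem corollary4p10:
  fixes \<phi> :: "(4, real) mpol"
  assumes "unimodular_hessian_potential 1 \<phi>"
  shows "(\<exists>\<xi>. constant_pivot \<phi> \<xi>) \<longleftrightarrow> mu_rank \<phi> \<le> 55"
proof -
  have "det (hess \<phi>) = 1 \<or> det (hess \<phi>) = - 1"
    using assms by (simp add: unimodular_hessian_potential_def)
  then show ?thesis by (simp only: pivot_iff_common_zero mu_rank_le_iff_common_zero)
qed

end
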